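(* Suppose that a symmetric matrix $A=(a_{ij})_{1\le i,j\le n}$ has exactly one positive eigenvalue and satisfies $a_{ij}\ge0$ for any $1\le i,j\le n$ and $\sum_{j=1}^na_{ij}>0$ for each $i=1,\dots,n$. Then the system $$-\Delta u_i+\lambda u_i=\sum_{j=1}^na_{ij}u_iu_j^2\ \text{ in }\Omega,\quad u_i\in H,\quad 1\le i\le n,$$ has no positive vector solutions if there exists no vector $\vec c=(c_1,\dots,c_n)\in\mathbb{R}^n$ satisfying $\sum_{j=1}^na_{ij}c_j^2=1$ and $c_i\ne0$ for each $i=1,\dots,n$.
   Context: $\Omega\subset\mathbb{R}^N$ is a domain, $N\le 3$, $\lambda>0$. $H=H^1_0(\Omega)$, except that if $\Omega=\mathbb{R}^N$ then $H$ is the subspace of radially symmetric functions in $H^1(\mathbb{R}^N)$. A positive vector solution is a solution with $u_i>0$ in $\Omega$ for every $i$. Eigenvalues are counted with multiplicity. *)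

theory Defs
  imports "HOL-Analysis.Analysis"
begin

definition grad :: "(real^'N \<Rightarrow> real) \<Rightarrow> real^'N \<Rightarrow> real^'N" where
  "grad f x = (\<chi> k. frechet_derivative f (at x) (axis k 1))"

text \<open>\<open>C_k m f\<close>: all partial derivatives of \<open>f\<close> up to order \<open>m\<close> exist and are continuous on the
  whole space.\<close>

primrec C_k :: "nat \<Rightarrow> (real^'N \<Rightarrow> real) \<Rightarrow> bool" where
  "C_k 0 f \<longleftrightarrow> continuous_on UNIV f"
| "C_k (Suc m) f \<longleftrightarrow> (\<forall>x. f differentiable (at x)) \<and> (\<forall>k. C_k m (\<lambda>x. grad f x $ k))"

definition test_functions :: "(real^'N) set \<Rightarrow> (real^'N \<Rightarrow> real) set" where
  "test_functions \<Omega> =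
     {\<phi>. (\<forall>m. C_k m \<phi>) \<and> compact (closure {x. \<phi> x \<noteq> 0}) \<and> closure {x. \<phi> x \<noteq> 0} \<subseteq> \<Omega>}"

text \<open>Elements of Lebesgue and Sobolev spaces are represented by functions on the whole space;
  their values outside \<open>\<Omega>\<close> and on null sets are irrelevant.\<close>

definition L2 :: "(real^'N) set \<Rightarrow> (real^'N \<Rightarrow> 'b::euclidean_space) set" where
  "L2 \<Omega> = {f. f \<in> borel_measurable (lebesgue_on \<Omega>) \<and>
               integrable (lebesgue_on \<Omega>) (\<lambda>x. (norm (f x))\<^sup>2)}"

definition has_weak_gradient ::
    "(real^'N) set \<Rightarrow> (real^'N \<Rightarrow> real) \<Rightarrow> (real^'N \<Rightarrow> real^'N) \<Rightarrow> bool" where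
  "has_weak_gradient \<Omega> u g \<longleftrightarrow>
     (\<forall>K. compact K \<and> K \<subseteq> \<Omega> \<longrightarrow> u absolutely_integrable_on K \<and> g absolutely_integrable_on K) \<and>
     (\<forall>\<phi>\<in>test_functions \<Omega>. \<forall>k.
        (\<integral>x. u x * grad \<phi> x $ k \<partial>lebesgue_on \<Omega>) = - (\<integral>x. g x $ k * \<phi> x \<partial>lebesgue_on \<Omega>))"

definition H1 :: "(real^'N) set \<Rightarrow> (real^'N \<Rightarrow> real) set" where
  "H1 \<Omega> = {u \<in> L2 \<Omega>. \<exists>g\<in>L2 \<Omega>. has_weak_gradient \<Omega> u g}"

text \<open>The closure of the test functions in \<open>H1 \<Omega>\<close> with respect to the \<open>H1\<close> norm.\<close>

definition H1_0 :: "(real^'N) set \<Rightarrow> (real^'N \<Rightarrow> real) set" where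
  "H1_0 \<Omega> = {u \<in> L2 \<Omega>. \<exists>g\<in>L2 \<Omega>. has_weak_gradient \<Omega> u g \<and>
     (\<forall>\<epsilon>>0. \<exists>\<phi>\<in>test_functions \<Omega>.
        (\<integral>x. (u x - \<phi> x)\<^sup>2 + (norm (g x - grad \<phi> x))\<^sup>2 \<partial>lebesgue_on \<Omega>) < \<epsilon>)}"

definition radially_symmetric :: "(real^'N \<Rightarrow> real) \<Rightarrow> bool" where
  "radially_symmetric u \<longleftrightarrow> (\<exists>\<rho>. AE x in lebesgue. u x = \<rho> (norm x))"

definition sol_space :: "(real^'N) set \<Rightarrow> (real^'N \<Rightarrow> real) set" where
  "sol_space \<Omega> = (if \<Omega> = UNIV then {u \<in> H1 UNIV. radially_symmetric u} else H1_0 \<Omega>)"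

text \<open>Weak solutions of \<open>-\<Delta>u\<^sub>i + lam u\<^sub>i = \<Sum>\<^sub>j a\<^sub>i\<^sub>j u\<^sub>i u\<^sub>j\<^sup>2\<close> in \<open>\<Omega>\<close>. The integral of the nonlinearity against
  a test element is required to exist; for \<open>N \<le> 3\<close> this is automatic, since \<open>H1_0 \<Omega>\<close> (and \<open>H1 UNIV\<close>)
  embeds into \<open>L\<^sup>4\<close>. Weak gradients are unique up to null sets and exist for all functions involved,
  so quantifying over all \<open>g\<close>, \<open>h\<close> amounts to speaking of the weak gradient.\<close>

definition weak_solution ::
    "(real^'N) set \<Rightarrow> real \<Rightarrow> real^'n^'n \<Rightarrow> ('n \<Rightarrow> real^'N \<Rightarrow> real) \<Rightarrow> bool" where
  "weak_solution \<Omega> lam A u \<longleftrightarrow>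
     (\<forall>i. u i \<in> sol_space \<Omega>) \<and>
     (\<forall>i. \<forall>v\<in>H1_0 \<Omega>. \<forall>g h. has_weak_gradient \<Omega> (u i) g \<and> has_weak_gradient \<Omega> v h \<longrightarrow>
        has_bochner_integral (lebesgue_on \<Omega>)
          (\<lambda>x. (\<Sum>j\<in>UNIV. A $ i $ j * u i x * (u j x)\<^sup>2) * v x)
          (\<integral>x. g x \<bullet> h x + lam * u i x * v x \<partial>lebesgue_on \<Omega>))"

definition positive_vector_solution ::
    "(real^'N) set \<Rightarrow> real \<Rightarrow> real^'n^'n \<Rightarrow> ('n \<Rightarrow> real^'N \<Rightarrow> real) \<Rightarrow> bool" where
  "positive_vector_solution \<Omega> lam A u \<longleftrightarrow>
     weak_solution \<Omega> lam A u \<and> (\<forall>i. AE x in lebesgue_on \<Omega>. u i x > 0)"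

definition eigenspace :: "real^'n^'n \<Rightarrow> real \<Rightarrow> (real^'n) set" where
  "eigenspace A \<mu> = {v. A *v v = \<mu> *\<^sub>R v}"

definition is_eigenvalue :: "real^'n^'n \<Rightarrow> real \<Rightarrow> bool" where
  "is_eigenvalue A \<mu> \<longleftrightarrow> (\<exists>v. v \<noteq> 0 \<and> v \<in> eigenspace A \<mu>)"

text \<open>Geometric multiplicities are used; the matrices considered are symmetric, so these are the
  algebraic ones.\<close>

definition num_positive_eigenvalues :: "real^'n^'n \<Rightarrow> nat" where
  "num_positive_eigenvalues A = (\<Sum>\<mu> | is_eigenvalue A \<mu> \<and> \<mu> > 0. dim (eigenspace A \<mu>))"

end

(* With f_i = u_i^2 and V_i = sum_j a_ij f_j, the i-th equation says that u_i > 0 is a null vector of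
   -Delta + lam - V_i. A positive null vector is a ground state, so this operator is nonnegative on H^1_0
   (Picone's identity); evaluating its form at u_j, where the j-th equation gives the value, yields
     M_ij := int V_i f_j  <=  int V_j f_j = M_jj.
   Here M = A G for the Gram matrix G_ij = int f_i f_j > 0, so M > 0 has a positive left eigenvector l,
   normalised to sum 1, with eigenvalue rho. A form with one positive eigenvalue satisfies the reversed
   Cauchy-Schwarz inequality; applied pointwise to f against l and integrated it gives tr M <= rho.
   But rho = sum_ij l_i M_ij <= sum_j M_jj = tr M, so equality holds throughout: each column of M is
   constant, and a normalised column s of G solves A s = 1 with s > 0. Then c_j = sqrt s_j. *)

theory Submission
  imports Defs
begin

section \<open>Forms with one positive eigenvalue\<close>

text \<open>Picone's identity tests the equation of u_i with phi^2 / u_i, which need not be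
  admissible: u_i is positive only almost everywhere and no positive lower bound is available. So 1
  / u_i is replaced by a smooth positive function of a test function close to u_i. Everything
  inserted in that argument is then a genuine test function, chain and product rules are those of
  smooth functions, and weak gradients enter only as limits. Each limit has two sides. The gradient
  side has integrable majorants and passes by dominated convergence; the side with V_i has none, but
  it is nonnegative, and Fatou's lemma keeps the inequality in the needed direction. Finiteness of
  the entries of G comes out of the same inequality, because its right side M_jj is finite by the
  j-th equation tested with u_j. That test requires u_j in H^1_0; on the whole space this is the
  density of test functions in H^1, obtained by mollification and cutoff, and it is the reason for
  the study of translations in L^2.\<close>

lemma real_quadratic_nonpos_imp_zero:
  fixes a b :: real
  assumes "\<And>t. t * a + t\<^sup>2 * b \<le> 0"
  shows "a = 0"
proof (rule ccontr)
  assume "a \<noteq> 0"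
  \<comment> \<open>For this step the linear term becomes t^2 (1 + |b|), which outweighs t^2 b
    whatever the sign of \<open>b\<close>.\<close>
  define t where "t = a / (1 + \<bar>b\<bar>)"
  have p: "1 + \<bar>b\<bar> > 0" by auto
  have "a = t * (1 + \<bar>b\<bar>)" using p by (simp add: t_def)
  hence "t * a + t\<^sup>2 * b = t\<^sup>2 * ((1 + \<bar>b\<bar>) + b)"
    by (metis mult.assoc power2_eq_square ring_class.ring_distribs(1))
  moreover have "t\<^sup>2 > 0" using \<open>a \<noteq> 0\<close> p by (simp add: t_def)
  moreover have "(1 + \<bar>b\<bar>) + b > 0" by auto
  ultimately show False using assms[of t] by (metis mult_pos_pos not_le)
qed

lemma dot_symmetric_matrix:
  fixes A :: "real^'n^'n"
  assumes "transpose A = A"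
  shows "x \<bullet> (A *v y) = y \<bullet> (A *v x)"
  by (metis assms dot_lmul_matrix inner_commute transpose_matrix_vector)

text \<open>Maximise the quadratic form over the unit vectors orthogonal to \<open>p\<close>. The
  orthogonal complement of an eigenvector of a symmetric matrix is invariant, so the maximiser is an
  eigenvector of \<open>A\<close> itself and not just of a compression; the vector \<open>x\<close>
  makes the maximum positive.\<close>

lemma symmetric_matrix_eigenvector_orthogonal:
  fixes A :: "real^'n^'n"
  assumes sym: "transpose A = A" and p: "A *v p = \<mu> *\<^sub>R p"
    and x: "x \<bullet> p = 0" "x \<bullet> (A *v x) > 0"
  obtains v \<kappa> where "v \<noteq> 0" "v \<bullet> p = 0" "A *v v = \<kappa> *\<^sub>R v" "\<kappa> > 0"
proof -
  define S where "S = {v. v \<bullet> p = 0} \<inter> sphere 0 1"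
  have "closed {v. v \<bullet> p = 0}" by (intro closed_Collect_eq continuous_intros)
  hence cS: "compact S" unfolding S_def by (simp add: closed_Int_compact)
  have x0: "x \<noteq> 0" using x(2) by auto
  hence xS: "(1 / norm x) *\<^sub>R x \<in> S" using x by (simp add: S_def)
  have cont: "continuous_on S (\<lambda>v. v \<bullet> (A *v v))"
    by (intro continuous_intros linear_continuous_on linear_conv_bounded_linear[THEN iffD1] matrix_vector_mul_linear)
  obtain v where v: "v \<in> S" "\<And>w. w \<in> S \<Longrightarrow> w \<bullet> (A *v w) \<le> v \<bullet> (A *v v)"
    using continuous_attains_sup[OF cS _ cont] xS by blast
  define \<kappa> where "\<kappa> = v \<bullet> (A *v v)"
  have nv: "norm v = 1" "v \<bullet> p = 0" using v(1) by (auto simp: S_def)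
  have "(1 / norm x) *\<^sub>R x \<bullet> (A *v ((1 / norm x) *\<^sub>R x)) \<le> \<kappa>"
    using v(2)[OF xS] by (simp add: \<kappa>_def)
  moreover have "(1 / norm x) *\<^sub>R x \<bullet> (A *v ((1 / norm x) *\<^sub>R x)) = (x \<bullet> (A *v x)) / (norm x)\<^sup>2"
    by (simp add: matrix_vector_mult_scaleR power2_eq_square)
  ultimately have \<kappa>: "\<kappa> > 0" using x(2) x0
    by (smt (verit) divide_pos_pos zero_less_norm_iff zero_less_power)
  have bound: "w \<bullet> (A *v w) \<le> \<kappa> * (w \<bullet> w)" if "w \<bullet> p = 0" for w
  proof (cases "w = 0")
    case False
    have "(1 / norm w) *\<^sub>R w \<in> S" using that False by (simp add: S_def)
    from v(2)[OF this] have "(w \<bullet> (A *v w)) / (norm w)\<^sup>2 \<le> \<kappa>"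
      by (simp add: matrix_vector_mult_scaleR power2_eq_square \<kappa>_def)
    thus ?thesis using False by (simp add: divide_le_eq dot_square_norm)
  qed simp
  \<comment> \<open>The residual of the eigenvalue equation is used as direction of variation. It
    stays orthogonal to \<open>p\<close>, and along it the form minus \<open>\<kappa>\<close> times
    the squared norm has first variation \<open>2 * (w \<bullet> w)\<close>, so maximality forces it
    to vanish.\<close>
  define w where "w = A *v v - \<kappa> *\<^sub>R v"
  have "p \<bullet> (A *v v) = 0" using dot_symmetric_matrix[OF sym, of p v] p nv by (simp add: inner_commute)
  hence wp: "w \<bullet> p = 0" using nv by (simp add: w_def inner_diff_left inner_diff_right inner_commute)
  have "t * (2 * (w \<bullet> w)) + t\<^sup>2 * (w \<bullet> (A *v w) - \<kappa> * (w \<bullet> w)) \<le> 0" for t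
  proof -
    have "(v + t *\<^sub>R w) \<bullet> p = 0" using nv wp by (simp add: inner_add_left)
    from bound[OF this]
    have *: "v \<bullet> (A *v v) + 2 * t * (w \<bullet> (A *v v)) + t\<^sup>2 * (w \<bullet> (A *v w))
        \<le> \<kappa> * (v \<bullet> v + 2 * t * (w \<bullet> v) + t\<^sup>2 * (w \<bullet> w))"
      using dot_symmetric_matrix[OF sym, of v w]
      by (simp add: matrix_vector_right_distrib matrix_vector_mult_scaleR inner_add_left
          inner_add_right algebra_simps power2_eq_square inner_commute[of v w])
    have "v \<bullet> v = 1" using nv by (simp add: dot_square_norm)
    moreover have "w \<bullet> w = w \<bullet> (A *v v) - \<kappa> * (w \<bullet> v)"
      by (metis inner_diff_right inner_scaleR_right w_def)
    hence "w \<bullet> (A *v v) = w \<bullet> w + \<kappa> * (w \<bullet> v)" by simp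
    ultimately show ?thesis using * unfolding \<kappa>_def[symmetric] by (simp add: algebra_simps)
  qed
  hence "2 * (w \<bullet> w) = 0" by (rule real_quadratic_nonpos_imp_zero)
  hence "A *v v = \<kappa> *\<^sub>R v" by (simp add: w_def)
  thus ?thesis using that nv \<kappa> by (metis norm_zero zero_neq_one)
qed

text \<open>Take for \<open>p\<close> an eigenvector of the positive eigenvalue. A positive value of
  the form orthogonal to \<open>p\<close> would yield another positive eigenvector orthogonal to
  \<open>p\<close>, hence a count of at least two: either a new eigenvalue or a second dimension in
  the same eigenspace.\<close>

lemma one_positive_eigenvalue_form_nonpos:
  fixes A :: "real^'n^'n"
  assumes sym: "transpose A = A" and one: "num_positive_eigenvalues A = 1"
  obtains p where "\<And>x. x \<bullet> p = 0 \<Longrightarrow> x \<bullet> (A *v x) \<le> 0"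
proof -
  let ?E = "{\<mu>. is_eigenvalue A \<mu> \<and> \<mu> > 0}"
  \<comment> \<open>A sum over an infinite set is 0 by convention, so the value 1 forces
    finiteness.\<close>
  have fin: "finite ?E" using one unfolding num_positive_eigenvalues_def
    by (metis (no_types, lifting) sum.infinite zero_neq_one)
  have "?E \<noteq> {}" using one unfolding num_positive_eigenvalues_def by force
  then obtain \<mu> p where \<mu>: "\<mu> > 0" and p: "p \<noteq> 0" "A *v p = \<mu> *\<^sub>R p"
    by (auto simp: is_eigenvalue_def eigenspace_def)
  have pos: "dim (eigenspace A \<kappa>) \<ge> 1" if "v \<noteq> 0" "A *v v = \<kappa> *\<^sub>R v" for \<kappa> v
  proof -
    have "v \<in> eigenspace A \<kappa>" using that by (simp add: eigenspace_def)
    hence "dim {v} \<le> dim (eigenspace A \<kappa>)" by (intro dim_subset) auto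
    thus ?thesis using that by (simp)
  qed
  have "x \<bullet> (A *v x) \<le> 0" if xp: "x \<bullet> p = 0" for x
  proof (rule ccontr)
    assume "\<not> ?thesis"
    hence "x \<bullet> (A *v x) > 0" by simp
    then obtain v \<kappa> where v: "v \<noteq> 0" "v \<bullet> p = 0" "A *v v = \<kappa> *\<^sub>R v" "\<kappa> > 0"
      using symmetric_matrix_eigenvector_orthogonal[OF sym p(2) xp] by blast
    have sub: "{\<mu>, \<kappa>} \<subseteq> ?E" using p \<mu> v by (auto simp: is_eigenvalue_def eigenspace_def)
    have "2 \<le> (\<Sum>\<mu>\<in>{\<mu>, \<kappa>}. dim (eigenspace A \<mu>))"
    proof (cases "\<mu> = \<kappa>")
      case False
      thus ?thesis using pos[OF p] pos[OF v(1,3)] by simp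
    next
      case True
      have ne: "p \<noteq> v" using v p by auto
      have "pairwise orthogonal {p, v}"
        using v by (auto simp: pairwise_def orthogonal_def inner_commute)
      hence "independent {p, v}" using p v by (intro pairwise_orthogonal_independent) auto
      moreover have "{p, v} \<subseteq> eigenspace A \<mu>" using p v True by (auto simp: eigenspace_def)
      ultimately have "card {p, v} \<le> dim (eigenspace A \<mu>)" using independent_card_le_dim by blast
      thus ?thesis using True ne by simp
    qed
    also have "\<dots> \<le> num_positive_eigenvalues A"
      unfolding num_positive_eigenvalues_def by (rule sum_mono2[OF fin sub]) auto
    finally show False using one by simp
  qed
  thus ?thesis using that by blast
qed

text \<open>Moving \<open>x\<close> along \<open>l\<close> into the hyperplane where the form is
  nonpositive bounds the form at \<open>x\<close> by 2 t b - t^2 c. This is at most b^2 / c for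
  every t, so the vector \<open>p\<close> disappears from the estimate.\<close>

lemma reversed_Cauchy_Schwarz:
  fixes A :: "real^'n^'n"
  assumes sym: "transpose A = A" and one: "num_positive_eigenvalues A = 1"
    and l: "l \<bullet> (A *v l) > 0"
  shows "x \<bullet> (A *v x) \<le> (x \<bullet> (A *v l))\<^sup>2 / (l \<bullet> (A *v l))"
proof -
  obtain p where p: "\<And>x. x \<bullet> p = 0 \<Longrightarrow> x \<bullet> (A *v x) \<le> 0"
    using one_positive_eigenvalue_form_nonpos[OF sym one] by blast
  define t where "t = (x \<bullet> p) / (l \<bullet> p)"
  define c b where "c = l \<bullet> (A *v l)" and "b = x \<bullet> (A *v l)"
  \<comment> \<open>Otherwise the form would be nonpositive at \<open>l\<close>. Hence the line
    through \<open>x\<close> in direction \<open>l\<close> meets the hyperplane.\<close>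
  have "l \<bullet> p \<noteq> 0" using p[of l] l by auto
  hence "(x - t *\<^sub>R l) \<bullet> p = 0" by (simp add: inner_diff_left t_def)
  from p[OF this] have "x \<bullet> (A *v x) - 2 * t * b + t\<^sup>2 * c \<le> 0"
    using dot_symmetric_matrix[OF sym, of l x]
    by (simp add: matrix_vector_mult_diff_distrib matrix_vector_mult_scaleR inner_diff_left
          inner_diff_right algebra_simps power2_eq_square b_def c_def)
  moreover have "0 \<le> (t * c - b)\<^sup>2 / c" using l by (simp add: c_def)
  moreover have "(t * c - b)\<^sup>2 / c = t\<^sup>2 * c - 2 * t * b + b\<^sup>2 / c"
    using l by (simp add: c_def[symmetric] power2_eq_square field_simps)
  ultimately show ?thesis by (simp add: b_def[symmetric] c_def[symmetric])
qed

section \<open>Perron vector and Gram matrix\<close>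

text \<open>Perron's theorem by way of Brouwer: the map l -> l M, rescaled by its total mass
  \<open>T\<close>, is a continuous self-map of the standard simplex, and \<open>T\<close> at a
  fixed point is the eigenvalue. Positivity of the entries comes afterwards, since a nonzero
  nonnegative row times a positive matrix is positive.\<close>

lemma positive_matrix_left_eigenvector:
  fixes M :: "'n::finite \<Rightarrow> 'n \<Rightarrow> real"
  assumes M: "\<And>i j. M i j > 0"
  obtains l \<rho> where "\<rho> > 0" "\<And>i. l i > 0" "(\<Sum>i\<in>UNIV. l i) = 1"
    "\<And>j. (\<Sum>i\<in>UNIV. l i * M i j) = \<rho> * l j"
proof -
  define S :: "(real^'n) set" where "S = {l. (\<forall>i. l $ i \<ge> 0) \<and> (\<Sum>i\<in>UNIV. l $ i) = 1}"
  define T where "T = (\<lambda>l::real^'n. \<Sum>j\<in>UNIV. \<Sum>i\<in>UNIV. l $ i * M i j)"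
  define F where "F = (\<lambda>l::real^'n. (\<chi> j. (\<Sum>i\<in>UNIV. l $ i * M i j) / T l) :: real^'n)"
  have S_le: "l $ i \<le> 1" if "l \<in> S" for l i
    using that member_le_sum[of i UNIV "\<lambda>i. l $ i"] by (auto simp: S_def)
  have "closed S" unfolding S_def
    by (intro closed_Collect_conj closed_Collect_all closed_Collect_le closed_Collect_eq continuous_intros)
  moreover have "bounded S"
  proof (rule boundedI)
    fix l assume l: "l \<in> S"
    have "norm l \<le> (\<Sum>i\<in>UNIV. \<bar>l $ i\<bar>)" by (rule norm_le_l1_cart)
    also have "\<dots> = 1" using l by (simp add: S_def)
    finally show "norm l \<le> 1" .
  qed
  ultimately have comp: "compact S" by (simp add: compact_eq_bounded_closed)
  have conv: "convex S" unfolding convex_def S_def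
    by (auto simp: sum.distrib sum_distrib_left[symmetric])
  obtain i0 :: 'n where True by blast
  have "axis i0 1 \<in> S" by (auto simp: S_def axis_def)
  hence ne: "S \<noteq> {}" by auto
  have pos: "(\<Sum>i\<in>UNIV. l $ i * M i j) > 0" if "l \<in> S" for l j
  proof -
    have "(\<Sum>i\<in>UNIV. l $ i) \<noteq> 0" using that by (simp add: S_def)
    hence "\<exists>i. l $ i \<noteq> 0" by (metis sum.neutral)
    then obtain i where "l $ i \<noteq> 0" ..
    hence "l $ i > 0" using that by (auto simp: S_def less_le)
    thus ?thesis using that M
      by (intro sum_pos2[of UNIV i]) (auto simp: S_def less_imp_le)
  qed
  have Tpos: "T l > 0" if "l \<in> S" for l
    unfolding T_def by (rule sum_pos) (use pos[OF that] in auto)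
  have "continuous_on S F" unfolding F_def T_def
    by (intro continuous_on_vec_lambda continuous_intros)
      (use Tpos in \<open>force simp: T_def\<close>)
  moreover have "F \<in> S \<rightarrow> S"
  proof
    fix l assume l: "l \<in> S"
    have "(\<Sum>j\<in>UNIV. (\<Sum>i\<in>UNIV. l $ i * M i j) / T l) = 1"
      using Tpos[OF l] by (simp add: sum_divide_distrib[symmetric] T_def)
    moreover have "(\<Sum>i\<in>UNIV. l $ i * M i j) / T l \<ge> 0" for j
      using Tpos[OF l] pos[OF l, of j] by simp
    ultimately show "F l \<in> S" by (simp add: S_def F_def)
  qed
  ultimately obtain l where l: "l \<in> S" "F l = l"
    using brouwer[OF comp conv ne, of F] by blast
  have eq: "(\<Sum>i\<in>UNIV. l $ i * M i j) = T l * l $ j" for j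
  proof -
    have "F l $ j = l $ j" using l by simp
    thus ?thesis using Tpos[OF l(1)] by (simp add: F_def field_simps)
  qed
  show ?thesis
  proof (rule that[of "T l" "\<lambda>i. l $ i"])
    show "l $ i > 0" for i using pos[OF l(1), of i] eq[of i] Tpos[OF l(1)]
      by (simp add: zero_less_mult_iff)
  qed (use l eq Tpos in \<open>auto simp: S_def\<close>)
qed

text \<open>All that the differential equations contribute is condensed into \<open>diag\<close>:
  every column of M = A G is largest on the diagonal. The rest is linear algebra and one integration
  over an abstract measure \<open>W\<close>.\<close>

lemma Gram_matrix_solution:
  fixes A :: "real^'n^'n" and f :: "'n \<Rightarrow> 'a \<Rightarrow> real"
  assumes sym: "transpose A = A" and one: "num_positive_eigenvalues A = 1"
    and nonneg: "\<And>i j. A $ i $ j \<ge> 0" and row: "\<And>i. (\<Sum>j\<in>UNIV. A $ i $ j) > 0"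
    and int: "\<And>i j. integrable W (\<lambda>x. f i x * f j x)"
    and pos: "\<And>i j. (\<integral>x. f i x * f j x \<partial>W) > 0"
    and diag: "\<And>i j. (\<Sum>k\<in>UNIV. A $ i $ k * (\<integral>x. f k x * f j x \<partial>W))
          \<le> (\<Sum>k\<in>UNIV. A $ j $ k * (\<integral>x. f k x * f j x \<partial>W))"
  obtains s where "\<And>j. s j > 0" "\<And>i. (\<Sum>j\<in>UNIV. A $ i $ j * s j) = 1"
proof -
  define G where "G i j = (\<integral>x. f i x * f j x \<partial>W)" for i j
  define M where "M i j = (\<Sum>k\<in>UNIV. A $ i $ k * G k j)" for i j
  have Gpos: "G i j > 0" for i j using pos by (simp add: G_def)
  have Asym: "A $ i $ j = A $ j $ i" for i j
    using arg_cong[OF sym, of "\<lambda>B. B $ j $ i"] by (simp add: transpose_def)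
  have Mpos: "M i j > 0" for i j
  proof -
    have "\<exists>k. A $ i $ k \<noteq> 0" using row[of i] by (metis less_irrefl sum.neutral)
    then obtain k where "A $ i $ k > 0" using nonneg by (metis less_le)
    thus ?thesis unfolding M_def using Gpos nonneg
      by (intro sum_pos2[of UNIV k]) (auto simp: less_imp_le)
  qed
  have Mdiag: "M i j \<le> M j j" for i j using diag by (simp add: M_def G_def)
  obtain l \<rho> where l: "\<rho> > 0" "\<And>i. l i > 0" "(\<Sum>i\<in>UNIV. l i) = 1"
    "\<And>j. (\<Sum>i\<in>UNIV. l i * M i j) = \<rho> * l j"
    by (rule positive_matrix_left_eigenvector[of M, OF Mpos]) (rule that)
  define L :: "real^'n" where "L = (\<chi> i. l i)"
  define m where "m = A *v L"
  have m: "m $ k = (\<Sum>i\<in>UNIV. A $ k $ i * l i)" for k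
    by (simp add: m_def L_def matrix_vector_mult_def)
  have mpos: "m $ k > 0" for k
  proof -
    have "\<exists>i. A $ k $ i \<noteq> 0" using row[of k] by (metis less_irrefl sum.neutral)
    then obtain i where "A $ k $ i > 0" using nonneg by (metis less_le)
    thus ?thesis unfolding m using l(2) nonneg
      by (intro sum_pos2[of UNIV i]) (auto simp: less_imp_le)
  qed
  \<comment> \<open>By symmetry of \<open>A\<close> the row m^T G equals l^T A G = l^T M, so the
    eigenvector relation applies.\<close>
  have lM: "(\<Sum>k\<in>UNIV. m $ k * G k j) = \<rho> * l j" for j
  proof -
    have "(\<Sum>k\<in>UNIV. m $ k * G k j) = (\<Sum>k\<in>UNIV. \<Sum>i\<in>UNIV. l i * (A $ i $ k * G k j))"
      unfolding m sum_distrib_right by (intro sum.cong refl) (simp add: Asym mult_ac)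
    also have "\<dots> = (\<Sum>i\<in>UNIV. l i * M i j)"
      by (subst sum.swap) (simp add: M_def sum_distrib_left)
    finally show ?thesis using l(4) by simp
  qed
  define c where "c = L \<bullet> m"
  have c: "c = (\<Sum>j\<in>UNIV. l j * m $ j)" by (simp add: c_def L_def inner_vec_def)
  have cpos: "c > 0" unfolding c using l(2) mpos by (intro sum_pos) auto
  \<comment> \<open>With f the vector of the \<open>f i x\<close> and m = A l, the pointwise bound
    reads f . A f <= (f . m)^2 / c. Integration turns the left side into tr M and the right side
    into m^T G m / c = \<rho> (l . m) / c, where l . m is \<open>c\<close>.\<close>
  have trace: "(\<Sum>j\<in>UNIV. M j j) \<le> \<rho>"
  proof -
    let ?F = "\<lambda>x. (\<chi> i. f i x) :: real^'n"
    have "(\<Sum>j\<in>UNIV. M j j) = (\<integral>x. (\<Sum>j\<in>UNIV. \<Sum>k\<in>UNIV. A $ j $ k * (f k x * f j x)) \<partial>W)"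
      unfolding M_def G_def using int by simp
    also have "\<dots> \<le> (\<integral>x. (\<Sum>j\<in>UNIV. \<Sum>k\<in>UNIV. m $ j * m $ k * (f k x * f j x)) / c \<partial>W)"
    proof (rule integral_mono)
      fix x
      have "(\<Sum>j\<in>UNIV. \<Sum>k\<in>UNIV. A $ j $ k * (f k x * f j x)) = ?F x \<bullet> (A *v ?F x)"
        by (simp add: inner_vec_def matrix_vector_mult_def sum_distrib_left mult_ac)
      also have "\<dots> \<le> (?F x \<bullet> m)\<^sup>2 / c"
        using reversed_Cauchy_Schwarz[OF sym one, of L "?F x"] cpos by (simp add: c_def m_def)
      also have "(?F x \<bullet> m)\<^sup>2 = (\<Sum>j\<in>UNIV. \<Sum>k\<in>UNIV. m $ j * m $ k * (f k x * f j x))"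
        by (simp add: inner_vec_def power2_eq_square sum_product mult_ac)
      finally show "(\<Sum>j\<in>UNIV. \<Sum>k\<in>UNIV. A $ j $ k * (f k x * f j x))
         \<le> (\<Sum>j\<in>UNIV. \<Sum>k\<in>UNIV. m $ j * m $ k * (f k x * f j x)) / c" .
    qed (use int in auto)
    also have "\<dots> = (\<Sum>j\<in>UNIV. \<Sum>k\<in>UNIV. m $ j * (m $ k * G k j)) / c"
      unfolding G_def using int by (simp add: mult_ac)
    also have "\<dots> = (\<Sum>j\<in>UNIV. m $ j * (\<rho> * l j)) / c"
      by (simp add: sum_distrib_left[symmetric] lM)
    also have "\<dots> = \<rho> * c / c" by (simp add: c sum_distrib_left mult_ac)
    finally show ?thesis using cpos by simp
  qed
  \<comment> \<open>Both sums are written with the weights \<open>l i\<close>, which add up to 1, so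
    that their difference becomes a sum of nonnegative terms.\<close>
  have "\<rho> = (\<Sum>j\<in>UNIV. \<Sum>i\<in>UNIV. l i * M i j)"
    using l by (simp add: sum_distrib_left[symmetric])
  moreover have "(\<Sum>j\<in>UNIV. M j j) = (\<Sum>j\<in>UNIV. \<Sum>i\<in>UNIV. l i * M j j)"
    using l by (simp add: sum_distrib_right[symmetric])
  ultimately have "(\<Sum>j\<in>UNIV. \<Sum>i\<in>UNIV. l i * (M j j - M i j)) \<le> 0"
    using trace by (simp add: right_diff_distrib sum_subtractf)
  moreover have nn: "l i * (M j j - M i j) \<ge> 0" for i j
    using l(2)[of i] Mdiag[of i j] by simp
  ultimately have "(\<Sum>j\<in>UNIV. \<Sum>i\<in>UNIV. l i * (M j j - M i j)) = 0"
    by (intro antisym sum_nonneg) auto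
  hence "l i * (M j j - M i j) = 0" for i j
    using nn by (simp add: sum_nonneg_eq_0_iff sum_nonneg)
  \<comment> \<open>The weights are strictly positive, so every single difference vanishes.\<close>
  hence Meq: "M i j = M j j" for i j using l(2)[of i] by (metis eq_iff_diff_eq_0 less_irrefl mult_eq_0_iff)
  obtain j0 :: 'n where True by blast
  show ?thesis
  \<comment> \<open>\<open>A\<close> maps column \<open>j0\<close> of \<open>G\<close> to column
    \<open>j0\<close> of \<open>M\<close>, which is constant; dividing by that constant yields the
    vector of ones.\<close>
  proof (rule that[of "\<lambda>k. G k j0 / M j0 j0"])
    show "G j j0 / M j0 j0 > 0" for j using Gpos Mpos by simp
    show "(\<Sum>j\<in>UNIV. A $ i $ j * (G j j0 / M j0 j0)) = 1" for i
      using Meq[of i j0] Mpos[of j0 j0] by (simp add: M_def sum_divide_distrib[symmetric])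
  qed
qed

section \<open>Smooth functions and test functions\<close>

text \<open>\<open>grad\<close> records the derivative along the axes only; linearity recovers it in
  all directions.\<close>

lemma grad_inner:
  assumes "f differentiable (at x)"
  shows "(f has_derivative (\<lambda>h. grad f x \<bullet> h)) (at x)"
proof -
  have D: "(f has_derivative frechet_derivative f (at x)) (at x)"
    using assms frechet_derivative_works by blast
  interpret linear "frechet_derivative f (at x)"
    using D has_derivative_linear by blast
  have "frechet_derivative f (at x) h = grad f x \<bullet> h" for h
  proof -
    have "frechet_derivative f (at x) h = frechet_derivative f (at x) (\<Sum>k\<in>UNIV. h $ k *\<^sub>R axis k 1)"
      by (metis basis_expansion scalar_mult_eq_scaleR)
    also have "\<dots> = (\<Sum>k\<in>UNIV. h $ k * frechet_derivative f (at x) (axis k 1))"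
      by (simp add: sum scale)
    also have "\<dots> = grad f x \<bullet> h" by (simp add: inner_vec_def grad_def mult.commute)
    finally show ?thesis .
  qed
  hence "frechet_derivative f (at x) = (\<lambda>h. grad f x \<bullet> h)" by blast
  with D show ?thesis by simp
qed

lemma grad_eqI:
  assumes "(f has_derivative D) (at x)"
  shows "grad f x $ k = D (axis k 1)"
  by (simp add: grad_def frechet_derivative_at[OF assms, symmetric])

lemma grad_eq_innerI:
  assumes "(f has_derivative (\<lambda>h. g \<bullet> h)) (at x)"
  shows "grad f x = g"
  by (simp add: vec_eq_iff grad_eqI[OF assms] inner_axis)

lemma C_k_Suc_imp: "C_k (Suc m) f \<Longrightarrow> C_k m f"
proof (induction m arbitrary: f)
  case 0
  thus ?case by (auto simp: continuous_on_eq_continuous_at differentiable_imp_continuous_within)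
qed auto

text \<open>In inductions on \<open>m\<close> an explicit formula \<open>g\<close> can take the
  place of \<open>grad f\<close>, so that the induction hypothesis is applied to visible
  expressions.\<close>

lemma C_k_Suc_iff:
  assumes "\<And>x. (f has_derivative (\<lambda>h. g x \<bullet> h)) (at x)"
  shows "C_k (Suc m) f \<longleftrightarrow> (\<forall>k. C_k m (\<lambda>x. g x $ k))"
proof -
  have "grad f = g" using grad_eq_innerI[OF assms] by blast
  thus ?thesis using assms by (auto simp: differentiable_def)
qed

lemma C_k_const: "C_k m (\<lambda>x::real^'n. c)"
proof (induction m arbitrary: c)
  case (Suc m)
  have "((\<lambda>x. c) has_derivative (\<lambda>h. 0 \<bullet> h)) (at x)" for x :: "real^'n" by simp
  from C_k_Suc_iff[of "\<lambda>x. c" "\<lambda>x. 0", OF this] show ?case using Suc[of 0] by (simp del: C_k.simps)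
qed auto

lemma C_k_add: "C_k m f \<Longrightarrow> C_k m g \<Longrightarrow> C_k m (\<lambda>x. f x + g x)"
proof (induction m arbitrary: f g)
  case (Suc m)
  have "((\<lambda>x. f x + g x) has_derivative (\<lambda>h. (grad f x + grad g x) \<bullet> h)) (at x)" for x
    using Suc.prems by (auto simp: inner_add_left intro!: derivative_intros grad_inner)
  from C_k_Suc_iff[of "\<lambda>x. f x + g x" "\<lambda>x. grad f x + grad g x", OF this] show ?case
    using Suc by simp
qed (auto intro: continuous_intros)

lemma C_k_mult: "C_k m f \<Longrightarrow> C_k m g \<Longrightarrow> C_k m (\<lambda>x. f x * g x)"
proof (induction m arbitrary: f g)
  case (Suc m)
  have "((\<lambda>x. f x * g x) has_derivative (\<lambda>h. (f x *\<^sub>R grad g x + g x *\<^sub>R grad f x) \<bullet> h)) (at x)" for x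
    using Suc.prems
    by (auto simp: inner_add_left mult.commute intro!: derivative_eq_intros grad_inner)
  from C_k_Suc_iff[of "\<lambda>x. f x * g x" "\<lambda>x. f x *\<^sub>R grad g x + g x *\<^sub>R grad f x", OF this]
  show ?case using Suc C_k_Suc_imp[OF Suc.prems(1)] C_k_Suc_imp[OF Suc.prems(2)]
    by (auto intro!: C_k_add Suc.IH)
qed (auto intro: continuous_intros)

lemma C_k_sum: "(\<And>i. i \<in> I \<Longrightarrow> C_k m (f i)) \<Longrightarrow> C_k m (\<lambda>x. \<Sum>i\<in>I. f i x)"
  by (induction I rule: infinite_finite_induct) (auto intro: C_k_const C_k_add)

lemma C_k_component: "C_k m (\<lambda>x::real^'n. x $ k)"
proof (cases m)
  case (Suc n)
  have "((\<lambda>x. x $ k) has_derivative (\<lambda>h. axis k 1 \<bullet> h)) (at x)" for x :: "real^'n"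
    by (simp add: inner_axis' bounded_linear_imp_has_derivative bounded_linear_vec_nth)
  from C_k_Suc_iff[of "\<lambda>x. x $ k" "\<lambda>x. axis k 1", OF this] show ?thesis
    using Suc by (simp add: C_k_const del: C_k.simps)
qed (auto intro: continuous_intros)

text \<open>Differentiating a composition replaces the outer function by its derivative. The
  induction therefore runs over a family \<open>S\<close> closed under derivatives, which stands in
  for a notion of smoothness on the line.\<close>

lemma C_k_compose:
  assumes S: "\<And>b. b \<in> S \<Longrightarrow> \<exists>b'\<in>S. \<forall>t. (b has_real_derivative b' t) (at t)"
  shows "b \<in> S \<Longrightarrow> C_k m f \<Longrightarrow> C_k m (\<lambda>x. b (f x))"
proof (induction m arbitrary: b)
  case 0
  have "continuous_on UNIV b" using S[OF 0(1)]
    by (metis DERIV_isCont continuous_at_imp_continuous_on)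
  with 0 show ?case by (auto intro: continuous_on_compose2)
next
  case (Suc m)
  from S[OF Suc.prems(1)] obtain b' where b': "b' \<in> S" "\<And>t. (b has_real_derivative b' t) (at t)"
    by blast
  have "((\<lambda>x. b (f x)) has_derivative (\<lambda>h. (b' (f x) *\<^sub>R grad f x) \<bullet> h)) (at x)" for x
    using has_derivative_compose[OF grad_inner b'(2)[unfolded has_field_derivative_def], of f x]
      Suc.prems(2) by simp
  from C_k_Suc_iff[of "\<lambda>x. b (f x)" "\<lambda>x. b' (f x) *\<^sub>R grad f x", OF this]
  show ?case using Suc.IH[OF b'(1) C_k_Suc_imp[OF Suc.prems(2)]] Suc.prems(2)
    by (auto intro!: C_k_mult)
qed

lemma C_k_powr:
  assumes "\<And>x. f x > 0" shows "C_k m f \<Longrightarrow> C_k m (\<lambda>x. f x powr a)"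
proof (induction m arbitrary: a)
  case 0
  thus ?case using assms by (auto intro!: continuous_intros) (metis less_irrefl)
next
  case (Suc m)
  have "((\<lambda>x. f x powr a) has_derivative (\<lambda>h. ((a * f x powr (a - 1)) *\<^sub>R grad f x) \<bullet> h)) (at x)" for x
  proof -
    have "f differentiable (at x)" using Suc.prems by simp
    from has_derivative_compose[OF grad_inner[OF this]
        has_real_derivative_powr[OF assms, unfolded has_field_derivative_def]]
    show ?thesis by simp
  qed
  from C_k_Suc_iff[of "\<lambda>x. f x powr a" "\<lambda>x. (a * f x powr (a - 1)) *\<^sub>R grad f x", OF this]
  show ?case using Suc.IH[of "a - 1"] Suc.prems C_k_Suc_imp[OF Suc.prems]
    by (auto intro!: C_k_mult C_k_const)
qed

section \<open>Bump functions\<close>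

text \<open>The flat function exp(-1/t), extended by 0, with a polynomial in 1/t as factor. All
  derivatives of exp(-1/t) have this shape, so the family is closed under differentiation.\<close>

definition flat_exp :: "real poly \<Rightarrow> real \<Rightarrow> real" where
  "flat_exp p t = (if t > 0 then poly p (1 / t) * exp (- (1 / t)) else 0)"

lemma poly_times_exp_minus_tendsto_0: "((\<lambda>s::real. poly p s * exp (- s)) \<longlongrightarrow> 0) at_top"
proof -
  have "((\<lambda>s. \<Sum>i\<le>degree p. coeff p i * (s ^ i / exp s)) \<longlongrightarrow> (\<Sum>i\<le>degree p. coeff p i * 0)) at_top"
    by (intro tendsto_intros tendsto_power_div_exp_0)
  thus ?thesis by (simp add: poly_altdef sum_distrib_right exp_minus divide_inverse mult.assoc)
qed

text \<open>With s = 1/t, the derivative of p(s) exp(-s) in t is s^2 (p(s) - p'(s)) exp(-s), which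
  explains the new polynomial. At 0 both one-sided derivatives are 0 because exp(-s) beats every
  polynomial.\<close>

lemma flat_exp_has_derivative:
  "(flat_exp p has_real_derivative flat_exp (monom 1 2 * (p - pderiv p)) t) (at t)"
proof -
  consider "t > 0" | "t < 0" | "t = 0" by linarith
  thus ?thesis
  proof cases
    case 1
    have "((\<lambda>t. poly p (1 / t) * exp (- (1 / t))) has_real_derivative
        flat_exp (monom 1 2 * (p - pderiv p)) t) (at t)"
      using 1 by (auto intro!: derivative_eq_intros DERIV_chain'[OF _ poly_DERIV]
          simp: flat_exp_def poly_monom field_simps power2_eq_square)
    thus ?thesis
      by (rule has_field_derivative_transform_within_open[where S = "{0<..}"])
        (use 1 in \<open>auto simp: flat_exp_def\<close>)
  next
    case 2
    have "((\<lambda>t. 0) has_real_derivative 0) (at t)" by simp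
    hence "(flat_exp p has_real_derivative 0) (at t)"
      by (rule has_field_derivative_transform_within_open[where S = "{..<0}"])
        (use 2 in \<open>auto simp: flat_exp_def\<close>)
    thus ?thesis using 2 by (simp add: flat_exp_def)
  next
    case 3
    have "((\<lambda>h. flat_exp p h / h) \<longlongrightarrow> 0) (at_left 0)"
      by (rule tendsto_eventually) (auto simp: flat_exp_def eventually_at_left_field intro!: exI[of _ "-1"])
    \<comment> \<open>The difference quotient contributes one more factor s = 1/h, and
      \<open>pCons 0 p\<close> is the polynomial s p(s).\<close>
    moreover have "((\<lambda>h. poly (pCons 0 p) (inverse h) * exp (- inverse h)) \<longlongrightarrow> 0) (at_right (0::real))"
      by (rule filterlim_compose[OF poly_times_exp_minus_tendsto_0 filterlim_inverse_at_top_right])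
    hence "((\<lambda>h. flat_exp p h / h) \<longlongrightarrow> 0) (at_right 0)"
      by (rule Lim_transform_eventually)
        (auto simp: flat_exp_def eventually_at_right_field field_simps intro!: exI[of _ 1])
    ultimately have "((\<lambda>h. flat_exp p h / h) \<longlongrightarrow> 0) (at 0)" by (simp add: filterlim_at_split)
    thus ?thesis using 3 by (simp add: DERIV_def flat_exp_def)
  qed
qed

lemma C_k_flat_exp: "C_k m f \<Longrightarrow> C_k m (\<lambda>x. flat_exp p (f x))"
  by (rule C_k_compose[of "range flat_exp"]) (auto intro: flat_exp_has_derivative)

text \<open>The argument is a polynomial in the coordinates, hence smooth also at the origin, where
  the norm is not.\<close>

definition bump :: "real \<Rightarrow> real^'N \<Rightarrow> real" where
  "bump d x = flat_exp 1 (d\<^sup>2 - x \<bullet> x)"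

lemma bump_nonneg: "bump d x \<ge> 0"
  by (simp add: bump_def flat_exp_def)

lemma bump_pos_iff: "d > 0 \<Longrightarrow> bump d x > 0 \<longleftrightarrow> norm x < d"
  using abs_square_less_1 power_strict_mono[of "norm x" d 2] power2_less_imp_less[of "norm x" d]
  by (auto simp: bump_def flat_exp_def dot_square_norm)

lemma C_k_bump: "C_k m (bump d :: real^'N \<Rightarrow> real)"
proof -
  have "C_k m (\<lambda>x::real^'N. flat_exp 1 (d\<^sup>2 + (- 1) * (\<Sum>k\<in>UNIV. x $ k * x $ k)))"
    by (intro C_k_flat_exp C_k_add C_k_const C_k_sum C_k_mult C_k_component)
  thus ?thesis by (simp add: bump_def[abs_def] inner_vec_def)
qed

lemma test_functionsI:
  assumes "\<And>m. C_k m \<phi>" "compact K" "K \<subseteq> \<Omega>" "\<And>x. x \<notin> K \<Longrightarrow> \<phi> x = 0"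
  shows "\<phi> \<in> test_functions \<Omega>"
proof -
  have "closure {x. \<phi> x \<noteq> 0} \<subseteq> K"
    using assms by (intro closure_minimal compact_imp_closed) auto
  moreover from this have "compact (closure {x. \<phi> x \<noteq> 0})"
    using assms(2) compact_Int_closed[of K "closure {x. \<phi> x \<noteq> 0}"] by (simp add: Int_absorb1)
  ultimately show ?thesis using assms(1,3) unfolding test_functions_def by blast
qed

text \<open>One compact set serves for the function and its gradient: off the closed support the
  function vanishes on an open set, so its gradient does too.\<close>

lemma test_functionsE:
  assumes "\<phi> \<in> test_functions \<Omega>"
  obtains K where "compact K" "K \<subseteq> \<Omega>" "\<And>x. x \<notin> K \<Longrightarrow> \<phi> x = 0" "\<And>x. x \<notin> K \<Longrightarrow> grad \<phi> x = 0"
proof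
  let ?K = "closure {x. \<phi> x \<noteq> 0}"
  show "compact ?K" "?K \<subseteq> \<Omega>" using assms by (auto simp: test_functions_def)
  show z: "\<phi> x = 0" if "x \<notin> ?K" for x using that closure_subset[of "{x. \<phi> x \<noteq> 0}"] by auto
  show "grad \<phi> x = 0" if "x \<notin> ?K" for x
  proof (rule grad_eq_innerI)
    have "((\<lambda>x. 0) has_derivative (\<lambda>h. 0 \<bullet> h)) (at x)" by simp
    thus "(\<phi> has_derivative (\<lambda>h. 0 \<bullet> h)) (at x)"
    proof (rule has_derivative_transform_within_open)
      show "open (- ?K)" "x \<in> - ?K" using that by (auto simp: open_Compl)
      show "0 = \<phi> y" if "y \<in> - ?K" for y using z[of y] that by simp
    qed
  qed
qed

lemma test_C_k: "\<phi> \<in> test_functions \<Omega> \<Longrightarrow> C_k m \<phi>"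
  by (simp add: test_functions_def)

lemma test_differentiable: "\<phi> \<in> test_functions \<Omega> \<Longrightarrow> \<phi> differentiable (at x)"
  using test_C_k[of \<phi> \<Omega> "Suc 0"] by simp

lemma test_continuous: "\<phi> \<in> test_functions \<Omega> \<Longrightarrow> continuous_on A \<phi>"
  using test_C_k[of \<phi> \<Omega> 0] continuous_on_subset[of UNIV \<phi> A] by simp

lemma test_grad: "\<phi> \<in> test_functions \<Omega> \<Longrightarrow> (\<lambda>x. grad \<phi> x $ k) \<in> test_functions \<Omega>"
proof -
  assume a: "\<phi> \<in> test_functions \<Omega>"
  then obtain K where "compact K" "K \<subseteq> \<Omega>" "\<And>x. x \<notin> K \<Longrightarrow> \<phi> x = 0" "\<And>x. x \<notin> K \<Longrightarrow> grad \<phi> x = 0"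
    by (rule test_functionsE) (rule that)
  moreover have "C_k m (\<lambda>x. grad \<phi> x $ k)" for m using test_C_k[OF a, of "Suc m"] by simp
  ultimately show ?thesis by (intro test_functionsI[of _ K \<Omega>]) (simp_all del: C_k.simps)
qed

lemma test_grad_continuous:
  assumes "\<phi> \<in> test_functions \<Omega>" shows "continuous_on A (grad \<phi>)"
proof -
  have "continuous_on A (\<lambda>x. \<chi> k. grad \<phi> x $ k)"
    by (rule continuous_on_vec_lambda) (rule test_continuous[OF test_grad[OF assms]])
  thus ?thesis by simp
qed

lemma test_mult:
  assumes "\<phi> \<in> test_functions \<Omega>" "\<And>m. C_k m \<psi>"
  shows "(\<lambda>x. \<phi> x * \<psi> x) \<in> test_functions \<Omega>"
proof -
  from assms(1) obtain K where "compact K" "K \<subseteq> \<Omega>" "\<And>x. x \<notin> K \<Longrightarrow> \<phi> x = 0" "\<And>x. x \<notin> K \<Longrightarrow> grad \<phi> x = 0"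
    by (rule test_functionsE) (rule that)
  thus ?thesis
    by (intro test_functionsI[of _ K \<Omega>] C_k_mult test_C_k[OF assms(1)] assms(2)) simp_all
qed

lemma bump_test:
  assumes "d > 0"
  shows "(bump d :: real^'N \<Rightarrow> real) \<in> test_functions UNIV"
proof (rule test_functionsI[of _ "cball 0 d"])
  show "bump d x = 0" if "x \<notin> cball 0 d" for x :: "real^'N"
    using bump_pos_iff[OF assms, of x] that bump_nonneg[of d x] by (simp add: less_le)
qed (rule C_k_bump compact_cball subset_UNIV)+

lemma integrable_compact_support:
  fixes f :: "'a::euclidean_space \<Rightarrow> 'b::{banach, second_countable_topology}"
  assumes "continuous_on UNIV f" "compact K" "\<And>x. x \<notin> K \<Longrightarrow> f x = 0"
  shows "integrable lborel f"
proof -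
  have "integrable lborel (\<lambda>x. indicator K x *\<^sub>R f x)"
    by (rule borel_integrable_compact) (use assms(2) continuous_on_subset[OF assms(1), of K] in auto)
  also have "(\<lambda>x. indicator K x *\<^sub>R f x) = f" using assms(3) by (auto simp: fun_eq_iff indicator_def)
  finally show ?thesis .
qed

lemma test_integrable: "\<phi> \<in> test_functions \<Omega> \<Longrightarrow> integrable lborel \<phi>"
  by (rule test_functionsE, assumption) (rule integrable_compact_support[OF test_continuous])

lemma test_bounded:
  assumes "\<phi> \<in> test_functions \<Omega>" obtains B where "B > 0" "\<And>x. \<bar>\<phi> x\<bar> \<le> B"
proof -
  obtain K where K: "compact K" "\<And>x. x \<notin> K \<Longrightarrow> \<phi> x = 0" using test_functionsE[OF assms] by metis
  have "compact (\<phi> ` K)" by (rule compact_continuous_image[OF test_continuous[OF assms] K(1)])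
  then obtain B where "B > 0" "\<forall>y\<in>\<phi> ` K. norm y \<le> B" using compact_imp_bounded bounded_pos by blast
  hence "\<bar>\<phi> x\<bar> \<le> B" for x using K(2)[of x] by (cases "x \<in> K") auto
  with \<open>B > 0\<close> show ?thesis using that by blast
qed

lemma test_grad_bounded:
  assumes "\<phi> \<in> test_functions \<Omega>" obtains B where "B > 0" "\<And>x. norm (grad \<phi> x) \<le> B"
proof -
  obtain K where K: "compact K" "\<And>x. x \<notin> K \<Longrightarrow> grad \<phi> x = 0" using test_functionsE[OF assms] by metis
  have "compact (grad \<phi> ` K)" by (rule compact_continuous_image[OF test_grad_continuous[OF assms] K(1)])
  then obtain B where B: "B > 0" "\<forall>y\<in>grad \<phi> ` K. norm y \<le> B" using compact_imp_bounded bounded_pos by blast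
  hence "norm (grad \<phi> x) \<le> B" for x using K(2)[of x] by (cases "x \<in> K") auto
  with B(1) show ?thesis using that by blast
qed

lemma test_support_cball:
  assumes "\<phi> \<in> test_functions \<Omega>"
  obtains R where "R > 0" "\<And>x. norm x > R \<Longrightarrow> \<phi> x = 0" "\<And>x. norm x > R \<Longrightarrow> grad \<phi> x = 0"
proof -
  obtain K where K: "compact K" "\<And>x. x \<notin> K \<Longrightarrow> \<phi> x = 0" "\<And>x. x \<notin> K \<Longrightarrow> grad \<phi> x = 0"
    using test_functionsE[OF assms] by metis
  obtain R where R: "R > 0" "\<forall>x\<in>K. norm x \<le> R" using K(1) compact_imp_bounded bounded_pos by blast
  show ?thesis
    by (rule that[OF R(1)]) (use K R(2) in \<open>meson not_le\<close>)+
qed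

text \<open>On the ball of radius \<open>R + 1\<close> continuity is uniform by compactness. Two
  points closer than 1 either both lie in it or both have norm above \<open>R\<close>, where
  \<open>f\<close> vanishes.\<close>

lemma uniform_modulus_compact_support:
  fixes f :: "'a::euclidean_space \<Rightarrow> 'b::real_normed_vector"
  assumes f: "continuous_on UNIV f" and R: "\<And>x. norm x > R \<Longrightarrow> f x = 0" and "\<epsilon> > 0"
  obtains d where "d > 0" "\<And>x y. norm (x - y) < d \<Longrightarrow> norm (f x - f y) < \<epsilon>"
proof -
  have "uniformly_continuous_on (cball 0 (R + 1)) f"
    by (rule compact_uniformly_continuous) (use f continuous_on_subset in auto)
  then obtain d where d: "d > 0" "\<And>x y. x \<in> cball 0 (R + 1) \<Longrightarrow> y \<in> cball 0 (R + 1) \<Longrightarrow>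
      dist x y < d \<Longrightarrow> dist (f x) (f y) < \<epsilon>"
    using \<open>\<epsilon> > 0\<close> unfolding uniformly_continuous_on_def by (metis dist_commute)
  show ?thesis
  proof (rule that[of "min d 1"])
    fix x y :: 'a assume xy: "norm (x - y) < min d 1"
    show "norm (f x - f y) < \<epsilon>"
    proof (cases "norm x \<le> R + 1 \<and> norm y \<le> R + 1")
      case True
      thus ?thesis using d(2)[of x y] xy by (simp add: dist_norm)
    next
      case False
      moreover have "\<bar>norm x - norm y\<bar> < 1" using xy norm_triangle_ineq3[of x y] by linarith
      ultimately have "norm x > R" "norm y > R" by linarith+
      thus ?thesis using R \<open>\<epsilon> > 0\<close> by simp
    qed
  qed (use d in auto)
qed

text \<open>The threshold \<open>d\<close> does not depend on the base point \<open>w\<close>. This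
  uniformity, inherited from the uniform continuity of the gradient, is what permits differentiation
  under the convolution integral.\<close>

lemma test_uniform_differentiable:
  fixes \<phi> :: "real^'N \<Rightarrow> real"
  assumes \<phi>: "\<phi> \<in> test_functions \<Omega>" and "\<epsilon> > 0"
  obtains d where "d > 0" "\<And>w h. norm h < d \<Longrightarrow> \<bar>\<phi> (w + h) - \<phi> w - grad \<phi> w \<bullet> h\<bar> \<le> \<epsilon> * norm h"
proof -
  obtain R where R: "\<And>x. norm x > R \<Longrightarrow> grad \<phi> x = 0" using test_support_cball[OF \<phi>] by metis
  obtain d where d: "d > 0" "\<And>x y. norm (x - y) < d \<Longrightarrow> norm (grad \<phi> x - grad \<phi> y) < \<epsilon>"
    using uniform_modulus_compact_support[OF test_grad_continuous[OF \<phi>] R \<open>\<epsilon> > 0\<close>] by metis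
  show ?thesis
  proof (rule that[OF d(1)])
    fix w h :: "real^'N" assume h: "norm h < d"
    have "norm (\<phi> (w + h) - \<phi> w - grad \<phi> w \<bullet> ((w + h) - w)) \<le> norm ((w + h) - w) * \<epsilon>"
    proof (rule differentiable_bound_linearization[where S = "ball w d" and f' = "\<lambda>x h. grad \<phi> x \<bullet> h"])
      show "w + t *\<^sub>R (w + h - w) \<in> ball w d" if "t \<in> {0..1}" for t
        using that h mult_left_le_one_le[of "norm h" t] by (simp add: dist_norm)
      show "(\<phi> has_derivative (\<lambda>h. grad \<phi> x \<bullet> h)) (at x within ball w d)" for x
        using grad_inner[OF test_differentiable[OF \<phi>]] has_derivative_at_withinI by blast
      show "onorm ((\<lambda>h. grad \<phi> x \<bullet> h) - (\<lambda>h. grad \<phi> w \<bullet> h)) \<le> \<epsilon>" if "x \<in> ball w d" for x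
      proof (rule onorm_le)
        fix h
        have "\<bar>(grad \<phi> x - grad \<phi> w) \<bullet> h\<bar> \<le> norm (grad \<phi> x - grad \<phi> w) * norm h"
          by (rule Cauchy_Schwarz_ineq2)
        also have "\<dots> \<le> \<epsilon> * norm h"
          using d(2)[of x w] that by (intro mult_right_mono) (auto simp: dist_norm norm_minus_commute)
        finally show "norm (((\<lambda>h. grad \<phi> x \<bullet> h) - (\<lambda>h. grad \<phi> w \<bullet> h)) h) \<le> \<epsilon> * norm h"
          by (simp add: inner_diff_left)
      qed
    qed (use d in auto)
    thus "\<bar>\<phi> (w + h) - \<phi> w - grad \<phi> w \<bullet> h\<bar> \<le> \<epsilon> * norm h" by (simp add: mult.commute)
  qed
qed

section \<open>Convolution with a test function\<close>

text \<open>Borel rather than Lebesgue measurability, because shifts and reflections of the argument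
  then stay measurable on \<open>lborel\<close>; elements of Sobolev spaces are first replaced by
  Borel representatives.\<close>

definition locally_integrable :: "('a::euclidean_space \<Rightarrow> real) \<Rightarrow> bool" where
  "locally_integrable v \<longleftrightarrow> v \<in> borel_measurable borel \<and>
     (\<forall>K. compact K \<longrightarrow> integrable lborel (\<lambda>x. indicator K x * v x))"

text \<open>The variable \<open>x\<close> sits in the smooth factor, so all derivatives fall on
  \<open>\<eta>\<close> and \<open>v\<close> only has to be locally integrable.\<close>

definition conv :: "(real^'N \<Rightarrow> real) \<Rightarrow> (real^'N \<Rightarrow> real) \<Rightarrow> real^'N \<Rightarrow> real" where
  "conv v \<eta> x = (\<integral>z. v z * \<eta> (x - z) \<partial>lborel)"

lemma integrable_conv:
  assumes v: "locally_integrable v" and \<eta>: "\<eta> \<in> test_functions \<Omega>"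
  shows "integrable lborel (\<lambda>z. v z * \<eta> (x - z))"
proof -
  obtain R where R: "R > 0" "\<And>x. norm x > R \<Longrightarrow> \<eta> x = 0" using test_support_cball[OF \<eta>] by metis
  obtain B where B: "\<And>x. \<bar>\<eta> x\<bar> \<le> B" using test_bounded[OF \<eta>] by metis
  have [measurable]: "v \<in> borel_measurable borel" using v by (simp add: locally_integrable_def)
  have [measurable]: "\<eta> \<in> borel_measurable borel"
    by (rule borel_measurable_continuous_onI[OF test_continuous[OF \<eta>]])
  have "integrable lborel (\<lambda>z. B * (indicator (cball x R) z * v z))"
    using v by (simp add: locally_integrable_def)
  thus ?thesis
  proof (rule Bochner_Integration.integrable_bound)
    show "AE z in lborel. norm (v z * \<eta> (x - z)) \<le> norm (B * (indicator (cball x R) z * v z))"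
    proof (rule AE_I2)
      fix z
      show "norm (v z * \<eta> (x - z)) \<le> norm (B * (indicator (cball x R) z * v z))"
      proof (cases "z \<in> cball x R")
        case True
        have "\<bar>v z\<bar> * \<bar>\<eta> (x - z)\<bar> \<le> \<bar>v z\<bar> * \<bar>B\<bar>" using B[of "x - z"] by (intro mult_left_mono) auto
        thus ?thesis using True by (simp add: abs_mult mult.commute)
      next
        case False
        thus ?thesis using R(2)[of "x - z"] by (simp add: dist_norm)
      qed
    qed
  qed measurable
qed

text \<open>The first-order remainder of \<open>\<eta>\<close> is at most \<open>e / (V + 1)\<close>
  times the length of the step, uniformly in \<open>z\<close>; integrating it against
  \<open>v\<close> costs the local mass \<open>V\<close> of \<open>v\<close>.\<close>

lemma conv_has_derivative:
  fixes v :: "real^'N \<Rightarrow> real"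
  assumes v: "locally_integrable v" and \<eta>: "\<eta> \<in> test_functions \<Omega>"
  shows "(conv v \<eta> has_derivative (\<lambda>h. (\<chi> k. conv v (\<lambda>y. grad \<eta> y $ k) x) \<bullet> h)) (at x)"
  unfolding has_derivative_at_alt
proof (intro conjI allI impI)
  show "bounded_linear ((\<bullet>) (\<chi> k. conv v (\<lambda>y. grad \<eta> y $ k) x))" by (rule bounded_linear_inner_right)
  fix e :: real assume e: "e > 0"
  obtain R where R: "R > 0" "\<And>x. norm x > R \<Longrightarrow> \<eta> x = 0" "\<And>x. norm x > R \<Longrightarrow> grad \<eta> x = 0"
    using test_support_cball[OF \<eta>] by metis
  \<comment> \<open>Radius \<open>R + 1\<close> covers the supports of the functions
    \<open>\<eta> (y - z)\<close> of \<open>z\<close> for all \<open>y\<close> within distance 1 of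
    \<open>x\<close>; hence the step is later restricted to \<open>min d 1\<close>.\<close>
  define V where "V = (\<integral>z. \<bar>indicator (cball x (R + 1)) z * v z\<bar> \<partial>lborel)"
  have V0: "V \<ge> 0" by (simp add: V_def)
  have iV: "integrable lborel (\<lambda>z. \<bar>indicator (cball x (R + 1)) z * v z\<bar>)"
    using v by (intro integrable_abs) (simp add: locally_integrable_def)
  obtain d where d: "d > 0"
    "\<And>w h. norm h < d \<Longrightarrow> \<bar>\<eta> (w + h) - \<eta> w - grad \<eta> w \<bullet> h\<bar> \<le> e / (V + 1) * norm h"
    using test_uniform_differentiable[OF \<eta>, of "e / (V + 1)"] e V0 by (metis add_nonneg_pos divide_pos_pos zero_less_one)
  show "\<exists>d>0. \<forall>y. norm (y - x) < d \<longrightarrow>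
      norm (conv v \<eta> y - conv v \<eta> x - (\<chi> k. conv v (\<lambda>y. grad \<eta> y $ k) x) \<bullet> (y - x)) \<le> e * norm (y - x)"
  proof (intro exI[of _ "min d 1"] conjI allI impI)
    show "min d 1 > 0" using d by simp
    fix y assume y: "norm (y - x) < min d 1"
    define h where "h = y - x"
    note i1 = integrable_conv[OF v \<eta>, of y] and i2 = integrable_conv[OF v \<eta>, of x]
    note i3 = integrable_conv[OF v test_grad[OF \<eta>], where x = x]
    have i4: "integrable lborel (\<lambda>z. v z * (grad \<eta> (x - z) \<bullet> h))"
    proof -
      have "integrable lborel (\<lambda>z. \<Sum>k\<in>UNIV. (v z * grad \<eta> (x - z) $ k) * h $ k)"
        by (intro Bochner_Integration.integrable_sum integrable_mult_left i3)
      thus ?thesis by (simp add: inner_vec_def sum_distrib_left mult.assoc)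
    qed
    have "(\<chi> k. conv v (\<lambda>y. grad \<eta> y $ k) x) \<bullet> h = (\<Sum>k\<in>UNIV. (\<integral>z. (v z * grad \<eta> (x - z) $ k) * h $ k \<partial>lborel))"
      by (simp add: inner_vec_def conv_def)
    also have "\<dots> = (\<integral>z. (\<Sum>k\<in>UNIV. (v z * grad \<eta> (x - z) $ k) * h $ k) \<partial>lborel)"
      by (rule Bochner_Integration.integral_sum[symmetric]) (intro integrable_mult_left i3)
    also have "\<dots> = (\<integral>z. v z * (grad \<eta> (x - z) \<bullet> h) \<partial>lborel)"
      by (simp add: inner_vec_def sum_distrib_left mult.assoc)
    finally have "conv v \<eta> y - conv v \<eta> x - (\<chi> k. conv v (\<lambda>y. grad \<eta> y $ k) x) \<bullet> h
        = (\<integral>z. v z * (\<eta> (y - z) - \<eta> (x - z) - grad \<eta> (x - z) \<bullet> h) \<partial>lborel)"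
      using i1 i2 i4 by (simp add: conv_def right_diff_distrib)
    also have "\<bar>\<dots>\<bar> \<le> (\<integral>z. e / (V + 1) * norm h * \<bar>indicator (cball x (R + 1)) z * v z\<bar> \<partial>lborel)"
    proof (rule integral_abs_bound_integral)
      fix z
      show "\<bar>v z * (\<eta> (y - z) - \<eta> (x - z) - grad \<eta> (x - z) \<bullet> h)\<bar>
          \<le> e / (V + 1) * norm h * \<bar>indicator (cball x (R + 1)) z * v z\<bar>"
      proof (cases "z \<in> cball x (R + 1)")
        case True
        have "\<bar>\<eta> ((x - z) + h) - \<eta> (x - z) - grad \<eta> (x - z) \<bullet> h\<bar> \<le> e / (V + 1) * norm h"
          using d(2)[of h "x - z"] y by (simp add: h_def)
        also have "(x - z) + h = y - z" by (simp add: h_def)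
        finally have "\<bar>v z\<bar> * \<bar>\<eta> (y - z) - \<eta> (x - z) - grad \<eta> (x - z) \<bullet> h\<bar> \<le> \<bar>v z\<bar> * (e / (V + 1) * norm h)"
          by (intro mult_left_mono) auto
        thus ?thesis using True by (simp add: abs_mult mult.commute)
      next
        case False
        hence "norm (x - z) > R + 1" by (simp add: dist_norm)
        moreover have "norm (x - z) \<le> norm (y - z) + norm (y - x)"
          using norm_triangle_ineq4[of "y - z" "y - x"] by simp
        ultimately have "norm (x - z) > R" "norm (y - z) > R" using y by auto
        thus ?thesis using R e V0 by simp
      qed
    qed (use i1 i2 i4 iV in \<open>auto simp: right_diff_distrib\<close>)
    also have "\<dots> = e / (V + 1) * norm h * V" by (simp add: V_def)
    also have "\<dots> \<le> e * norm h"
    proof -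
      have "V / (V + 1) \<le> 1" using V0 by simp
      hence "(e * norm h) * (V / (V + 1)) \<le> e * norm h" using e by (intro mult_left_le) auto
      thus ?thesis by simp
    qed
    finally show "norm (conv v \<eta> y - conv v \<eta> x - (\<chi> k. conv v (\<lambda>y. grad \<eta> y $ k) x) \<bullet> (y - x)) \<le> e * norm (y - x)"
      by (simp add: h_def)
  qed
qed

lemma C_k_conv:
  assumes v: "locally_integrable v"
  shows "\<eta> \<in> test_functions \<Omega> \<Longrightarrow> C_k m (conv v \<eta>)"
proof (induction m arbitrary: \<eta>)
  case 0
  have "isCont (conv v \<eta>) x" for x using has_derivative_continuous[OF conv_has_derivative[OF v 0]] .
  thus ?case by (simp add: continuous_at_imp_continuous_on)
next
  case (Suc m)
  show ?case using Suc.IH[OF test_grad[OF Suc.prems]]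
    unfolding C_k_Suc_iff[OF conv_has_derivative[OF v Suc.prems]] by simp
qed

lemma grad_conv:
  assumes "locally_integrable v" "\<eta> \<in> test_functions \<Omega>"
  shows "grad (conv v \<eta>) x $ k = conv v (\<lambda>y. grad \<eta> y $ k) x"
  using grad_eq_innerI[OF conv_has_derivative[OF assms]] by simp

lemma lborel_distr_reflect: "distr lborel borel (\<lambda>x. t - x) = (lborel :: 'a::euclidean_space measure)"
proof -
  have "lborel = density (distr lborel borel (\<lambda>x::'a. t + (- 1) *\<^sub>R x)) (\<lambda>_. \<bar>- 1::real\<bar>^DIM('a))"
    by (rule lborel_affine) simp
  thus ?thesis by (simp add: density_1)
qed

lemma lborel_integral_reflect:
  fixes f :: "'a::euclidean_space \<Rightarrow> real"
  assumes "f \<in> borel_measurable borel"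
  shows "(\<integral>x. f (t - x) \<partial>lborel) = (\<integral>x. f x \<partial>lborel)"
  using integral_distr[of "\<lambda>x. t - x" lborel borel f] assms by (simp add: lborel_distr_reflect)

lemma test_borel: "\<phi> \<in> test_functions \<Omega> \<Longrightarrow> \<phi> \<in> borel_measurable borel"
  by (rule borel_measurable_continuous_onI[OF test_continuous])

text \<open>Convolution of the constant 1 with \<open>\<phi>\<close> is constant, so its gradient
  vanishes; but that gradient is the convolution of 1 with the partial derivatives. This is the
  source of every integration by parts below.\<close>

lemma integral_grad_test:
  assumes \<phi>: "\<phi> \<in> test_functions \<Omega>"
  shows "(\<integral>x. grad \<phi> x $ k \<partial>lborel) = 0"
proof -
  have v: "locally_integrable (\<lambda>x::real^'n. 1)"
    using integrable_real_indicator[of _ lborel]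
    by (auto simp: locally_integrable_def intro!: integrable_real_indicator emeasure_compact_finite
        borel_compact)
  have "conv (\<lambda>x. 1) \<phi> = (\<lambda>x. \<integral>z. \<phi> z \<partial>lborel)"
    using lborel_integral_reflect[OF test_borel[OF \<phi>]] by (simp add: conv_def fun_eq_iff)
  hence "grad (conv (\<lambda>x. 1) \<phi>) 0 $ k = 0" by (simp add: grad_eqI[OF has_derivative_const])
  thus ?thesis using grad_conv[OF v \<phi>, of 0 k] lborel_integral_reflect[OF test_borel[OF test_grad[OF \<phi>]], of 0 k]
    by (simp add: conv_def)
qed

section \<open>Mollification and density of test functions in H1\<close>

lemma nn_integral_lborel_shift:
  fixes g :: "'a::euclidean_space \<Rightarrow> ennreal"
  assumes [measurable]: "g \<in> borel_measurable borel"
  shows "(\<integral>\<^sup>+x. g (x - y) \<partial>lborel) = (\<integral>\<^sup>+x. g x \<partial>lborel)"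
proof -
  have "(\<integral>\<^sup>+x. g x \<partial>lborel) = (\<integral>\<^sup>+x. g x \<partial>distr lborel borel ((+) (- y)))"
    by (simp add: lborel_distr_plus)
  also have "\<dots> = (\<integral>\<^sup>+x. g (x - y) \<partial>lborel)"
    by (subst nn_integral_distr) (auto simp: algebra_simps)
  finally show ?thesis by simp
qed

lemma nn_integral_lborel_reflect:
  fixes g :: "'a::euclidean_space \<Rightarrow> ennreal"
  assumes [measurable]: "g \<in> borel_measurable borel"
  shows "(\<integral>\<^sup>+x. g (y - x) \<partial>lborel) = (\<integral>\<^sup>+x. g x \<partial>lborel)"
proof -
  have "(\<integral>\<^sup>+x. g x \<partial>lborel) = (\<integral>\<^sup>+x. g x \<partial>distr lborel borel (\<lambda>x. y - x))"
    by (simp add: lborel_distr_reflect)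
  also have "\<dots> = (\<integral>\<^sup>+x. g (y - x) \<partial>lborel)"
    by (subst nn_integral_distr) auto
  finally show ?thesis by simp
qed

section \<open>Continuity of translations in L1 and L2\<close>

text \<open>The nonnegative integral is used so that integrability of the difference is not a side
  condition.\<close>

definition translation_continuous_L1 :: "('a::euclidean_space \<Rightarrow> real) \<Rightarrow> bool" where
  "translation_continuous_L1 f \<longleftrightarrow> (\<forall>e>0. \<exists>d>0. \<forall>y. norm y < d \<longrightarrow>
     (\<integral>\<^sup>+x. ennreal \<bar>f (x - y) - f x\<bar> \<partial>lborel) \<le> ennreal e)"

lemma translation_continuous_L1D:
  assumes "translation_continuous_L1 f" "e > 0"
  obtains d where "d > 0" "\<And>y. norm y < d \<Longrightarrow> (\<integral>\<^sup>+x. ennreal \<bar>f (x - y) - f x\<bar> \<partial>lborel) \<le> ennreal e"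
  using assms unfolding translation_continuous_L1_def by meson

text \<open>Three-epsilon argument: the difference is split at \<open>g\<close> and its shift, and
  the shifted error equals the unshifted one by translation invariance.\<close>

lemma translation_continuous_L1_limit:
  fixes f :: "'a::euclidean_space \<Rightarrow> real"
  assumes [measurable]: "f \<in> borel_measurable borel"
    and ap: "\<And>e. e > 0 \<Longrightarrow> \<exists>g. g \<in> borel_measurable borel \<and> translation_continuous_L1 g \<and>
      (\<integral>\<^sup>+x. ennreal \<bar>f x - g x\<bar> \<partial>lborel) \<le> ennreal e"
  shows "translation_continuous_L1 f"
  unfolding translation_continuous_L1_def
proof (intro allI impI)
  fix e :: real assume "e > 0"
  hence "e / 3 > 0" by simp
  from ap[OF this] obtain g where g[measurable]: "g \<in> borel_measurable borel"
    and tg: "translation_continuous_L1 g" and le: "(\<integral>\<^sup>+x. ennreal \<bar>f x - g x\<bar> \<partial>lborel) \<le> ennreal (e / 3)"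
    by blast
  obtain d where d: "d > 0"
    "\<And>y. norm y < d \<Longrightarrow> (\<integral>\<^sup>+x. ennreal \<bar>g (x - y) - g x\<bar> \<partial>lborel) \<le> ennreal (e / 3)"
    using translation_continuous_L1D[OF tg \<open>e / 3 > 0\<close>] by blast
  show "\<exists>d>0. \<forall>y. norm y < d \<longrightarrow> (\<integral>\<^sup>+x. ennreal \<bar>f (x - y) - f x\<bar> \<partial>lborel) \<le> ennreal e"
  proof (intro exI[of _ d] conjI allI impI d(1))
    fix y :: 'a assume y: "norm y < d"
    have "(\<integral>\<^sup>+x. ennreal \<bar>f (x - y) - f x\<bar> \<partial>lborel) \<le>
      (\<integral>\<^sup>+x. (ennreal \<bar>f (x - y) - g (x - y)\<bar> + ennreal \<bar>g (x - y) - g x\<bar>) + ennreal \<bar>f x - g x\<bar> \<partial>lborel)"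
      by (rule nn_integral_mono) (auto simp flip: ennreal_plus intro!: ennreal_leI)
    also have "\<dots> = (\<integral>\<^sup>+x. ennreal \<bar>f (x - y) - g (x - y)\<bar> \<partial>lborel)
        + (\<integral>\<^sup>+x. ennreal \<bar>g (x - y) - g x\<bar> \<partial>lborel) + (\<integral>\<^sup>+x. ennreal \<bar>f x - g x\<bar> \<partial>lborel)"
      by (subst nn_integral_add; simp)+
    also have "(\<integral>\<^sup>+x. ennreal \<bar>f (x - y) - g (x - y)\<bar> \<partial>lborel) = (\<integral>\<^sup>+x. ennreal \<bar>f x - g x\<bar> \<partial>lborel)"
      by (rule nn_integral_lborel_shift[of "\<lambda>x. ennreal \<bar>f x - g x\<bar>"]) simp
    also have "(\<integral>\<^sup>+x. ennreal \<bar>f x - g x\<bar> \<partial>lborel) + (\<integral>\<^sup>+x. ennreal \<bar>g (x - y) - g x\<bar> \<partial>lborel)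
        + (\<integral>\<^sup>+x. ennreal \<bar>f x - g x\<bar> \<partial>lborel) \<le> ennreal (e / 3) + ennreal (e / 3) + ennreal (e / 3)"
      by (intro add_mono le d(2) y)
    also have "\<dots> = ennreal e" using \<open>e > 0\<close> by (simp flip: ennreal_plus)
    finally show "(\<integral>\<^sup>+x. ennreal \<bar>f (x - y) - f x\<bar> \<partial>lborel) \<le> ennreal e" .
  qed
qed

text \<open>Regularity squeezes \<open>A\<close> between a compact \<open>K\<close> and an open
  \<open>U\<close>. A shift too short to move a point of \<open>K\<close> out of \<open>U\<close>
  can change the indicator only if \<open>x\<close> or \<open>x - y\<close> lies in U - K, a set of
  small measure.\<close>

lemma translation_continuous_L1_indicator:
  fixes A :: "'a::euclidean_space set"
  assumes A: "A \<in> sets borel" and fin: "emeasure lborel A < \<infinity>"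
  shows "translation_continuous_L1 (indicator A)"
  unfolding translation_continuous_L1_def
proof (intro allI impI)
  fix e :: real assume "e > 0"
  \<comment> \<open>Four contributions of at most \<open>r\<close> occur: U - A and A - K, each at
    \<open>x\<close> and at \<open>x - y\<close>. The set A - K costs \<open>r / 2\<close> for the
    closed inner approximation and \<open>r / 2\<close> for its truncation to a ball.\<close>
  define r where "r = e / 4"
  have r: "r > 0" "r / 2 > 0" using \<open>e > 0\<close> by (auto simp: r_def)
  have AL: "A \<in> sets lebesgue" using A by simp
  obtain U where U: "open U" "A \<subseteq> U" "emeasure lebesgue (U - A) < ennreal r"
    using sets_lebesgue_outer_open[OF AL r(1)] by metis
  obtain C where C: "closed C" "C \<subseteq> A" "emeasure lebesgue (A - C) < ennreal (r / 2)"
    using sets_lebesgue_inner_closed[OF AL r(2)] by metis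
  have C': "emeasure lborel (A - C) \<le> ennreal (r / 2)" and U': "emeasure lborel (U - A) \<le> ennreal r"
    using C U A by (auto simp: borel_closed)
  define D where "D n = A - cball (0::'a) (real n)" for n
  have "(\<lambda>n. emeasure lborel (D n)) \<longlonglongrightarrow> emeasure lborel (\<Inter>n. D n)"
  proof (rule Lim_emeasure_decseq)
    show "range D \<subseteq> sets lborel" using A by (auto simp: D_def)
    show "decseq D" by (auto simp: decseq_def D_def)
    show "emeasure lborel (D n) \<noteq> \<infinity>" for n
      using emeasure_mono[of "D n" A lborel] A fin by (auto simp: D_def top_unique)
  qed
  also have "(\<Inter>n. D n) = {}"
    by (auto simp: D_def) (metis linorder_not_le real_arch_simple)
  finally have "(\<lambda>n. emeasure lborel (D n)) \<longlonglongrightarrow> 0" by simp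
  from order_tendstoD(2)[OF this, of "ennreal (r / 2)"]
  have "eventually (\<lambda>n. emeasure lborel (D n) < ennreal (r / 2)) sequentially"
    using r by simp
  then obtain n where n: "emeasure lborel (D n) < ennreal (r / 2)"
    using eventually_happens by force
  define K where "K = C \<inter> cball 0 (real n)"
  have K: "compact K" "K \<subseteq> A" using C by (auto simp: K_def closed_Int_compact)
  have Kb: "K \<in> sets borel" using K by (simp add: borel_compact)
  have "emeasure lborel (A - K) \<le> emeasure lborel ((A - C) \<union> D n)"
    using A C by (intro emeasure_mono) (auto simp: K_def D_def borel_closed)
  also have "\<dots> \<le> emeasure lborel (A - C) + emeasure lborel (D n)"
    using A C by (intro emeasure_subadditive) (auto simp: D_def borel_closed)
  also have "\<dots> \<le> ennreal (r / 2) + ennreal (r / 2)" using C' n by (intro add_mono) auto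
  also have "\<dots> = ennreal r" using r by (simp flip: ennreal_plus)
  finally have K': "emeasure lborel (A - K) \<le> ennreal r" .
  have "\<exists>d>0. \<forall>x\<in>K. ball x d \<subseteq> U"
  proof (cases "K = {}")
    case False
    thus ?thesis
      using compact_subset_open_imp_ball_epsilon_subset[OF K(1) U(1)] K(2) U(2) by (metis UN_subset_iff subset_trans)
  qed (auto intro: exI[of _ 1])
  then obtain d where d: "d > 0" "\<And>x. x \<in> K \<Longrightarrow> ball x d \<subseteq> U" by blast
  have [measurable]: "A \<in> sets borel" "K \<in> sets borel" "U \<in> sets borel" using A Kb U by auto
  show "\<exists>d>0. \<forall>y. norm y < d \<longrightarrow>
      (\<integral>\<^sup>+x. ennreal \<bar>indicator A (x - y) - indicator A x\<bar> \<partial>lborel) \<le> ennreal e"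
  proof (intro exI[of _ d] conjI allI impI d(1))
    fix y :: 'a assume y: "norm y < d"
    let ?S = "\<lambda>x. indicator (U - A) x + indicator (A - K) x :: ennreal"
    have S: "(\<integral>\<^sup>+x. ?S x \<partial>lborel) \<le> ennreal r + ennreal r"
      using U' K' by (subst nn_integral_add) (auto intro: add_mono)
    have "ennreal \<bar>indicator A (x - y) - indicator A x\<bar> \<le> ?S (x - y) + ?S x" for x
    proof -
      have "x - y \<in> U" if "x \<in> K" using d(2)[OF that] y by (auto simp: subset_iff dist_norm)
      moreover have "x \<in> U" if "x - y \<in> K"
        using d(2)[OF that] y by (auto simp: subset_iff dist_norm)
      ultimately show ?thesis by (auto simp: indicator_def)
    qed
    hence "(\<integral>\<^sup>+x. ennreal \<bar>indicator A (x - y) - indicator A x\<bar> \<partial>lborel) \<le> (\<integral>\<^sup>+x. ?S (x - y) + ?S x \<partial>lborel)"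
      by (rule nn_integral_mono)
    also have "\<dots> = (\<integral>\<^sup>+x. ?S (x - y) \<partial>lborel) + (\<integral>\<^sup>+x. ?S x \<partial>lborel)"
      by (rule nn_integral_add) auto
    also have "(\<integral>\<^sup>+x. ?S (x - y) \<partial>lborel) = (\<integral>\<^sup>+x. ?S x \<partial>lborel)"
      by (rule nn_integral_lborel_shift) auto
    also have "(\<integral>\<^sup>+x. ?S x \<partial>lborel) + (\<integral>\<^sup>+x. ?S x \<partial>lborel) \<le> (ennreal r + ennreal r) + (ennreal r + ennreal r)"
      by (intro add_mono S)
    also have "\<dots> = ennreal e" using r by (simp add: r_def flip: ennreal_plus)
    finally show "(\<integral>\<^sup>+x. ennreal \<bar>indicator A (x - y) - indicator A x\<bar> \<partial>lborel) \<le> ennreal e" .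
  qed
qed

lemma translation_continuous_L1_cmult:
  assumes [measurable]: "f \<in> borel_measurable borel" and f: "translation_continuous_L1 f"
  shows "translation_continuous_L1 (\<lambda>x. f x * c)"
  unfolding translation_continuous_L1_def
proof (intro allI impI)
  fix e :: real assume "e > 0"
  hence "e / (\<bar>c\<bar> + 1) > 0" by simp
  from translation_continuous_L1D[OF f this] obtain d where d: "d > 0"
    "\<And>y. norm y < d \<Longrightarrow> (\<integral>\<^sup>+x. ennreal \<bar>f (x - y) - f x\<bar> \<partial>lborel) \<le> ennreal (e / (\<bar>c\<bar> + 1))" by blast
  show "\<exists>d>0. \<forall>y. norm y < d \<longrightarrow> (\<integral>\<^sup>+x. ennreal \<bar>f (x - y) * c - f x * c\<bar> \<partial>lborel) \<le> ennreal e"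
  proof (intro exI[of _ d] conjI allI impI d(1))
    fix y :: 'a assume y: "norm y < d"
    have "(\<integral>\<^sup>+x. ennreal \<bar>f (x - y) * c - f x * c\<bar> \<partial>lborel)
        = (\<integral>\<^sup>+x. ennreal \<bar>f (x - y) - f x\<bar> * ennreal \<bar>c\<bar> \<partial>lborel)"
      by (simp add: abs_mult ennreal_mult' flip: left_diff_distrib)
    also have "\<dots> = (\<integral>\<^sup>+x. ennreal \<bar>f (x - y) - f x\<bar> \<partial>lborel) * ennreal \<bar>c\<bar>"
      by (rule nn_integral_multc) simp
    also have "\<dots> \<le> ennreal (e / (\<bar>c\<bar> + 1)) * ennreal \<bar>c\<bar>" by (intro mult_right_mono d(2) y) simp
    also have "\<dots> = ennreal (e / (\<bar>c\<bar> + 1) * \<bar>c\<bar>)" by (rule ennreal_mult''[symmetric]) simp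
    also have "\<dots> \<le> ennreal e" using \<open>e > 0\<close> by (intro ennreal_leI) (simp add: field_simps)
    finally show "(\<integral>\<^sup>+x. ennreal \<bar>f (x - y) * c - f x * c\<bar> \<partial>lborel) \<le> ennreal e" .
  qed
qed

lemma translation_continuous_L1_add:
  assumes [measurable]: "f \<in> borel_measurable borel" "g \<in> borel_measurable borel"
    and f: "translation_continuous_L1 f" and g: "translation_continuous_L1 g"
  shows "translation_continuous_L1 (\<lambda>x. f x + g x)"
  unfolding translation_continuous_L1_def
proof (intro allI impI)
  fix e :: real assume "e > 0"
  hence e: "e / 2 > 0" by simp
  from translation_continuous_L1D[OF f e] obtain d where d: "d > 0"
    "\<And>y. norm y < d \<Longrightarrow> (\<integral>\<^sup>+x. ennreal \<bar>f (x - y) - f x\<bar> \<partial>lborel) \<le> ennreal (e / 2)" by blast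
  from translation_continuous_L1D[OF g e] obtain d' where d': "d' > 0"
    "\<And>y. norm y < d' \<Longrightarrow> (\<integral>\<^sup>+x. ennreal \<bar>g (x - y) - g x\<bar> \<partial>lborel) \<le> ennreal (e / 2)" by blast
  show "\<exists>d>0. \<forall>y. norm y < d \<longrightarrow> (\<integral>\<^sup>+x. ennreal \<bar>f (x - y) + g (x - y) - (f x + g x)\<bar> \<partial>lborel) \<le> ennreal e"
  proof (intro exI[of _ "min d d'"] conjI allI impI)
    fix y :: 'a assume y: "norm y < min d d'"
    have "(\<integral>\<^sup>+x. ennreal \<bar>f (x - y) + g (x - y) - (f x + g x)\<bar> \<partial>lborel)
        \<le> (\<integral>\<^sup>+x. ennreal \<bar>f (x - y) - f x\<bar> + ennreal \<bar>g (x - y) - g x\<bar> \<partial>lborel)"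
      by (rule nn_integral_mono) (auto simp flip: ennreal_plus intro!: ennreal_leI)
    also have "\<dots> = (\<integral>\<^sup>+x. ennreal \<bar>f (x - y) - f x\<bar> \<partial>lborel) + (\<integral>\<^sup>+x. ennreal \<bar>g (x - y) - g x\<bar> \<partial>lborel)"
      by (rule nn_integral_add) auto
    also have "\<dots> \<le> ennreal (e / 2) + ennreal (e / 2)" using y by (intro add_mono d d') auto
    also have "\<dots> = ennreal e" using \<open>e > 0\<close> by (simp flip: ennreal_plus)
    finally show "(\<integral>\<^sup>+x. ennreal \<bar>f (x - y) + g (x - y) - (f x + g x)\<bar> \<partial>lborel) \<le> ennreal e" .
  qed (use d d' in auto)
qed

text \<open>Induction along the construction of the integral: multiples of indicators, sums, and
  limits. In the limit case the approximants are bounded by 2 |f|, whence the majorant 3 |f| of the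
  error.\<close>

lemma translation_continuous_L1_integrable:
  fixes f :: "'a::euclidean_space \<Rightarrow> real"
  shows "integrable lborel f \<Longrightarrow> translation_continuous_L1 f"
proof (induction rule: integrable_induct)
  case (base A c)
  have "translation_continuous_L1 (\<lambda>x. indicator A x * c)"
    by (rule translation_continuous_L1_cmult[OF _ translation_continuous_L1_indicator]) (use base in auto)
  thus ?case by simp
next
  case (add f g)
  thus ?case by (intro translation_continuous_L1_add) auto
next
  case (lim f s)
  have [measurable]: "f \<in> borel_measurable borel" "\<And>i. s i \<in> borel_measurable borel"
    using lim by auto
  show ?case
  proof (rule translation_continuous_L1_limit)
    fix e :: real assume e: "e > 0"
    have "(\<lambda>i. \<integral>x. \<bar>f x - s i x\<bar> \<partial>lborel) \<longlonglongrightarrow> integral\<^sup>L lborel (\<lambda>x::'a. 0)"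
    proof (rule integral_dominated_convergence[where w = "\<lambda>x. 3 * \<bar>f x\<bar>"])
      show "AE x in lborel. (\<lambda>i. \<bar>f x - s i x\<bar>) \<longlonglongrightarrow> 0"
      proof (rule AE_I2)
        fix x
        have "(\<lambda>i. \<bar>f x - s i x\<bar>) \<longlonglongrightarrow> \<bar>f x - f x\<bar>"
          using lim by (intro tendsto_intros) auto
        thus "(\<lambda>i. \<bar>f x - s i x\<bar>) \<longlonglongrightarrow> 0" by simp
      qed
      show "AE x in lborel. norm \<bar>f x - s i x\<bar> \<le> 3 * \<bar>f x\<bar>" for i
      proof (rule AE_I2)
        fix x
        have "\<bar>s i x\<bar> \<le> 2 * \<bar>f x\<bar>" using lim by auto
        thus "norm \<bar>f x - s i x\<bar> \<le> 3 * \<bar>f x\<bar>" by auto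
      qed
    qed (use lim in auto)
    hence "eventually (\<lambda>i. (\<integral>x. \<bar>f x - s i x\<bar> \<partial>lborel) < e) sequentially"
      using e by (auto dest: order_tendstoD)
    then obtain i where i: "(\<integral>x. \<bar>f x - s i x\<bar> \<partial>lborel) < e" using eventually_happens by force
    have "(\<integral>\<^sup>+x. ennreal \<bar>f x - s i x\<bar> \<partial>lborel) = ennreal (\<integral>x. \<bar>f x - s i x\<bar> \<partial>lborel)"
      using lim by (intro nn_integral_eq_integral) auto
    with i show "\<exists>g. g \<in> borel_measurable borel \<and> translation_continuous_L1 g \<and>
      (\<integral>\<^sup>+x. ennreal \<bar>f x - g x\<bar> \<partial>lborel) \<le> ennreal e"
      using lim by (intro exI[of _ "s i"]) (auto intro: ennreal_leI)
  qed simp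
qed

text \<open>Truncation in height and in space gives an integrable function with bounded shift
  differences, whose squares are then controlled by the L1 result. The truncation error is small in
  L2 by dominated convergence.\<close>

lemma translation_continuous_L2:
  fixes f :: "'a::euclidean_space \<Rightarrow> real"
  assumes f[measurable]: "f \<in> borel_measurable borel" and f2: "integrable lborel (\<lambda>x. (f x)\<^sup>2)" and "e > 0"
  obtains d where "d > 0"
    "\<And>y. norm y < d \<Longrightarrow> (\<integral>\<^sup>+x. ennreal ((f (x - y) - f x)\<^sup>2) \<partial>lborel) \<le> ennreal e"
proof -
  define t where "t n x = (if norm x \<le> real n \<and> \<bar>f x\<bar> \<le> real n then f x else 0)" for n x
  have [measurable]: "t n \<in> borel_measurable borel" for n unfolding t_def by measurable
  have "(\<lambda>n. \<integral>x. (f x - t n x)\<^sup>2 \<partial>lborel) \<longlonglongrightarrow> integral\<^sup>L lborel (\<lambda>x::'a. 0)"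
  proof (rule integral_dominated_convergence[OF _ _ f2])
    show "AE x in lborel. (\<lambda>n. (f x - t n x)\<^sup>2) \<longlonglongrightarrow> 0"
    proof (rule AE_I2, rule tendsto_eventually)
      fix x
      obtain N where N: "max (norm x) \<bar>f x\<bar> \<le> real N" using real_arch_simple by blast
      show "\<forall>\<^sub>F n in sequentially. (f x - t n x)\<^sup>2 = 0"
        using eventually_ge_at_top[of N]
      proof eventually_elim
        case (elim n)
        hence "real N \<le> real n" by simp
        thus ?case using N by (simp add: t_def)
      qed
    qed
  qed (auto simp: t_def)
  hence "(\<lambda>n. \<integral>x. (f x - t n x)\<^sup>2 \<partial>lborel) \<longlonglongrightarrow> 0" by simp
  from order_tendstoD(2)[OF this, of "e / 9"]
  have "eventually (\<lambda>n. (\<integral>x. (f x - t n x)\<^sup>2 \<partial>lborel) < e / 9) sequentially"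
    using \<open>e > 0\<close> by simp
  then obtain n where n: "(\<integral>x. (f x - t n x)\<^sup>2 \<partial>lborel) < e / 9" using eventually_happens by force
  have "integrable lborel (\<lambda>x. (f x - t n x)\<^sup>2)"
    by (rule Bochner_Integration.integrable_bound[OF f2]) (auto simp: t_def)
  hence "(\<integral>\<^sup>+x. ennreal ((f x - t n x)\<^sup>2) \<partial>lborel) = ennreal (\<integral>x. (f x - t n x)\<^sup>2 \<partial>lborel)"
    by (intro nn_integral_eq_integral) auto
  hence n': "(\<integral>\<^sup>+x. ennreal ((f x - t n x)\<^sup>2) \<partial>lborel) \<le> ennreal (e / 9)"
    using n by (simp add: ennreal_leI)
  have "integrable lborel (\<lambda>x. real n * indicator (cball (0::'a) (real n)) x)"
    by (intro integrable_mult_right integrable_real_indicator emeasure_compact_finite) auto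
  hence "integrable lborel (t n)"
    by (rule Bochner_Integration.integrable_bound) (auto simp: t_def indicator_def)
  hence T: "translation_continuous_L1 (t n)" by (rule translation_continuous_L1_integrable)
  \<comment> \<open>In (a - b + r)^2 <= 3 a^2 + 3 b^2 + 3 r^2 the last term is at most 6 n |r|,
    because |r| <= 2 n; adding 1 keeps \<open>c\<close> positive for n = 0. The three thirds of
    \<open>e\<close> are 3 (e / 9), twice, and c (e / (3 c)).\<close>
  define c where "c = 6 * real n + 1"
  have c: "c > 0" by (simp add: c_def)
  have "e / (3 * c) > 0" using \<open>e > 0\<close> c by simp
  from translation_continuous_L1D[OF T this] obtain d where d: "d > 0"
    "\<And>y. norm y < d \<Longrightarrow> (\<integral>\<^sup>+x. ennreal \<bar>t n (x - y) - t n x\<bar> \<partial>lborel) \<le> ennreal (e / (3 * c))" by blast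
  show ?thesis
  proof (rule that[OF d(1)])
    fix y :: 'a assume y: "norm y < d"
    let ?F = "\<lambda>x. ennreal ((f x - t n x)\<^sup>2)"
    have "(\<integral>\<^sup>+x. ennreal ((f (x - y) - f x)\<^sup>2) \<partial>lborel)
       \<le> (\<integral>\<^sup>+x. (3 * ?F (x - y) + 3 * ?F x) + ennreal c * ennreal \<bar>t n (x - y) - t n x\<bar> \<partial>lborel)"
    proof (rule nn_integral_mono)
      fix x
      define a b r where "a = f (x - y) - t n (x - y)" and "b = f x - t n x" and "r = t n (x - y) - t n x"
      have "\<bar>r\<bar> \<le> 2 * real n" unfolding r_def t_def by auto
      hence "3 * (\<bar>r\<bar> * \<bar>r\<bar>) \<le> 3 * (2 * real n * \<bar>r\<bar>)" by (intro mult_left_mono mult_right_mono) auto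
      hence r: "3 * r\<^sup>2 \<le> c * \<bar>r\<bar>" unfolding c_def by (simp add: power2_eq_square algebra_simps)
      have "f (x - y) - f x = a - b + r" by (simp add: a_def b_def r_def)
      moreover have "(a - b + r)\<^sup>2 \<le> 3 * a\<^sup>2 + 3 * b\<^sup>2 + 3 * r\<^sup>2"
        using zero_le_power2[of "a + b"] zero_le_power2[of "a - r"] zero_le_power2[of "b + r"]
        by (simp add: power2_eq_square algebra_simps)
      ultimately have "(f (x - y) - f x)\<^sup>2 \<le> 3 * a\<^sup>2 + 3 * b\<^sup>2 + c * \<bar>r\<bar>" using r by simp
      hence "ennreal ((f (x - y) - f x)\<^sup>2) \<le> ennreal (3 * a\<^sup>2 + 3 * b\<^sup>2 + c * \<bar>r\<bar>)" by (rule ennreal_leI)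
      also have "\<dots> = (3 * ennreal (a\<^sup>2) + 3 * ennreal (b\<^sup>2)) + ennreal c * ennreal \<bar>r\<bar>"
        using c by (simp add: ennreal_plus ennreal_mult' less_imp_le)
      finally show "ennreal ((f (x - y) - f x)\<^sup>2) \<le> (3 * ?F (x - y) + 3 * ?F x) + ennreal c * ennreal \<bar>t n (x - y) - t n x\<bar>"
        by (simp add: a_def b_def r_def)
    qed
    also have "\<dots> = (3 * (\<integral>\<^sup>+x. ?F (x - y) \<partial>lborel) + 3 * (\<integral>\<^sup>+x. ?F x \<partial>lborel))
        + ennreal c * (\<integral>\<^sup>+x. ennreal \<bar>t n (x - y) - t n x\<bar> \<partial>lborel)"
      by (simp add: nn_integral_add nn_integral_cmult)
    also have "(\<integral>\<^sup>+x. ?F (x - y) \<partial>lborel) = (\<integral>\<^sup>+x. ?F x \<partial>lborel)"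
      by (rule nn_integral_lborel_shift) simp
    also have "3 * (\<integral>\<^sup>+x. ?F x \<partial>lborel) + 3 * (\<integral>\<^sup>+x. ?F x \<partial>lborel)
        + ennreal c * (\<integral>\<^sup>+x. ennreal \<bar>t n (x - y) - t n x\<bar> \<partial>lborel)
        \<le> 3 * ennreal (e / 9) + 3 * ennreal (e / 9) + ennreal c * ennreal (e / (3 * c))"
      by (intro add_mono mult_left_mono n' d(2) y) auto
    also have "3 * ennreal (e / 9) = ennreal (e / 3)" using ennreal_mult'[of 3 "e / 9"] by simp
    also have "ennreal c * ennreal (e / (3 * c)) = ennreal (e / 3)"
      using ennreal_mult'[of c "e / (3 * c)"] c by simp
    also have "ennreal (e / 3) + ennreal (e / 3) + ennreal (e / 3) = ennreal e"
      using \<open>e > 0\<close> by (simp flip: ennreal_plus)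
    finally show "(\<integral>\<^sup>+x. ennreal ((f (x - y) - f x)\<^sup>2) \<partial>lborel) \<le> ennreal e" .
  qed
qed

lemma locally_integrable_square_integrable:
  fixes f :: "'a::euclidean_space \<Rightarrow> real"
  assumes [measurable]: "f \<in> borel_measurable borel" and "integrable lborel (\<lambda>x. (f x)\<^sup>2)"
  shows "locally_integrable f"
  unfolding locally_integrable_def
proof (intro conjI allI impI assms(1))
  fix K :: "'a set" assume K: "compact K"
  hence [measurable]: "K \<in> sets borel" by (rule borel_compact)
  have "integrable lborel (\<lambda>x. indicator K x + (f x)\<^sup>2)"
    using assms(2) emeasure_compact_finite[OF K] by (intro Bochner_Integration.integrable_add integrable_real_indicator) auto
  thus "integrable lborel (\<lambda>x. indicator K x * f x)"
  proof (rule Bochner_Integration.integrable_bound)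
    have "\<bar>f x\<bar> \<le> 1 + (f x)\<^sup>2" for x
      using zero_le_power2[of "\<bar>f x\<bar> - 1"] by (simp add: power2_diff)
    thus "AE x in lborel. norm (indicator K x * f x) \<le> norm (indicator K x + (f x)\<^sup>2)"
      by (auto simp: indicator_def)
  qed simp
qed

lemma locally_integrable_integrable:
  assumes "integrable lborel f" shows "locally_integrable f"
  using assms integrable_mult_indicator[of _ lborel f]
  by (auto simp: locally_integrable_def borel_compact)

section \<open>Mollification\<close>

text \<open>As \<open>\<eta> (x - z)\<close> is a probability density in \<open>z\<close>, Jensen's
  inequality bounds the squared error at \<open>x\<close> by an average of squared differences of
  \<open>f\<close>. After Tonelli the inner integral is that of the shift by \<open>y\<close>, and
  only shifts shorter than \<open>d\<close> contribute.\<close>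

lemma conv_L2_approx:
  fixes f :: "real^'N \<Rightarrow> real"
  assumes f[measurable]: "f \<in> borel_measurable borel" and f2: "integrable lborel (\<lambda>x. (f x)\<^sup>2)" and "e > 0"
    and \<eta>: "\<eta> \<in> test_functions UNIV" "\<And>x. \<eta> x \<ge> 0" "(\<integral>x. \<eta> x \<partial>lborel) = 1"
      "\<And>x. norm x \<ge> d \<Longrightarrow> \<eta> x = 0"
    and d: "\<And>y. norm y < d \<Longrightarrow> (\<integral>\<^sup>+x. ennreal ((f (x - y) - f x)\<^sup>2) \<partial>lborel) \<le> ennreal e"
  shows "integrable lborel (\<lambda>x. (conv f \<eta> x - f x)\<^sup>2)" "(\<integral>x. (conv f \<eta> x - f x)\<^sup>2 \<partial>lborel) \<le> e"
proof -
  have [measurable]: "\<eta> \<in> borel_measurable borel" by (rule test_borel[OF \<eta>(1)])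
  note lf = locally_integrable_square_integrable[OF f f2]
  have [measurable]: "conv f \<eta> \<in> borel_measurable borel"
    using C_k_conv[OF lf \<eta>(1), of 0] by (simp add: borel_measurable_continuous_onI)
  have \<eta>1: "(\<integral>z. \<eta> (x - z) \<partial>lborel) = 1" for x
    using lborel_integral_reflect[of \<eta> x] \<eta>(3) by simp
  \<comment> \<open>A function that is not integrable has Bochner integral 0, so the value 1 already
    gives integrability.\<close>
  have \<eta>i: "integrable lborel (\<lambda>z. \<eta> (x - z))" for x
    using \<eta>1[of x] not_integrable_integral_eq by fastforce
  have Jensen: "ennreal ((conv f \<eta> x - f x)\<^sup>2) \<le> (\<integral>\<^sup>+z. ennreal ((f z - f x)\<^sup>2 * \<eta> (x - z)) \<partial>lborel)" for x
  proof -
    define m where "m = conv f \<eta> x - f x"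
    have i1: "integrable lborel (\<lambda>z. f z * \<eta> (x - z))" by (rule integrable_conv[OF lf \<eta>(1)])
    have i2: "integrable lborel (\<lambda>z. (f z)\<^sup>2 * \<eta> (x - z))"
      by (rule integrable_conv[OF locally_integrable_integrable[OF f2] \<eta>(1)])
    have "integrable lborel (\<lambda>z. (f z)\<^sup>2 * \<eta> (x - z) - 2 * f x * (f z * \<eta> (x - z)) + (f x)\<^sup>2 * \<eta> (x - z))"
      using i1 i2 \<eta>i[of x] by simp
    also have "(\<lambda>z. (f z)\<^sup>2 * \<eta> (x - z) - 2 * f x * (f z * \<eta> (x - z)) + (f x)\<^sup>2 * \<eta> (x - z))
       = (\<lambda>z. (f z - f x)\<^sup>2 * \<eta> (x - z))"
      by (auto simp: power2_eq_square algebra_simps)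
    finally have i3: "integrable lborel (\<lambda>z. (f z - f x)\<^sup>2 * \<eta> (x - z))" .
    have i4: "integrable lborel (\<lambda>z. (f z - f x) * \<eta> (x - z))"
      using i1 \<eta>i[of x] by (simp add: left_diff_distrib)
    have m4: "(\<integral>z. (f z - f x) * \<eta> (x - z) \<partial>lborel) = m"
      using i1 \<eta>i[of x] \<eta>1[of x] by (simp add: left_diff_distrib m_def conv_def)
    \<comment> \<open>Jensen's inequality in the form of a nonnegative variance: \<open>m\<close> is
      the mean of \<open>f z - f x\<close> under the density.\<close>
    have "0 \<le> (\<integral>z. (f z - f x - m)\<^sup>2 * \<eta> (x - z) \<partial>lborel)"
      by (rule Bochner_Integration.integral_nonneg) (simp add: \<eta>(2))
    also have "(\<lambda>z. (f z - f x - m)\<^sup>2 * \<eta> (x - z)) =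
       (\<lambda>z. (f z - f x)\<^sup>2 * \<eta> (x - z) - 2 * m * ((f z - f x) * \<eta> (x - z)) + m\<^sup>2 * \<eta> (x - z))"
      by (auto simp: power2_eq_square algebra_simps)
    also have "(\<integral>z. (f z - f x)\<^sup>2 * \<eta> (x - z) - 2 * m * ((f z - f x) * \<eta> (x - z)) + m\<^sup>2 * \<eta> (x - z) \<partial>lborel)
       = (\<integral>z. (f z - f x)\<^sup>2 * \<eta> (x - z) \<partial>lborel) - 2 * m * m + m\<^sup>2"
      using i3 i4 \<eta>i[of x] \<eta>1[of x] m4 by simp
    finally have "m\<^sup>2 \<le> (\<integral>z. (f z - f x)\<^sup>2 * \<eta> (x - z) \<partial>lborel)" by (simp add: power2_eq_square)
    hence "ennreal (m\<^sup>2) \<le> ennreal (\<integral>z. (f z - f x)\<^sup>2 * \<eta> (x - z) \<partial>lborel)" by (rule ennreal_leI)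
    also have "\<dots> = (\<integral>\<^sup>+z. ennreal ((f z - f x)\<^sup>2 * \<eta> (x - z)) \<partial>lborel)"
      by (rule nn_integral_eq_integral[symmetric]) (use i3 \<eta>(2) in auto)
    finally show ?thesis by (simp add: m_def)
  qed
  have "(\<integral>\<^sup>+x. ennreal ((conv f \<eta> x - f x)\<^sup>2) \<partial>lborel)
      \<le> (\<integral>\<^sup>+x. \<integral>\<^sup>+z. ennreal ((f z - f x)\<^sup>2 * \<eta> (x - z)) \<partial>lborel \<partial>lborel)"
    by (rule nn_integral_mono) (rule Jensen)
  also have "\<dots> = (\<integral>\<^sup>+x. \<integral>\<^sup>+y. ennreal ((f (x - y) - f x)\<^sup>2 * \<eta> y) \<partial>lborel \<partial>lborel)"
  proof (rule nn_integral_cong)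
    fix x
    show "(\<integral>\<^sup>+z. ennreal ((f z - f x)\<^sup>2 * \<eta> (x - z)) \<partial>lborel) = (\<integral>\<^sup>+y. ennreal ((f (x - y) - f x)\<^sup>2 * \<eta> y) \<partial>lborel)"
      using nn_integral_lborel_reflect[of "\<lambda>z. ennreal ((f z - f x)\<^sup>2 * \<eta> (x - z))" x] by simp
  qed
  also have "\<dots> = (\<integral>\<^sup>+y. \<integral>\<^sup>+x. ennreal ((f (x - y) - f x)\<^sup>2 * \<eta> y) \<partial>lborel \<partial>lborel)"
    by (rule lborel_pair.Fubini'[symmetric]) simp
  also have "\<dots> \<le> (\<integral>\<^sup>+y. ennreal e * ennreal (\<eta> y) \<partial>lborel)"
  proof (rule nn_integral_mono)
    fix y
    have "(\<integral>\<^sup>+x. ennreal ((f (x - y) - f x)\<^sup>2 * \<eta> y) \<partial>lborel)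
       = (\<integral>\<^sup>+x. ennreal ((f (x - y) - f x)\<^sup>2) \<partial>lborel) * ennreal (\<eta> y)"
      by (simp add: ennreal_mult'' \<eta>(2) nn_integral_multc)
    also have "\<dots> \<le> ennreal e * ennreal (\<eta> y)"
    proof (cases "norm y < d")
      case True
      thus ?thesis by (intro mult_right_mono d) auto
    next
      case False
      thus ?thesis using \<eta>(4)[of y] by simp
    qed
    finally show "(\<integral>\<^sup>+x. ennreal ((f (x - y) - f x)\<^sup>2 * \<eta> y) \<partial>lborel) \<le> ennreal e * ennreal (\<eta> y)" .
  qed
  also have "\<dots> = ennreal e * (\<integral>\<^sup>+y. ennreal (\<eta> y) \<partial>lborel)" by (rule nn_integral_cmult) simp
  also have "(\<integral>\<^sup>+y. ennreal (\<eta> y) \<partial>lborel) = 1"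
    using nn_integral_eq_integral[OF test_integrable[OF \<eta>(1)]] \<eta>(2,3) by simp
  finally have le: "(\<integral>\<^sup>+x. ennreal ((conv f \<eta> x - f x)\<^sup>2) \<partial>lborel) \<le> ennreal e" by simp
  show i: "integrable lborel (\<lambda>x. (conv f \<eta> x - f x)\<^sup>2)"
    by (rule integrableI_bounded) (use le in \<open>auto simp: less_top[symmetric] top_unique\<close>)
  show "(\<integral>x. (conv f \<eta> x - f x)\<^sup>2 \<partial>lborel) \<le> e"
    using le nn_integral_eq_integral[OF i] \<open>e > 0\<close> by (simp add: ennreal_le_iff)
qed

text \<open>Two cases matter later: the reflection \<open>b = -1\<close>, which occurs in
  \<open>\<eta> (x - z)\<close>, and the dilations of a cutoff.\<close>

lemma C_k_affine: "C_k m f \<Longrightarrow> C_k m (\<lambda>x. f (a + b *\<^sub>R x))"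
proof (induction m arbitrary: f)
  case 0
  thus ?case by (auto intro!: continuous_on_compose2[of UNIV f] continuous_intros)
next
  case (Suc m)
  have "((\<lambda>x. f (a + b *\<^sub>R x)) has_derivative (\<lambda>h. (b *\<^sub>R grad f (a + b *\<^sub>R x)) \<bullet> h)) (at x)" for x
  proof -
    have "((\<lambda>x. a + b *\<^sub>R x) has_derivative (\<lambda>h. b *\<^sub>R h)) (at x)"
      by (auto intro!: derivative_eq_intros)
    moreover have "f differentiable (at (a + b *\<^sub>R x))" using Suc.prems by simp
    ultimately show ?thesis
      using has_derivative_compose[OF _ grad_inner, of "\<lambda>x. a + b *\<^sub>R x" "\<lambda>h. b *\<^sub>R h" x UNIV f] by simp
  qed
  from C_k_Suc_iff[of "\<lambda>x. f (a + b *\<^sub>R x)" "\<lambda>x. b *\<^sub>R grad f (a + b *\<^sub>R x)", OF this]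
  moreover have "C_k m (\<lambda>x. b * grad f (a + b *\<^sub>R x) $ k)" for k
    by (intro C_k_mult C_k_const Suc.IH[of "\<lambda>x. grad f x $ k"]) (use Suc.prems in simp)
  ultimately show ?case by (simp del: C_k.simps)
qed

lemma grad_affine:
  assumes "f differentiable (at (a + b *\<^sub>R x))"
  shows "grad (\<lambda>x. f (a + b *\<^sub>R x)) x = b *\<^sub>R grad f (a + b *\<^sub>R x)"
proof (rule grad_eq_innerI)
  have "((\<lambda>x. a + b *\<^sub>R x) has_derivative (\<lambda>h. b *\<^sub>R h)) (at x)"
    by (auto intro!: derivative_eq_intros)
  from has_derivative_compose[OF this grad_inner[OF assms]]
  show "((\<lambda>x. f (a + b *\<^sub>R x)) has_derivative (\<lambda>h. (b *\<^sub>R grad f (a + b *\<^sub>R x)) \<bullet> h)) (at x)" by simp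
qed

lemma test_affine:
  assumes \<phi>: "\<phi> \<in> test_functions UNIV" and b: "b \<noteq> 0"
  shows "(\<lambda>x. \<phi> (a + b *\<^sub>R x)) \<in> test_functions UNIV"
proof -
  obtain R where R: "R > 0" "\<And>x. norm x > R \<Longrightarrow> \<phi> x = 0" using test_support_cball[OF \<phi>] by metis
  show ?thesis
  proof (rule test_functionsI[of _ "cball 0 ((R + norm a) / \<bar>b\<bar>)"])
    show "\<phi> (a + b *\<^sub>R x) = 0" if "x \<notin> cball 0 ((R + norm a) / \<bar>b\<bar>)" for x
    proof (rule R(2))
      have "R + norm a < norm (b *\<^sub>R x)" using that b by (simp add: field_simps)
      thus "norm (a + b *\<^sub>R x) > R" using norm_diff_ineq[of "b *\<^sub>R x" a] by (simp add: add.commute)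
    qed
  qed (rule C_k_affine test_C_k[OF \<phi>] compact_cball subset_UNIV)+
qed

lemma borel_measurable_lebesgueI:
  "f \<in> borel_measurable borel \<Longrightarrow> f \<in> borel_measurable lebesgue"
  by (simp add: measurable_completion)

text \<open>The reflected mollifier is taken as test function in the definition of the weak
  gradient. Reflection changes the sign of its gradient, which cancels the sign of the integration
  by parts. Mollification thus commutes with weak derivatives.\<close>

lemma conv_weak_gradient:
  fixes u g' :: "real^'N \<Rightarrow> real"
  assumes w: "has_weak_gradient UNIV u g" and \<eta>: "\<eta> \<in> test_functions UNIV"
    and u: "u \<in> borel_measurable lebesgue" and g: "(\<lambda>x. g x $ k) \<in> borel_measurable lebesgue"
    and u': "AE x in lborel. u x = u' x" "u' \<in> borel_measurable borel"
    and g': "AE x in lborel. g x $ k = g' x" "g' \<in> borel_measurable borel"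
  shows "conv u' (\<lambda>y. grad \<eta> y $ k) x = conv g' \<eta> x"
proof -
  let ?\<phi> = "\<lambda>z. \<eta> (x + (- 1) *\<^sub>R z)"
  have \<phi>: "?\<phi> \<in> test_functions UNIV" by (rule test_affine[OF \<eta>]) simp
  have gr: "grad ?\<phi> z = - grad \<eta> (x - z)" for z
    using grad_affine[OF test_differentiable[OF \<eta>], of x "-1" z] by simp
  have [measurable]: "\<eta> \<in> borel_measurable borel" "(\<lambda>y. grad \<eta> y $ k) \<in> borel_measurable borel"
    using test_borel[OF \<eta>] test_borel[OF test_grad[OF \<eta>]] by auto
  have m1: "(\<lambda>z. u' z * grad \<eta> (x - z) $ k) \<in> borel_measurable borel"
    "(\<lambda>z. g' z * \<eta> (x - z)) \<in> borel_measurable borel"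
    using u'(2) g'(2) by auto
  have m2: "(\<lambda>z. grad \<eta> (x - z) $ k) \<in> borel_measurable lebesgue"
    "(\<lambda>z. \<eta> (x - z)) \<in> borel_measurable lebesgue"
    by (rule borel_measurable_lebesgueI, measurable)+
  have AEc: "AE z in lebesgue. u z = u' z" "AE z in lebesgue. g z $ k = g' z"
    using u' g' by (auto intro: AE_completion)
  have "(\<integral>z. u z * grad ?\<phi> z $ k \<partial>lebesgue) = - (\<integral>z. g z $ k * ?\<phi> z \<partial>lebesgue)"
    using w \<phi> unfolding has_weak_gradient_def by (simp add: lebesgue_on_UNIV_eq)
  from this[unfolded gr]
  have "(\<integral>z. u z * grad \<eta> (x - z) $ k \<partial>lebesgue) = (\<integral>z. g z $ k * \<eta> (x - z) \<partial>lebesgue)"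
    by simp
  moreover have "(\<integral>z. u z * grad \<eta> (x - z) $ k \<partial>lebesgue) = (\<integral>z. u' z * grad \<eta> (x - z) $ k \<partial>lebesgue)"
    by (rule integral_cong_AE)
      (use AEc u m2 borel_measurable_lebesgueI[OF m1(1)] in \<open>auto intro: borel_measurable_times\<close>)
  moreover have "(\<integral>z. g z $ k * \<eta> (x - z) \<partial>lebesgue) = (\<integral>z. g' z * \<eta> (x - z) \<partial>lebesgue)"
    by (rule integral_cong_AE)
      (use AEc g m2 borel_measurable_lebesgueI[OF m1(2)] in \<open>auto intro: borel_measurable_times\<close>)
  ultimately show ?thesis using m1 by (simp add: conv_def integral_completion)
qed

lemma mollifier_exists:
  assumes "d > 0"
  obtains \<eta> :: "real^'N \<Rightarrow> real" where "\<eta> \<in> test_functions UNIV" "\<And>x. \<eta> x \<ge> 0"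
    "(\<integral>x. \<eta> x \<partial>lborel) = 1" "\<And>x. norm x \<ge> d \<Longrightarrow> \<eta> x = 0"
proof -
  let ?b = "bump d :: real^'N \<Rightarrow> real"
  define J where "J = (\<integral>x. ?b x \<partial>lborel)"
  note bt = bump_test[OF assms, where 'N='N]
  \<comment> \<open>The bump is positive on an open ball, which is not a null set.\<close>
  have "J \<noteq> 0"
  proof
    assume "J = 0"
    hence "AE x in lborel. ?b x = 0"
      using integral_nonneg_eq_0_iff_AE[OF test_integrable[OF bt]] bump_nonneg by (auto simp: J_def)
    moreover have "x \<notin> ball 0 d" if "?b x = 0" for x using bump_pos_iff[OF assms, of x] that by simp
    ultimately have "AE x in lborel. x \<notin> ball (0::real^'N) d" by (auto elim: eventually_mono)
    hence "emeasure lborel (ball (0::real^'N) d) = 0"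
      using AE_iff_null_sets[of "ball (0::real^'N) d" lborel] by auto
    thus False using open_not_negligible[of "ball (0::real^'N) d"] assms
      by (auto simp: negligible_iff_emeasure0)
  qed
  moreover have "J \<ge> 0" unfolding J_def by (rule Bochner_Integration.integral_nonneg) (rule bump_nonneg)
  ultimately have J: "J > 0" by simp
  show ?thesis
  proof (rule that[of "\<lambda>x. ?b x * (1 / J)"])
    show "(\<lambda>x. ?b x * (1 / J)) \<in> test_functions UNIV" by (rule test_mult[OF bt C_k_const])
    show "(\<integral>x. ?b x * (1 / J) \<partial>lborel) = 1" using J by (simp add: J_def)
    show "?b x * (1 / J) \<ge> 0" for x using J bump_nonneg[of d x] by simp
    show "?b x * (1 / J) = 0" if "norm x \<ge> d" for x
      using bump_pos_iff[OF assms, of x] that bump_nonneg[of d x] by (simp add: less_le)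
  qed
qed

lemma norm_vec_power2: "(norm (x::real^'n))\<^sup>2 = (\<Sum>k\<in>UNIV. (x $ k)\<^sup>2)"
  unfolding power2_norm_eq_inner by (simp add: inner_vec_def power2_eq_square)

lemma norm_add_power2_le:
  fixes a b :: "'a::real_inner"
  shows "(norm (a + b))\<^sup>2 \<le> 2 * (norm a)\<^sup>2 + 2 * (norm b)\<^sup>2"
  using inner_ge_zero[of "a - b"]
  by (simp add: power2_norm_eq_inner inner_add_left inner_add_right inner_diff_left inner_diff_right inner_commute)

lemma borel_measurable_component: "(\<lambda>x::real^'n. x $ k) \<in> borel_measurable borel"
  by (intro borel_measurable_continuous_onI continuous_intros)

lemma C_k_grad_continuous:
  assumes "\<And>m. C_k m w" shows "continuous_on UNIV (grad w)"
proof -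
  have "continuous_on UNIV (\<lambda>x. grad w x $ k)" for k using assms[of "Suc 0"] by simp
  hence "continuous_on UNIV (\<lambda>x. \<chi> k. grad w x $ k)" by (rule continuous_on_vec_lambda)
  thus ?thesis by simp
qed

text \<open>Working componentwise reduces the vector-valued gradient to the mollification results
  for real Borel functions.\<close>

lemma L2_component_representative:
  fixes g :: "real^'N \<Rightarrow> real^'N"
  assumes "g \<in> L2 UNIV"
  obtains G where "\<And>k. G k \<in> borel_measurable borel" "\<And>k. AE x in lborel. g x $ k = G k x"
    "\<And>k. integrable lborel (\<lambda>x. (G k x)\<^sup>2)"
proof -
  have m: "g \<in> borel_measurable lebesgue" and i: "integrable lebesgue (\<lambda>x. (norm (g x))\<^sup>2)"
    using assms by (auto simp: L2_def lebesgue_on_UNIV_eq)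
  have mk: "(\<lambda>x. g x $ k) \<in> borel_measurable lebesgue" for k
    using measurable_compose[OF m borel_measurable_component] by simp
  have "\<forall>k. \<exists>G\<in>borel_measurable lborel. AE x in lborel. g x $ k = G x"
    using completion_ex_borel_measurable_real[OF mk] by blast
  then obtain G where G: "\<And>k. G k \<in> borel_measurable lborel" "\<And>k. AE x in lborel. g x $ k = G k x"
    by metis
  have "integrable lborel (\<lambda>x. (G k x)\<^sup>2)" for k
  proof -
    have "integrable lebesgue (\<lambda>x. (G k x)\<^sup>2)"
    proof (rule Bochner_Integration.integrable_bound[OF i])
      show "(\<lambda>x. (G k x)\<^sup>2) \<in> borel_measurable lebesgue"
        using G(1)[of k] by (intro borel_measurable_lebesgueI) simp
      show "AE x in lebesgue. norm ((G k x)\<^sup>2) \<le> norm ((norm (g x))\<^sup>2)"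
        using AE_completion[OF G(2)[of k]]
      proof eventually_elim
        case (elim x)
        have "\<bar>g x $ k\<bar> \<le> norm (g x)" by (rule component_le_norm_cart)
        hence "(g x $ k)\<^sup>2 \<le> (norm (g x))\<^sup>2" by (metis abs_ge_zero power2_abs power_mono)
        thus ?case using elim by simp
      qed
    qed
    thus ?thesis using G(1)[of k] by (simp add: integrable_completion)
  qed
  thus ?thesis using that[of G] G by simp
qed

lemma L2_representative:
  fixes u :: "real^'N \<Rightarrow> real"
  assumes "u \<in> L2 UNIV"
  obtains u' where "u' \<in> borel_measurable borel" "AE x in lborel. u x = u' x"
    "integrable lborel (\<lambda>x. (u' x)\<^sup>2)"
proof -
  have m: "u \<in> borel_measurable lebesgue" and i: "integrable lebesgue (\<lambda>x. (u x)\<^sup>2)"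
    using assms by (auto simp: L2_def lebesgue_on_UNIV_eq)
  obtain u' where u': "u' \<in> borel_measurable lborel" "AE x in lborel. u x = u' x"
    using completion_ex_borel_measurable_real[OF m] by blast
  have "integrable lebesgue (\<lambda>x. (u' x)\<^sup>2)"
    by (rule integrable_cong_AE_imp[OF i])
      (use u'(1) AE_completion[OF u'(2)] in \<open>auto intro: borel_measurable_lebesgueI elim: eventually_mono\<close>)
  hence "integrable lborel (\<lambda>x. (u' x)\<^sup>2)" using u'(1) by (simp add: integrable_completion)
  thus ?thesis using that u' by simp
qed

text \<open>A single mollifier works, with radius below the translation moduli of the function and
  of all components of its gradient. Compact support is left to a separate cutoff.\<close>

lemma H1_smooth_approximation:
  fixes u :: "real^'N \<Rightarrow> real"
  assumes u: "u \<in> L2 UNIV" and g: "g \<in> L2 UNIV" and wg: "has_weak_gradient UNIV u g" and "\<epsilon> > 0"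
  obtains w where "\<And>m. C_k m w"
    "integrable lebesgue (\<lambda>x. (u x - w x)\<^sup>2 + (norm (g x - grad w x))\<^sup>2)"
    "(\<integral>x. (u x - w x)\<^sup>2 + (norm (g x - grad w x))\<^sup>2 \<partial>lebesgue) < \<epsilon>"
proof -
  have um: "u \<in> borel_measurable lebesgue" and gm: "g \<in> borel_measurable lebesgue"
    using u g by (auto simp: L2_def lebesgue_on_UNIV_eq)
  have gmk: "(\<lambda>x. g x $ k) \<in> borel_measurable lebesgue" for k
    using measurable_compose[OF gm borel_measurable_component] by simp
  obtain u' where u': "u' \<in> borel_measurable borel" "AE x in lborel. u x = u' x"
    "integrable lborel (\<lambda>x. (u' x)\<^sup>2)" using L2_representative[OF u] by blast
  obtain G where G: "\<And>k. G k \<in> borel_measurable borel" "\<And>k. AE x in lborel. g x $ k = G k x"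
    "\<And>k. integrable lborel (\<lambda>x. (G k x)\<^sup>2)" using L2_component_representative[OF g] by blast
  \<comment> \<open>One squared error for the function and one for each gradient component; the
    factor 2 makes the final inequality strict.\<close>
  define e where "e = \<epsilon> / (2 * (1 + real CARD('N)))"
  have e: "e > 0" using \<open>\<epsilon> > 0\<close> by (simp add: e_def add_pos_nonneg)
  obtain d0 where d0: "d0 > 0"
    "\<And>y. norm y < d0 \<Longrightarrow> (\<integral>\<^sup>+x. ennreal ((u' (x - y) - u' x)\<^sup>2) \<partial>lborel) \<le> ennreal e"
    using translation_continuous_L2[OF u'(1,3) e] by blast
  have "\<forall>k. \<exists>d>0. \<forall>y. norm y < d \<longrightarrow> (\<integral>\<^sup>+x. ennreal ((G k (x - y) - G k x)\<^sup>2) \<partial>lborel) \<le> ennreal e"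
    using translation_continuous_L2[OF G(1,3) e] by metis
  then obtain D where D: "\<And>k. D k > 0"
    "\<And>k y. norm y < D k \<Longrightarrow> (\<integral>\<^sup>+x. ennreal ((G k (x - y) - G k x)\<^sup>2) \<partial>lborel) \<le> ennreal e" by metis
  define d where "d = min d0 (Min (range D))"
  have d: "d > 0" "d \<le> d0" "d \<le> D k" for k using d0 D by (auto simp: d_def min.coboundedI2)
  obtain \<eta> :: "real^'N \<Rightarrow> real" where \<eta>: "\<eta> \<in> test_functions UNIV" "\<And>x. \<eta> x \<ge> 0"
    "(\<integral>x. \<eta> x \<partial>lborel) = 1" "\<And>x. norm x \<ge> d \<Longrightarrow> \<eta> x = 0" using mollifier_exists[OF d(1)] by blast
  have A: "integrable lborel (\<lambda>x. (conv u' \<eta> x - u' x)\<^sup>2)" "(\<integral>x. (conv u' \<eta> x - u' x)\<^sup>2 \<partial>lborel) \<le> e"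
    using conv_L2_approx[OF u'(1,3) e \<eta>] d0(2) d(2) by auto
  have B: "integrable lborel (\<lambda>x. (conv (G k) \<eta> x - G k x)\<^sup>2)" "(\<integral>x. (conv (G k) \<eta> x - G k x)\<^sup>2 \<partial>lborel) \<le> e" for k
    using conv_L2_approx[OF G(1)[of k] G(3)[of k] e \<eta>] D(2)[of _ k] d(3)[of k] by auto
  define w where "w = conv u' \<eta>"
  note lu = locally_integrable_square_integrable[OF u'(1,3)]
  have Cw: "C_k m w" for m unfolding w_def by (rule C_k_conv[OF lu \<eta>(1)])
  have gw: "grad w x $ k = conv (G k) \<eta> x" for x k
    unfolding w_def grad_conv[OF lu \<eta>(1)]
    by (rule conv_weak_gradient[OF wg \<eta>(1) um gmk u'(2,1) G(2,1)])
  define F where "F x = (conv u' \<eta> x - u' x)\<^sup>2 + (\<Sum>k\<in>UNIV. (conv (G k) \<eta> x - G k x)\<^sup>2)" for x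
  have Fi: "integrable lborel F" unfolding F_def using A B by auto
  have "AE x in lborel. \<forall>k. g x $ k = G k x" using G(2) by (simp add: AE_all_countable)
  with u'(2) have "AE x in lborel. F x = (u x - w x)\<^sup>2 + (norm (g x - grad w x))\<^sup>2"
    by eventually_elim (simp add: F_def w_def[symmetric] norm_vec_power2 gw power2_commute)
  hence AE: "AE x in lebesgue. F x = (u x - w x)\<^sup>2 + (norm (g x - grad w x))\<^sup>2" by (rule AE_completion)
  have "w \<in> borel_measurable lebesgue" "grad w \<in> borel_measurable lebesgue"
    using Cw[of 0] C_k_grad_continuous[OF Cw]
    by (auto intro!: borel_measurable_lebesgueI borel_measurable_continuous_onI)
  hence meas: "(\<lambda>x. (u x - w x)\<^sup>2 + (norm (g x - grad w x))\<^sup>2) \<in> borel_measurable lebesgue"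
    using um gm by simp
  have Fl: "integrable lebesgue F" using Fi by (simp add: integrable_completion)
  have int: "integrable lebesgue (\<lambda>x. (u x - w x)\<^sup>2 + (norm (g x - grad w x))\<^sup>2)"
    by (rule integrable_cong_AE_imp[OF Fl meas]) (use AE in \<open>auto elim: eventually_mono\<close>)
  have "(\<integral>x. (u x - w x)\<^sup>2 + (norm (g x - grad w x))\<^sup>2 \<partial>lebesgue) = (\<integral>x. F x \<partial>lebesgue)"
    by (rule integral_cong_AE) (use AE meas Fl in \<open>auto elim: eventually_mono\<close>)
  also have "\<dots> = (\<integral>x. F x \<partial>lborel)" using Fi by (simp add: integral_completion)
  also have "\<dots> = (\<integral>x. (conv u' \<eta> x - u' x)\<^sup>2 \<partial>lborel) + (\<Sum>k\<in>UNIV. \<integral>x. (conv (G k) \<eta> x - G k x)\<^sup>2 \<partial>lborel)"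
    unfolding F_def using A B by simp
  also have "\<dots> \<le> e + (\<Sum>k\<in>(UNIV::'N set). e)" by (intro add_mono sum_mono A B)
  also have "\<dots> = (1 + real CARD('N)) * e" by (simp add: algebra_simps)
  also have "\<dots> = \<epsilon> / 2"
    using add_pos_nonneg[of 1 "real CARD('N)"] by (simp add: e_def divide_simps)
  also have "\<dots> < \<epsilon>" using \<open>\<epsilon> > 0\<close> by simp
  finally show ?thesis using that[OF Cw int] by blast
qed

section \<open>Cutoff and density on the whole space\<close>

text \<open>Arithmetic of the majorant for the cutoff errors \<open>X\<close> and \<open>Y\<close>,
  those of the function and of the gradient. \<open>W\<close> and \<open>H\<close> stand for the
  squares of the smooth approximant and of its gradient norm, \<open>b\<close> and \<open>e\<close>
  for the squared bounds of the cutoff and of its gradient.\<close>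

lemma cutoff_bound:
  fixes X Y U G S R W H b e :: real
  assumes "X \<le> 2 * U + 2 * b * W" "Y \<le> 2 * G + 2 * (2 * S + 2 * R)" "S \<le> b * H" "R \<le> W * e"
    "0 \<le> b * W" "0 \<le> e * H"
  shows "X + Y \<le> 2 * U + 2 * G + (4 * b + 4 * e) * (W + H)"
proof -
  have "X + Y \<le> 2 * U + 2 * G + (4 * p + 4 * q + 4 * r + 4 * t)"
    if "X \<le> 2 * U + 2 * p" "S \<le> q" "R \<le> r" "0 \<le> p" "0 \<le> t" for p q r t
    using that assms(2) by simp
  from this[of "b * W" "b * H" "W * e" "e * H"] show ?thesis
    using assms by (simp add: algebra_simps)
qed

text \<open>The smooth approximant is multiplied by ever wider dilations of a cutoff. The total
  error converges to the error of the approximant itself, which is already below the prescribed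
  bound, so some cutoff stays below it too.\<close>

lemma H1_UNIV_subset_H1_0: "H1 (UNIV :: (real^'N) set) \<subseteq> H1_0 UNIV"
proof
  fix u :: "real^'N \<Rightarrow> real" assume "u \<in> H1 UNIV"
  then obtain g where u: "u \<in> L2 UNIV" and g: "g \<in> L2 UNIV" and wg: "has_weak_gradient UNIV u g"
    by (auto simp: H1_def)
  have um: "u \<in> borel_measurable lebesgue" and gm: "g \<in> borel_measurable lebesgue"
    and ui: "integrable lebesgue (\<lambda>x. (u x)\<^sup>2)" and gi: "integrable lebesgue (\<lambda>x. (norm (g x))\<^sup>2)"
    using u g by (auto simp: L2_def lebesgue_on_UNIV_eq)
  \<comment> \<open>Normalised to the value 1 at the origin: by continuity the dilated cutoffs then
    tend to 1 at every point.\<close>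
  define \<theta> :: "real^'N \<Rightarrow> real" where "\<theta> = (\<lambda>x. bump 1 x * (1 / bump 1 (0::real^'N)))"
  have \<theta>: "\<theta> \<in> test_functions UNIV" unfolding \<theta>_def by (rule test_mult[OF bump_test C_k_const]) simp
  have \<theta>0: "\<theta> 0 = 1" using bump_pos_iff[of 1 "0::real^'N"] by (simp add: \<theta>_def)
  obtain B1 where B1: "B1 > 0" "\<And>x. \<bar>\<theta> x\<bar> \<le> B1" using test_bounded[OF \<theta>] by blast
  obtain B2 where B2: "\<And>x. norm (grad \<theta> x) \<le> B2" using test_grad_bounded[OF \<theta>] by blast
  have "\<exists>\<phi>\<in>test_functions UNIV. (\<integral>x. (u x - \<phi> x)\<^sup>2 + (norm (g x - grad \<phi> x))\<^sup>2 \<partial>lebesgue) < \<epsilon>"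
    if \<epsilon>: "\<epsilon> > 0" for \<epsilon>
  proof -
    obtain w where w: "\<And>m. C_k m w"
      and wi: "integrable lebesgue (\<lambda>x. (u x - w x)\<^sup>2 + (norm (g x - grad w x))\<^sup>2)"
      and we: "(\<integral>x. (u x - w x)\<^sup>2 + (norm (g x - grad w x))\<^sup>2 \<partial>lebesgue) < \<epsilon>"
      using H1_smooth_approximation[OF u g wg \<epsilon>] by blast
    define c where "c n = 1 / real (Suc n)" for n
    have c: "0 < c n" "c n \<le> 1" for n by (auto simp: c_def)
    have c0: "c \<longlonglongrightarrow> 0" unfolding c_def[abs_def] using LIMSEQ_inverse_real_of_nat
      by (simp add: inverse_eq_divide)
    define \<phi> where "\<phi> n x = \<theta> (0 + c n *\<^sub>R x) * w x" for n x
    have \<phi>t: "\<phi> n \<in> test_functions UNIV" for n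
      unfolding \<phi>_def[abs_def] by (rule test_mult[OF test_affine[OF \<theta>] w]) (use c(1)[of n] in simp)
    have gr: "grad (\<phi> n) x = \<theta> (c n *\<^sub>R x) *\<^sub>R grad w x + (w x * c n) *\<^sub>R grad \<theta> (c n *\<^sub>R x)" for n x
    proof (rule grad_eq_innerI)
      let ?\<psi> = "\<lambda>x. \<theta> (0 + c n *\<^sub>R x)"
      have t: "?\<psi> \<in> test_functions UNIV" by (rule test_affine[OF \<theta>]) (use c(1)[of n] in simp)
      have 1: "(?\<psi> has_derivative (\<lambda>h. (c n *\<^sub>R grad \<theta> (0 + c n *\<^sub>R x)) \<bullet> h)) (at x)"
        using grad_inner[OF test_differentiable[OF t], of x] grad_affine[OF test_differentiable[OF \<theta>], of 0 "c n" x] by simp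
      have 2: "(w has_derivative (\<lambda>h. grad w x \<bullet> h)) (at x)" using w[of "Suc 0"] by (intro grad_inner) simp
      show "(\<phi> n has_derivative (\<lambda>h. (\<theta> (c n *\<^sub>R x) *\<^sub>R grad w x + (w x * c n) *\<^sub>R grad \<theta> (c n *\<^sub>R x)) \<bullet> h)) (at x)"
        unfolding \<phi>_def[abs_def] using has_derivative_mult[OF 1 2]
        by (simp add: inner_add_left mult_ac)
    qed
    define T where "T n x = (u x - \<phi> n x)\<^sup>2 + (norm (g x - grad (\<phi> n) x))\<^sup>2" for n x
    define W where "W x = (u x - w x)\<^sup>2 + (norm (g x - grad w x))\<^sup>2" for x
    have cm: "w \<in> borel_measurable lebesgue" "grad w \<in> borel_measurable lebesgue"
       "\<phi> n \<in> borel_measurable lebesgue" "grad (\<phi> n) \<in> borel_measurable lebesgue" for n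
      using w[of 0] C_k_grad_continuous[OF w] test_continuous[OF \<phi>t] test_grad_continuous[OF \<phi>t]
      by (auto intro!: borel_measurable_lebesgueI borel_measurable_continuous_onI)
    have sq: "(a - t * b)\<^sup>2 \<le> 2 * a\<^sup>2 + 2 * t\<^sup>2 * b\<^sup>2" for a b t :: real
      using zero_le_power2[of "a + t * b"] by (simp add: power2_eq_square algebra_simps)
    \<comment> \<open>A majorant independent of \<open>n\<close>: the smooth approximant and its
      gradient are estimated by \<open>u\<close>, \<open>g\<close> and the integrable error
      \<open>W\<close>, and \<open>c n \<le> 1\<close> absorbs the dilation factor.\<close>
    define M where "M x = 2 * (u x)\<^sup>2 + 2 * (norm (g x))\<^sup>2 + (4 * B1\<^sup>2 + 4 * B2\<^sup>2) * (2 * (u x)\<^sup>2 + 2 * W x + 2 * (norm (g x))\<^sup>2)" for x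
    have Mi: "integrable lebesgue M" unfolding M_def using ui gi wi[folded W_def] by simp
    have "(\<lambda>n. \<integral>x. T n x \<partial>lebesgue) \<longlonglongrightarrow> (\<integral>x. W x \<partial>lebesgue)"
    proof (rule integral_dominated_convergence[OF _ _ Mi])
      show "W \<in> borel_measurable lebesgue" unfolding W_def using wi by auto
      show "T n \<in> borel_measurable lebesgue" for n unfolding T_def using um gm cm by simp
      show "AE x in lebesgue. (\<lambda>n. T n x) \<longlonglongrightarrow> W x"
      proof (rule AE_I2)
        fix x :: "real^'N"
        have "isCont \<theta> 0" using test_continuous[OF \<theta>, of UNIV] by (simp add: continuous_on_eq_continuous_at)
        moreover have cx: "(\<lambda>n. c n *\<^sub>R x) \<longlonglongrightarrow> 0" 
          using tendsto_scaleR[OF c0 tendsto_const, of x] by simp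
        ultimately have 1: "(\<lambda>n. \<theta> (c n *\<^sub>R x)) \<longlonglongrightarrow> 1" using isCont_tendsto_compose \<theta>0 by fastforce
        have "isCont (grad \<theta>) 0" using test_grad_continuous[OF \<theta>, of UNIV] by (simp add: continuous_on_eq_continuous_at)
        hence 2: "(\<lambda>n. grad \<theta> (c n *\<^sub>R x)) \<longlonglongrightarrow> grad \<theta> 0" using cx isCont_tendsto_compose by blast
        have "(\<lambda>n. (u x - \<theta> (c n *\<^sub>R x) * w x)\<^sup>2 + (norm (g x - (\<theta> (c n *\<^sub>R x) *\<^sub>R grad w x + (w x * c n) *\<^sub>R grad \<theta> (c n *\<^sub>R x))))\<^sup>2)
          \<longlonglongrightarrow> (u x - 1 * w x)\<^sup>2 + (norm (g x - (1 *\<^sub>R grad w x + (w x * 0) *\<^sub>R grad \<theta> 0)))\<^sup>2"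
          by (intro tendsto_intros 1 2 c0)
        thus "(\<lambda>n. T n x) \<longlonglongrightarrow> W x" by (simp add: T_def W_def gr) (simp add: \<phi>_def)
      qed
      show "AE x in lebesgue. norm (T n x) \<le> M x" for n
      proof (rule AE_I2)
        fix x :: "real^'N"
        define s where "s = \<theta> (c n *\<^sub>R x)"
        define p where "p = grad \<theta> (c n *\<^sub>R x)"
        have s: "s\<^sup>2 \<le> B1\<^sup>2" using B1(2)[of "c n *\<^sub>R x"] by (simp add: s_def abs_le_square_iff[symmetric])
        have "norm (c n *\<^sub>R p) \<le> 1 * B2"
          unfolding norm_scaleR by (rule mult_mono) (use c[of n] B2[of "c n *\<^sub>R x"] in \<open>auto simp: p_def\<close>)
        hence p: "(norm (c n *\<^sub>R p))\<^sup>2 \<le> B2\<^sup>2" by (intro power_mono) auto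
        have w2: "(w x)\<^sup>2 \<le> 2 * (u x)\<^sup>2 + 2 * (u x - w x)\<^sup>2"
          using zero_le_power2[of "2 * u x - w x"] by (simp add: power2_eq_square algebra_simps)
        have gw2: "(norm (grad w x))\<^sup>2 \<le> 2 * (norm (g x))\<^sup>2 + 2 * (norm (g x - grad w x))\<^sup>2"
          using norm_add_power2_le[of "g x" "grad w x - g x"] by (simp add: norm_minus_commute)
        have "(u x - \<phi> n x)\<^sup>2 \<le> 2 * (u x)\<^sup>2 + 2 * s\<^sup>2 * (w x)\<^sup>2"
          using sq[of "u x" s "w x"] by (simp add: \<phi>_def s_def)
        also have "\<dots> \<le> 2 * (u x)\<^sup>2 + 2 * B1\<^sup>2 * (w x)\<^sup>2" using s by (simp add: mult_right_mono)
        finally have a: "(u x - \<phi> n x)\<^sup>2 \<le> 2 * (u x)\<^sup>2 + 2 * B1\<^sup>2 * (w x)\<^sup>2" .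
        have "(norm (g x - grad (\<phi> n) x))\<^sup>2 \<le> 2 * (norm (g x))\<^sup>2 + 2 * (norm (grad (\<phi> n) x))\<^sup>2"
          using norm_add_power2_le[of "g x" "- grad (\<phi> n) x"] by simp
        also have "grad (\<phi> n) x = s *\<^sub>R grad w x + w x *\<^sub>R (c n *\<^sub>R p)" by (simp add: gr s_def p_def)
        also have "(norm (s *\<^sub>R grad w x + w x *\<^sub>R (c n *\<^sub>R p)))\<^sup>2 \<le>
            2 * (norm (s *\<^sub>R grad w x))\<^sup>2 + 2 * (norm (w x *\<^sub>R (c n *\<^sub>R p)))\<^sup>2" by (rule norm_add_power2_le)
        also have "(norm (s *\<^sub>R grad w x))\<^sup>2 = s\<^sup>2 * (norm (grad w x))\<^sup>2" by (simp add: power_mult_distrib)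
        also have "(norm (w x *\<^sub>R (c n *\<^sub>R p)))\<^sup>2 = (w x)\<^sup>2 * (norm (c n *\<^sub>R p))\<^sup>2"
          by (simp only: norm_scaleR[of "w x"] power_mult_distrib) simp
        finally have b: "(norm (g x - grad (\<phi> n) x))\<^sup>2 \<le> 2 * (norm (g x))\<^sup>2 +
            2 * (2 * (s\<^sup>2 * (norm (grad w x))\<^sup>2) + 2 * ((w x)\<^sup>2 * (norm (c n *\<^sub>R p))\<^sup>2))"
          by (simp add: gr s_def[symmetric] p_def[symmetric])
        have b1: "s\<^sup>2 * (norm (grad w x))\<^sup>2 \<le> B1\<^sup>2 * (norm (grad w x))\<^sup>2" using s by (simp add: mult_right_mono)
        have b2: "(w x)\<^sup>2 * (norm (c n *\<^sub>R p))\<^sup>2 \<le> (w x)\<^sup>2 * B2\<^sup>2" using p by (intro mult_left_mono) auto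
        have "T n x \<le> 2 * (u x)\<^sup>2 + 2 * (norm (g x))\<^sup>2 + (4 * B1\<^sup>2 + 4 * B2\<^sup>2) * ((w x)\<^sup>2 + (norm (grad w x))\<^sup>2)"
          unfolding T_def by (rule cutoff_bound[OF a b b1 b2]) auto
        also have "\<dots> \<le> M x"
          unfolding M_def W_def by (intro add_left_mono mult_left_mono) (use w2 gw2 in auto)
        finally show "norm (T n x) \<le> M x" by (simp add: T_def)
      qed
    qed
    from order_tendstoD(2)[OF this we[folded W_def]]
    obtain n where "(\<integral>x. T n x \<partial>lebesgue) < \<epsilon>" using eventually_happens by force
    thus ?thesis using \<phi>t[of n] by (auto simp: T_def)
  qed
  thus "u \<in> H1_0 UNIV" using u g wg by (auto simp: H1_0_def lebesgue_on_UNIV_eq)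
qed

text \<open>Each component of a weak solution is therefore an admissible test element in the
  equations, also when the domain is the whole space.\<close>

lemma sol_space_subset_H1_0: "sol_space \<Omega> \<subseteq> H1_0 \<Omega>"
  using H1_UNIV_subset_H1_0 by (auto simp: sol_space_def)

section \<open>Test functions and limits on open sets\<close>

lemma borel_measurable_lebesgue_onI:
  "f \<in> borel_measurable borel \<Longrightarrow> f \<in> borel_measurable (lebesgue_on \<Omega>)"
  by (rule measurable_restrict_space1) (rule borel_measurable_lebesgueI)

lemma continuous_borel_measurable_lebesgue_on:
  "continuous_on UNIV f \<Longrightarrow> f \<in> borel_measurable (lebesgue_on \<Omega>)"
  by (intro borel_measurable_lebesgue_onI borel_measurable_continuous_onI)

lemma integrable_lborel_imp_lebesgue_on:
  fixes f :: "'a::euclidean_space \<Rightarrow> 'b::{banach, second_countable_topology}"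
  assumes "integrable lborel f" "\<Omega> \<in> sets lebesgue"
  shows "integrable (lebesgue_on \<Omega>) f"
proof -
  have "integrable lebesgue f" using assms(1) by (simp add: integrable_completion)
  thus ?thesis using assms(2) integrable_mult_indicator[of \<Omega> lebesgue f]
    by (simp add: integrable_restrict_space)
qed

lemma integral_lebesgue_on_eq_lborel:
  fixes f :: "'a::euclidean_space \<Rightarrow> real"
  assumes "f \<in> borel_measurable borel" "\<Omega> \<in> sets lebesgue" "\<And>x. x \<notin> \<Omega> \<Longrightarrow> f x = 0"
  shows "(\<integral>x. f x \<partial>lebesgue_on \<Omega>) = (\<integral>x. f x \<partial>lborel)"
proof -
  have "(\<integral>x. f x \<partial>lebesgue_on \<Omega>) = (\<integral>x. indicator \<Omega> x *\<^sub>R f x \<partial>lebesgue)"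
    using assms(2) by (simp add: integral_restrict_space)
  also have "(\<lambda>x. indicator \<Omega> x *\<^sub>R f x) = f" using assms(3) by (auto simp: fun_eq_iff indicator_def)
  finally show ?thesis using assms(1) by (simp add: integral_completion)
qed

lemma grad_mult:
  assumes "f differentiable (at x)" "h differentiable (at x)"
  shows "grad (\<lambda>x. f x * h x) x = f x *\<^sub>R grad h x + h x *\<^sub>R grad f x"
  by (rule grad_eq_innerI)
    (use has_derivative_mult[OF grad_inner[OF assms(1)] grad_inner[OF assms(2)]] in
      \<open>simp add: inner_add_left mult.commute\<close>)

lemma test_absolutely_integrable:
  assumes \<phi>: "\<phi> \<in> test_functions \<Omega>" and "compact K"
  shows "\<phi> absolutely_integrable_on K" "grad \<phi> absolutely_integrable_on K"
proof -
  obtain S where S: "compact S" "\<And>x. x \<notin> S \<Longrightarrow> \<phi> x = 0" "\<And>x. x \<notin> S \<Longrightarrow> grad \<phi> x = 0"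
    using test_functionsE[OF \<phi>] by metis
  have "integrable lborel \<phi>" "integrable lborel (grad \<phi>)"
    using integrable_compact_support[OF test_continuous[OF \<phi>] S(1,2)]
      integrable_compact_support[OF test_grad_continuous[OF \<phi>] S(1,3)] by auto
  moreover have "K \<in> sets lebesgue" using assms(2) by (simp add: borel_compact)
  ultimately show "\<phi> absolutely_integrable_on K" "grad \<phi> absolutely_integrable_on K"
    unfolding set_integrable_def
    using integrable_mult_indicator[of K lebesgue \<phi>] integrable_mult_indicator[of K lebesgue "grad \<phi>"]
    by (simp_all add: integrable_completion)
qed

lemma test_L2:
  assumes \<phi>: "\<phi> \<in> test_functions \<Omega>" and "open \<Omega>"
  shows "\<phi> \<in> L2 \<Omega>" "grad \<phi> \<in> L2 \<Omega>"
proof -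
  obtain S where S: "compact S" "\<And>x. x \<notin> S \<Longrightarrow> \<phi> x = 0" "\<And>x. x \<notin> S \<Longrightarrow> grad \<phi> x = 0"
    using test_functionsE[OF \<phi>] by metis
  have "integrable lborel (\<lambda>x. (\<phi> x)\<^sup>2)" "integrable lborel (\<lambda>x. (norm (grad \<phi> x))\<^sup>2)"
    by (rule integrable_compact_support[OF _ S(1)];
        use S in \<open>auto intro!: continuous_intros test_continuous[OF \<phi>] test_grad_continuous[OF \<phi>]\<close>)+
  thus "\<phi> \<in> L2 \<Omega>" "grad \<phi> \<in> L2 \<Omega>"
    using \<open>open \<Omega>\<close> continuous_borel_measurable_lebesgue_on[OF test_continuous[OF \<phi>]]
      continuous_borel_measurable_lebesgue_on[OF test_grad_continuous[OF \<phi>]]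
    by (auto simp: L2_def intro!: integrable_lborel_imp_lebesgue_on)
qed

text \<open>Integrate the product rule for \<open>\<phi>\<close> times \<open>\<zeta>\<close>; the
  gradient of that test function has integral 0.\<close>

lemma test_weak_gradient:
  fixes \<phi> :: "real^'N \<Rightarrow> real"
  assumes \<phi>: "\<phi> \<in> test_functions \<Omega>" and \<Omega>: "open \<Omega>"
  shows "has_weak_gradient \<Omega> \<phi> (grad \<phi>)"
proof -
  have "(\<integral>x. \<phi> x * grad \<zeta> x $ k \<partial>lebesgue_on \<Omega>) = - (\<integral>x. grad \<phi> x $ k * \<zeta> x \<partial>lebesgue_on \<Omega>)"
    if \<zeta>: "\<zeta> \<in> test_functions \<Omega>" for \<zeta> k
  proof -
    have L: "\<Omega> \<in> sets lebesgue" using \<Omega> by simp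
    have t1: "(\<lambda>x. \<phi> x * grad \<zeta> x $ k) \<in> test_functions \<Omega>" by (rule test_mult[OF \<phi> test_C_k[OF test_grad[OF \<zeta>]]])
    have t2: "(\<lambda>x. grad \<phi> x $ k * \<zeta> x) \<in> test_functions \<Omega>" by (rule test_mult[OF test_grad[OF \<phi>] test_C_k[OF \<zeta>]])
    have t3: "(\<lambda>x. \<phi> x * \<zeta> x) \<in> test_functions \<Omega>" by (rule test_mult[OF \<phi> test_C_k[OF \<zeta>]])
    have out: "\<theta> x = 0" if "\<theta> \<in> test_functions \<Omega>" "x \<notin> \<Omega>" for \<theta> x
      using test_functionsE[OF that(1)] that(2) by (metis subsetD)
    have "grad (\<lambda>x. \<phi> x * \<zeta> x) x $ k = \<phi> x * grad \<zeta> x $ k + grad \<phi> x $ k * \<zeta> x" for x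
      by (simp add: grad_mult[OF test_differentiable[OF \<phi>] test_differentiable[OF \<zeta>]])
    hence "(\<integral>x. \<phi> x * grad \<zeta> x $ k + grad \<phi> x $ k * \<zeta> x \<partial>lborel) = 0"
      using integral_grad_test[OF t3, of k] by simp
    hence "(\<integral>x. \<phi> x * grad \<zeta> x $ k \<partial>lborel) + (\<integral>x. grad \<phi> x $ k * \<zeta> x \<partial>lborel) = 0"
      using test_integrable[OF t1] test_integrable[OF t2] by simp
    thus ?thesis
      using integral_lebesgue_on_eq_lborel[OF test_borel[OF t1] L out[OF t1]]
        integral_lebesgue_on_eq_lborel[OF test_borel[OF t2] L out[OF t2]] by simp
  qed
  thus ?thesis using test_absolutely_integrable[OF \<phi>] by (auto simp: has_weak_gradient_def)
qed

section \<open>Almost everywhere convergent approximations\<close>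

text \<open>The sum of all \<open>D k\<close> is integrable by the geometric bound. It dominates
  each term, and where the series converges its terms tend to 0, so the whole sequence converges and
  not just a subsequence.\<close>

lemma fast_L1_null_sequence:
  fixes D :: "nat \<Rightarrow> 'a \<Rightarrow> real"
  assumes int: "\<And>k. integrable M (D k)" and nn: "\<And>k x. D k x \<ge> 0"
    and le: "\<And>k. (\<integral>x. D k x \<partial>M) \<le> (1 / 2) ^ k"
  obtains E where "integrable M E" "AE x in M. (\<forall>k. D k x \<le> E x) \<and> (\<lambda>k. D k x) \<longlonglongrightarrow> 0"
proof -
  have sum: "summable (\<lambda>k. \<integral>x. norm (D k x) \<partial>M)"
    by (rule summable_comparison_test'[of "\<lambda>k. (1 / 2) ^ k" 0]) (use le nn in \<open>auto simp: Bochner_Integration.integral_nonneg\<close>)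
  have eq: "(\<integral>\<^sup>+x. ennreal (D k x) \<partial>M) = ennreal (\<integral>x. D k x \<partial>M)" for k
    by (rule nn_integral_eq_integral) (use int nn in auto)
  have "(\<integral>\<^sup>+x. (\<Sum>k. ennreal (D k x)) \<partial>M) = (\<Sum>k. \<integral>\<^sup>+x. ennreal (D k x) \<partial>M)"
    using int by (intro nn_integral_suminf) auto
  also have "\<dots> = ennreal (\<Sum>k. \<integral>x. D k x \<partial>M)"
    unfolding eq using sum nn by (intro suminf_ennreal2) (auto simp: Bochner_Integration.integral_nonneg)
  finally have "(\<integral>\<^sup>+x. (\<Sum>k. ennreal (D k x)) \<partial>M) \<noteq> \<infinity>" by simp
  hence "AE x in M. (\<Sum>k. ennreal (D k x)) \<noteq> \<infinity>"
    using int by (intro nn_integral_PInf_AE) auto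
  hence AE: "AE x in M. summable (\<lambda>k. D k x)"
    by eventually_elim (use nn in \<open>auto intro: summable_suminf_not_top\<close>)
  show ?thesis
  proof (rule that)
    show "integrable M (\<lambda>x. \<Sum>k. D k x)"
      by (rule integrable_suminf[OF int _ sum]) (use AE nn in \<open>auto\<close>)
    show "AE x in M. (\<forall>k. D k x \<le> (\<Sum>k. D k x)) \<and> (\<lambda>k. D k x) \<longlonglongrightarrow> 0"
      using AE
    proof eventually_elim
      case (elim x)
      have "D k x \<le> (\<Sum>k. D k x)" for k
        using sum_le_suminf[OF elim, of "{k}"] nn by simp
      thus ?case using summable_LIMSEQ_zero[OF elim] by blast
    qed
  qed
qed

text \<open>Fatou's lemma with convergent bounds. It serves the potential side of the Picone
  estimates, where no integrable majorant is at hand; \<open>ennreal\<close> cuts negative values to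
  0.\<close>

lemma nn_integral_limit_le:
  fixes f :: "nat \<Rightarrow> 'a \<Rightarrow> real"
  assumes m: "\<And>n. f n \<in> borel_measurable M"
    and lim: "AE x in M. (\<lambda>n. f n x) \<longlonglongrightarrow> h x"
    and le: "\<And>n. (\<integral>\<^sup>+x. ennreal (f n x) \<partial>M) \<le> ennreal (c n)" and c: "c \<longlonglongrightarrow> C"
  shows "(\<integral>\<^sup>+x. ennreal (h x) \<partial>M) \<le> ennreal C"
proof -
  have "(\<integral>\<^sup>+x. ennreal (h x) \<partial>M) = (\<integral>\<^sup>+x. liminf (\<lambda>n. ennreal (f n x)) \<partial>M)"
  proof (rule nn_integral_cong_AE)
    show "AE x in M. ennreal (h x) = liminf (\<lambda>n. ennreal (f n x))"
      using lim by eventually_elim (auto intro!: lim_imp_Liminf[symmetric] tendsto_ennrealI)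
  qed
  also have "\<dots> \<le> liminf (\<lambda>n. \<integral>\<^sup>+x. ennreal (f n x) \<partial>M)"
    by (rule nn_integral_liminf) (use m in auto)
  also have "\<dots> \<le> liminf (\<lambda>n. ennreal (c n))" by (rule Liminf_mono) (use le in auto)
  also have "\<dots> = ennreal C" by (rule lim_imp_Liminf) (use c in \<open>auto intro: tendsto_ennrealI\<close>)
  finally show ?thesis .
qed

lemma test_H1_0:
  assumes \<phi>: "\<phi> \<in> test_functions \<Omega>" and \<Omega>: "open \<Omega>"
  shows "\<phi> \<in> H1_0 \<Omega>"
proof -
  have "\<exists>\<psi>\<in>test_functions \<Omega>. (\<integral>x. (\<phi> x - \<psi> x)\<^sup>2 + (norm (grad \<phi> x - grad \<psi> x))\<^sup>2 \<partial>lebesgue_on \<Omega>) < \<epsilon>"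
    if "\<epsilon> > 0" for \<epsilon>
    by (rule bexI[OF _ \<phi>]) (use that in simp)
  thus ?thesis using test_L2[OF assms] test_weak_gradient[OF assms] by (auto simp: H1_0_def)
qed

text \<open>Norm convergence alone does not pass through nonlinear expressions in the approximants.
  With errors below 2^(-k) there are pointwise limits and a common majorant \<open>E\<close>, as
  dominated convergence requires. The gradient \<open>g\<close> is an argument, so that the
  gradients tend to this very function.\<close>

lemma H1_0_sequence:
  fixes u :: "real^'N \<Rightarrow> real"
  assumes \<Omega>: "open \<Omega>" and u: "u \<in> L2 \<Omega>" and g: "g \<in> L2 \<Omega>"
    and ap: "\<And>\<epsilon>. \<epsilon> > 0 \<Longrightarrow> \<exists>\<phi>\<in>test_functions \<Omega>.
        (\<integral>x. (u x - \<phi> x)\<^sup>2 + (norm (g x - grad \<phi> x))\<^sup>2 \<partial>lebesgue_on \<Omega>) < \<epsilon>"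
  obtains \<psi> E where "\<And>k::nat. \<psi> k \<in> test_functions \<Omega>" "integrable (lebesgue_on \<Omega>) E"
    "AE x in lebesgue_on \<Omega>. (\<forall>k. (\<psi> k x)\<^sup>2 \<le> E x \<and> (norm (grad (\<psi> k) x))\<^sup>2 \<le> E x) \<and>
       (\<lambda>k. \<psi> k x) \<longlonglongrightarrow> u x \<and> (\<lambda>k. grad (\<psi> k) x) \<longlonglongrightarrow> g x"
proof -
  let ?M = "lebesgue_on \<Omega>"
  have um: "u \<in> borel_measurable ?M" and gm: "g \<in> borel_measurable ?M"
    and ui: "integrable ?M (\<lambda>x. (u x)\<^sup>2)" and gi: "integrable ?M (\<lambda>x. (norm (g x))\<^sup>2)"
    using u g by (auto simp: L2_def)
  let ?d = "\<lambda>\<phi>. \<integral>x. (u x - \<phi> x)\<^sup>2 + (norm (g x - grad \<phi> x))\<^sup>2 \<partial>?M"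
  have "\<exists>\<phi>. \<phi> \<in> test_functions \<Omega> \<and> ?d \<phi> < (1 / 2) ^ k" for k :: nat
    using ap[of "(1 / 2) ^ k"] unfolding Bex_def by simp
  hence "\<exists>\<psi>. \<forall>k::nat. \<psi> k \<in> test_functions \<Omega> \<and> ?d (\<psi> k) < (1 / 2) ^ k"
    by (intro choice allI)
  then obtain \<psi> where \<psi>: "\<And>k::nat. \<psi> k \<in> test_functions \<Omega>" "\<And>k. ?d (\<psi> k) < (1 / 2) ^ k" by blast
  define D where "D k x = (u x - \<psi> k x)\<^sup>2 + (norm (g x - grad (\<psi> k) x))\<^sup>2" for k x
  have nsq: "(a - b)\<^sup>2 \<le> 2 * a\<^sup>2 + 2 * b\<^sup>2" for a b :: real
    using norm_add_power2_le[of a "- b"] by simp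
  have nsq': "(norm (a - b))\<^sup>2 \<le> 2 * (norm a)\<^sup>2 + 2 * (norm b)\<^sup>2" for a b :: "real^'N"
    using norm_add_power2_le[of a "- b"] by simp
  have Di: "integrable ?M (D k)" for k
  proof (rule Bochner_Integration.integrable_bound)
    have pm: "\<psi> k \<in> borel_measurable ?M" "grad (\<psi> k) \<in> borel_measurable ?M"
      and pi: "integrable ?M (\<lambda>x. (\<psi> k x)\<^sup>2)" "integrable ?M (\<lambda>x. (norm (grad (\<psi> k) x))\<^sup>2)"
      using test_L2[OF \<psi>(1)[of k] \<Omega>] by (auto simp: L2_def)
    show "D k \<in> borel_measurable ?M" unfolding D_def using um gm pm by simp
    show "integrable ?M (\<lambda>x. (2 * (u x)\<^sup>2 + 2 * (\<psi> k x)\<^sup>2) + (2 * (norm (g x))\<^sup>2 + 2 * (norm (grad (\<psi> k) x))\<^sup>2))"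
      using ui gi pi by simp
    show "AE x in ?M. norm (D k x) \<le> norm ((2 * (u x)\<^sup>2 + 2 * (\<psi> k x)\<^sup>2) + (2 * (norm (g x))\<^sup>2 + 2 * (norm (grad (\<psi> k) x))\<^sup>2))"
    proof (rule AE_I2)
      fix x
      have "D k x \<le> (2 * (u x)\<^sup>2 + 2 * (\<psi> k x)\<^sup>2) + (2 * (norm (g x))\<^sup>2 + 2 * (norm (grad (\<psi> k) x))\<^sup>2)"
        unfolding D_def by (intro add_mono nsq nsq')
      moreover have "D k x \<ge> 0" by (simp add: D_def)
      ultimately show "norm (D k x) \<le> norm ((2 * (u x)\<^sup>2 + 2 * (\<psi> k x)\<^sup>2) + (2 * (norm (g x))\<^sup>2 + 2 * (norm (grad (\<psi> k) x))\<^sup>2))"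
        by simp
    qed
  qed
  have D0: "D k x \<ge> 0" for k x by (simp add: D_def)
  have Dle: "(\<integral>x. D k x \<partial>?M) \<le> (1 / 2) ^ k" for k using \<psi>(2)[of k] by (simp add: D_def less_imp_le)
  obtain D' where D': "integrable ?M D'" "AE x in ?M. (\<forall>k. D k x \<le> D' x) \<and> (\<lambda>k. D k x) \<longlonglongrightarrow> 0"
    by (rule fast_L1_null_sequence[of ?M D, OF Di D0 Dle]) (rule that)
  show ?thesis
  proof (rule that[OF \<psi>(1)])
    \<comment> \<open>The majorant combines v^2 <= 2 u^2 + 2 (u - v)^2 for the approximants v, the
      analogue for gradients, and the function \<open>D'\<close> that dominates all errors.\<close>
    show "integrable ?M (\<lambda>x. 2 * (u x)\<^sup>2 + 2 * (norm (g x))\<^sup>2 + 2 * D' x)" using ui gi D'(1) by simp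
    show "AE x in ?M. (\<forall>k. (\<psi> k x)\<^sup>2 \<le> 2 * (u x)\<^sup>2 + 2 * (norm (g x))\<^sup>2 + 2 * D' x \<and>
         (norm (grad (\<psi> k) x))\<^sup>2 \<le> 2 * (u x)\<^sup>2 + 2 * (norm (g x))\<^sup>2 + 2 * D' x) \<and>
       (\<lambda>k. \<psi> k x) \<longlonglongrightarrow> u x \<and> (\<lambda>k. grad (\<psi> k) x) \<longlonglongrightarrow> g x"
      using D'(2)
    proof eventually_elim
      case (elim x)
      have a: "(\<psi> k x)\<^sup>2 \<le> 2 * (u x)\<^sup>2 + 2 * (norm (g x))\<^sup>2 + 2 * D' x" for k
      proof -
        have "(u x - \<psi> k x)\<^sup>2 \<le> D' x"
          using elim[THEN conjunct1, rule_format, of k] zero_le_power2[of "norm (g x - grad (\<psi> k) x)"]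
          unfolding D_def by linarith
        moreover have "(\<psi> k x)\<^sup>2 \<le> 2 * (u x)\<^sup>2 + 2 * (u x - \<psi> k x)\<^sup>2"
          using nsq[of "u x" "u x - \<psi> k x"] by simp
        ultimately show ?thesis using zero_le_power2[of "norm (g x)"] by linarith
      qed
      have b: "(norm (grad (\<psi> k) x))\<^sup>2 \<le> 2 * (u x)\<^sup>2 + 2 * (norm (g x))\<^sup>2 + 2 * D' x" for k
      proof -
        have "(norm (g x - grad (\<psi> k) x))\<^sup>2 \<le> D' x"
          using elim[THEN conjunct1, rule_format, of k] zero_le_power2[of "u x - \<psi> k x"] unfolding D_def by linarith
        moreover have "(norm (grad (\<psi> k) x))\<^sup>2 \<le> 2 * (norm (g x))\<^sup>2 + 2 * (norm (g x - grad (\<psi> k) x))\<^sup>2"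
          using nsq'[of "g x" "g x - grad (\<psi> k) x"] by simp
        ultimately show ?thesis using zero_le_power2[of "u x"] by linarith
      qed
      have c1: "(\<lambda>k. (u x - \<psi> k x)\<^sup>2) \<longlonglongrightarrow> 0"
        by (rule tendsto_sandwich[OF _ _ tendsto_const elim[THEN conjunct2]]) (auto simp: D_def)
      have c2: "(\<lambda>k. (norm (g x - grad (\<psi> k) x))\<^sup>2) \<longlonglongrightarrow> 0"
        by (rule tendsto_sandwich[OF _ _ tendsto_const elim[THEN conjunct2]]) (auto simp: D_def)
      have "(\<lambda>k. sqrt ((u x - \<psi> k x)\<^sup>2)) \<longlonglongrightarrow> sqrt 0" by (rule tendsto_real_sqrt[OF c1])
      hence "(\<lambda>k. norm (\<psi> k x - u x)) \<longlonglongrightarrow> 0" by (simp add: abs_minus_commute)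
      hence "(\<lambda>k. \<psi> k x) \<longlonglongrightarrow> u x" by (rule LIM_zero_cancel[OF tendsto_norm_zero_cancel])
      moreover have "(\<lambda>k. sqrt ((norm (g x - grad (\<psi> k) x))\<^sup>2)) \<longlonglongrightarrow> sqrt 0" by (rule tendsto_real_sqrt[OF c2])
      hence "(\<lambda>k. norm (grad (\<psi> k) x - g x)) \<longlonglongrightarrow> 0" by (simp add: norm_minus_commute)
      hence "(\<lambda>k. grad (\<psi> k) x) \<longlonglongrightarrow> g x" by (rule LIM_zero_cancel[OF tendsto_norm_zero_cancel])
      ultimately show ?case using a b by blast
    qed
  qed
qed

section \<open>Picone's inequality\<close>

text \<open>Picone's identity tests with \<open>\<phi>\<^sup>2 / u\<close>. Here \<open>1 / t\<close> is replaced by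
  \<open>\<beta> t = 2 / (q t + t)\<close> with \<open>q t = sqrt (t\<^sup>2 + \<epsilon>\<^sup>2)\<close>, which is smooth and positive on the whole
  line, because the test functions approximating \<open>u\<close> may change sign; it satisfies
  \<open>\<beta>' = - \<beta> / q\<close>.\<close>

lemma C_k_regularized_reciprocal:
  assumes "\<epsilon> > 0" "C_k m \<psi>"
  shows "C_k m (\<lambda>x. 2 / \<epsilon>\<^sup>2 * (sqrt ((\<psi> x)\<^sup>2 + \<epsilon>\<^sup>2) - \<psi> x))"
proof -
  have p: "(\<psi> x)\<^sup>2 + \<epsilon>\<^sup>2 > 0" for x using assms(1) by (simp add: add_nonneg_pos)
  \<comment> \<open>In this rationalised form \<open>\<beta>\<close> is a multiple of q - t and
    involves no quotient of functions; q is a power of a positive smooth function.\<close>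
  have "C_k m (\<lambda>x. 2 / \<epsilon>\<^sup>2 * (((\<psi> x)\<^sup>2 + \<epsilon>\<^sup>2) powr (1 / 2) + (- 1) * \<psi> x))"
    unfolding power2_eq_square[of "\<psi> _"]
    by (intro C_k_mult C_k_const C_k_add C_k_powr assms(2)) (use p in \<open>simp add: power2_eq_square\<close>)
  thus ?thesis using p by (simp add: powr_half_sqrt less_imp_le)
qed

text \<open>Everything rests on (q - t) (q + t) = \<epsilon>^2 and |t| < q <= |t| + \<epsilon>. The
  last two bounds, for \<open>\<beta>\<close> and for the size \<open>\<beta> / q\<close> of its
  derivative, hold for \<open>t\<close> of any sign and supply the majorant at fixed
  \<open>\<epsilon>\<close>.\<close>

lemma regularized_reciprocal_bounds:
  fixes t \<epsilon> :: real
  assumes "\<epsilon> > 0"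
  defines "q \<equiv> sqrt (t\<^sup>2 + \<epsilon>\<^sup>2)" and "\<beta> \<equiv> 2 / \<epsilon>\<^sup>2 * (sqrt (t\<^sup>2 + \<epsilon>\<^sup>2) - t)"
  shows "q > 0" "\<beta> > 0" "\<beta> = 2 / (q + t)" "\<bar>\<beta>\<bar> \<le> 2 / \<epsilon> + 4 / \<epsilon>\<^sup>2 * \<bar>t\<bar>" "\<beta> / q \<le> 4 / \<epsilon>\<^sup>2"
proof -
  have qt: "q > \<bar>t\<bar>" unfolding q_def using assms(1) by (intro real_less_rsqrt) simp
  thus q: "q > 0" by simp
  have b: "\<beta> = 2 / \<epsilon>\<^sup>2 * (q - t)" by (simp add: \<beta>_def q_def)
  show "\<beta> > 0" using qt assms(1) by (simp add: b)
  have q2: "q\<^sup>2 = t\<^sup>2 + \<epsilon>\<^sup>2" unfolding q_def by simp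
  have "(q - t) * (q + t) = \<epsilon>\<^sup>2" using q2 by (simp add: power2_eq_square algebra_simps)
  moreover have "q + t > 0" using qt by simp
  ultimately show "\<beta> = 2 / (q + t)" using assms(1) unfolding b by (simp add: field_simps)
  have "q \<le> \<bar>t\<bar> + \<epsilon>" unfolding q_def using sqrt_sum_squares_le_sum_abs[of t \<epsilon>] assms(1) by simp
  hence "\<beta> \<le> 2 / \<epsilon>\<^sup>2 * (2 * \<bar>t\<bar> + \<epsilon>)" unfolding b using assms(1) by (intro mult_left_mono) auto
  also have "\<dots> = 2 / \<epsilon> + 4 / \<epsilon>\<^sup>2 * \<bar>t\<bar>" using assms(1) by (simp add: field_simps power2_eq_square)
  finally show "\<bar>\<beta>\<bar> \<le> 2 / \<epsilon> + 4 / \<epsilon>\<^sup>2 * \<bar>t\<bar>" using \<open>\<beta> > 0\<close> by simp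
  have "\<beta> \<le> 2 / \<epsilon>\<^sup>2 * (2 * q)" unfolding b using qt assms(1) by (intro mult_left_mono) auto
  thus "\<beta> / q \<le> 4 / \<epsilon>\<^sup>2" using q by (simp add: divide_le_eq)
qed

lemma regularized_reciprocal_derivative:
  fixes t \<epsilon> :: real
  assumes "\<epsilon> > 0"
  shows "((\<lambda>t. 2 / \<epsilon>\<^sup>2 * (sqrt (t\<^sup>2 + \<epsilon>\<^sup>2) - t)) has_real_derivative
     - (2 / \<epsilon>\<^sup>2 * (sqrt (t\<^sup>2 + \<epsilon>\<^sup>2) - t)) / sqrt (t\<^sup>2 + \<epsilon>\<^sup>2)) (at t)"
proof -
  have p: "t\<^sup>2 + \<epsilon>\<^sup>2 > 0" using assms by (simp add: add_nonneg_pos)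
  hence s: "sqrt (t\<^sup>2 + \<epsilon>\<^sup>2) > 0" by simp
  have "((\<lambda>t. t\<^sup>2 + \<epsilon>\<^sup>2) has_real_derivative 2 * t) (at t)"
    by (auto intro!: derivative_eq_intros)
  from DERIV_chain2[OF DERIV_real_sqrt[OF p] this]
  have "((\<lambda>t. sqrt (t\<^sup>2 + \<epsilon>\<^sup>2)) has_real_derivative t / sqrt (t\<^sup>2 + \<epsilon>\<^sup>2)) (at t)"
    by (simp add: field_simps)
  from DERIV_cmult[OF DERIV_diff[OF this DERIV_ident], of "2 / \<epsilon>\<^sup>2"]
  show ?thesis by (rule DERIV_cong) (use s assms in \<open>simp add: field_simps\<close>)
qed

text \<open>Expand the square of \<open>p *\<^sub>R a - q *\<^sub>R b\<close>. With \<open>a\<close>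
  the gradient of u and \<open>b\<close> that of the test function \<open>p\<close>, this is
  Picone's inequality, where \<open>\<beta> * q\<close> takes the place of the factor 1.\<close>

lemma Picone_integrand_bound:
  fixes a b :: "real^'N"
  assumes "\<beta> > 0" "q > (0::real)"
  shows "2 * p * \<beta> * (a \<bullet> b) - p\<^sup>2 * (\<beta> / q) * (a \<bullet> a) \<le> \<beta> * q * (b \<bullet> b)"
proof -
  have "0 \<le> \<beta> / q * ((p *\<^sub>R a - q *\<^sub>R b) \<bullet> (p *\<^sub>R a - q *\<^sub>R b))" using assms by simp
  also have "\<dots> = p\<^sup>2 * (\<beta> / q) * (a \<bullet> a) - 2 * p * \<beta> * (a \<bullet> b) + \<beta> * q * (b \<bullet> b)"
    using assms(2) by (simp add: inner_diff_left inner_diff_right inner_commute power2_eq_square field_simps)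
  finally show ?thesis by simp
qed

text \<open>Here \<open>p\<close> and \<open>d\<close> are the test function and its gradient norm,
  \<open>t\<close> is the approximant of \<open>u\<close>, \<open>r\<close> is
  \<open>\<beta>\<close> at \<open>t\<close>, \<open>s\<close> is \<open>\<beta> / q\<close>, and
  \<open>m\<close>, \<open>n\<close> are the gradient norms of the approximant and of
  \<open>u\<close>. Products of two unbounded quantities are split by x y <= x^2 + y^2 into squares
  with integrable majorants.\<close>

lemma Picone_majorant:
  fixes p d r t n u l E c a b :: real
  assumes p: "\<bar>p\<bar> \<le> B1" and d: "0 \<le> d" "d \<le> B2" and r: "\<bar>r\<bar> \<le> a + b * \<bar>t\<bar>"
    and ab: "a \<ge> 0" "b \<ge> 0" and s: "0 \<le> s" "s \<le> b" and E: "t\<^sup>2 \<le> E" "m\<^sup>2 \<le> E"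
    and nn: "n \<ge> 0" "m \<ge> 0" "l \<ge> 0"
  shows "n * (2 * \<bar>p\<bar> * \<bar>r\<bar> * d + p\<^sup>2 * s * m) + l * \<bar>u\<bar> * (p\<^sup>2 * \<bar>r\<bar>)
    \<le> (2 * B2 * a + 2 * B1 * B2 * b + B1\<^sup>2 * b + l * B1 * a + l * B1\<^sup>2 * b) * (p\<^sup>2 + u\<^sup>2 + n\<^sup>2 + E)"
proof -
  define S where "S = p\<^sup>2 + u\<^sup>2 + n\<^sup>2 + E"
  have am: "x * y \<le> x\<^sup>2 + y\<^sup>2" for x y :: real
  proof -
    have "2 * (x * y) \<le> x\<^sup>2 + y\<^sup>2" using zero_le_power2[of "x - y"] by (simp add: power2_diff)
    thus ?thesis using zero_le_power2[of x] zero_le_power2[of y] by linarith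
  qed
  have E0: "E \<ge> 0" using E(1) zero_le_power2[of t] by linarith
  have B: "B1 \<ge> 0" "B2 \<ge> 0" using p d by auto
  have Sl: "n * \<bar>p\<bar> \<le> S" "n * \<bar>t\<bar> \<le> S" "n * m \<le> S" "\<bar>u\<bar> * \<bar>p\<bar> \<le> S" "\<bar>u\<bar> * \<bar>t\<bar> \<le> S"
    using am[of n "\<bar>p\<bar>"] am[of n "\<bar>t\<bar>"] am[of n m] am[of "\<bar>u\<bar>" "\<bar>p\<bar>"] am[of "\<bar>u\<bar>" "\<bar>t\<bar>"] E E0
      zero_le_power2[of p] zero_le_power2[of u] zero_le_power2[of n]
    unfolding S_def power2_abs by linarith+
  have p2: "p\<^sup>2 \<le> B1\<^sup>2" using p abs_le_square_iff[of p B1] B by simp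
  have "n * (2 * \<bar>p\<bar> * \<bar>r\<bar> * d) \<le> n * (2 * \<bar>p\<bar> * (a + b * \<bar>t\<bar>) * B2)"
    using nn B d r ab by (intro mult_left_mono mult_mono) auto
  also have "\<dots> = 2 * B2 * a * (n * \<bar>p\<bar>) + 2 * \<bar>p\<bar> * B2 * b * (n * \<bar>t\<bar>)" by (simp add: algebra_simps)
  also have "\<dots> \<le> 2 * B2 * a * S + 2 * B1 * B2 * b * S"
    using nn B ab p Sl by (intro add_mono mult_mono mult_left_mono mult_right_mono) auto
  finally have 1: "n * (2 * \<bar>p\<bar> * \<bar>r\<bar> * d) \<le> 2 * B2 * a * S + 2 * B1 * B2 * b * S" .
  have "n * (p\<^sup>2 * s * m) = (p\<^sup>2 * s) * (n * m)" by simp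
  also have "\<dots> \<le> (B1\<^sup>2 * b) * S" using p2 s Sl nn by (intro mult_mono) auto
  finally have 2: "n * (p\<^sup>2 * s * m) \<le> B1\<^sup>2 * b * S" .
  have "l * \<bar>u\<bar> * (p\<^sup>2 * \<bar>r\<bar>) \<le> l * \<bar>u\<bar> * (p\<^sup>2 * (a + b * \<bar>t\<bar>))"
    using nn r by (intro mult_left_mono) auto
  also have "\<dots> = l * \<bar>p\<bar> * a * (\<bar>u\<bar> * \<bar>p\<bar>) + l * p\<^sup>2 * b * (\<bar>u\<bar> * \<bar>t\<bar>)"
  proof -
    have "p\<^sup>2 = \<bar>p\<bar> * \<bar>p\<bar>" by (simp add: power2_eq_square)
    thus ?thesis by (simp only:) (simp add: algebra_simps)
  qed
  also have "\<dots> \<le> l * B1 * a * S + l * B1\<^sup>2 * b * S"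
    using nn B ab p p2 Sl by (intro add_mono mult_mono mult_left_mono mult_right_mono) auto
  finally have 3: "l * \<bar>u\<bar> * (p\<^sup>2 * \<bar>r\<bar>) \<le> l * B1 * a * S + l * B1\<^sup>2 * b * S" .
  show ?thesis using 1 2 3 unfolding S_def[symmetric] by (simp add: distrib_left distrib_right)
qed

text \<open>For u > 0 the form 2 / (q + u) of \<open>\<beta>\<close> gives
  \<open>\<beta> * q \<le> 2\<close> and \<open>u * \<beta> \<le> 2\<close>. The resulting majorant
  is free of \<open>\<epsilon>\<close> and serves again when \<open>\<epsilon>\<close> tends to
  0.\<close>

lemma Picone_rhs_integrable:
  fixes u \<phi> :: "real^'N \<Rightarrow> real"
  assumes \<epsilon>: "\<epsilon> > 0" and um: "u \<in> borel_measurable M" and pos: "AE x in M. u x > 0"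
    and pm: "\<phi> \<in> borel_measurable M" "grad \<phi> \<in> borel_measurable M"
    and pi: "integrable M (\<lambda>x. (\<phi> x)\<^sup>2)" "integrable M (\<lambda>x. (norm (grad \<phi> x))\<^sup>2)" and lam: "lam \<ge> 0"
  shows "integrable M (\<lambda>x. 2 / \<epsilon>\<^sup>2 * (sqrt ((u x)\<^sup>2 + \<epsilon>\<^sup>2) - u x) * sqrt ((u x)\<^sup>2 + \<epsilon>\<^sup>2) * (norm (grad \<phi> x))\<^sup>2
     + lam * (\<phi> x)\<^sup>2 * (u x * (2 / \<epsilon>\<^sup>2 * (sqrt ((u x)\<^sup>2 + \<epsilon>\<^sup>2) - u x))))" (is "integrable M ?R")
    and "AE x in M. norm (2 / \<epsilon>\<^sup>2 * (sqrt ((u x)\<^sup>2 + \<epsilon>\<^sup>2) - u x) * sqrt ((u x)\<^sup>2 + \<epsilon>\<^sup>2) * (norm (grad \<phi> x))\<^sup>2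
     + lam * (\<phi> x)\<^sup>2 * (u x * (2 / \<epsilon>\<^sup>2 * (sqrt ((u x)\<^sup>2 + \<epsilon>\<^sup>2) - u x)))) \<le> 2 * (norm (grad \<phi> x))\<^sup>2 + 2 * lam * (\<phi> x)\<^sup>2"
proof -
  show bd: "AE x in M. norm (?R x) \<le> 2 * (norm (grad \<phi> x))\<^sup>2 + 2 * lam * (\<phi> x)\<^sup>2"
    using pos
  proof eventually_elim
    case (elim x)
    define q where "q = sqrt ((u x)\<^sup>2 + \<epsilon>\<^sup>2)"
    define \<beta> where "\<beta> = 2 / \<epsilon>\<^sup>2 * (sqrt ((u x)\<^sup>2 + \<epsilon>\<^sup>2) - u x)"
    have \<beta>: "q > 0" "\<beta> > 0" "\<beta> = 2 / (q + u x)"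
      unfolding q_def \<beta>_def using regularized_reciprocal_bounds(1-3)[OF \<epsilon>, of "u x"] by auto
    have 1: "\<beta> * q \<le> 2" "u x * \<beta> \<le> 2" unfolding \<beta>(3) using \<beta>(1) elim by (auto simp: divide_le_eq)
    have 2: "\<beta> * q * (norm (grad \<phi> x))\<^sup>2 \<le> 2 * (norm (grad \<phi> x))\<^sup>2"
      using 1 by (intro mult_right_mono) auto
    have 3: "lam * (\<phi> x)\<^sup>2 * (u x * \<beta>) \<le> lam * (\<phi> x)\<^sup>2 * 2"
      using 1 lam by (intro mult_left_mono) auto
    have "0 \<le> \<beta> * q * (norm (grad \<phi> x))\<^sup>2" "0 \<le> lam * (\<phi> x)\<^sup>2 * (u x * \<beta>)"
      using \<beta> elim lam by auto
    thus ?case using 2 3 unfolding \<beta>_def[symmetric] unfolding q_def[symmetric] by simp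
  qed
  show "integrable M ?R"
  proof (rule Bochner_Integration.integrable_bound)
    show "integrable M (\<lambda>x. 2 * (norm (grad \<phi> x))\<^sup>2 + 2 * lam * (\<phi> x)\<^sup>2)" using pi by simp
    show "?R \<in> borel_measurable M" using um pm by simp
    show "AE x in M. norm (?R x) \<le> norm (2 * (norm (grad \<phi> x))\<^sup>2 + 2 * lam * (\<phi> x)\<^sup>2)"
      using bd by eventually_elim (use lam in auto)
  qed
qed

text \<open>The equation is tested with \<phi>^2 times \<open>\<beta>\<close> of test functions
  tending to \<open>u\<close>. At fixed \<open>\<epsilon>\<close> the gradient side converges by
  dominated convergence and the potential side is bounded by Fatou's lemma; the pointwise Picone
  inequality then eliminates \<open>g\<close>.\<close>

lemma Picone_regularized:
  fixes u :: "real^'N \<Rightarrow> real"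
  assumes \<Omega>: "open \<Omega>" and u: "u \<in> L2 \<Omega>" and g: "g \<in> L2 \<Omega>"
    and ap: "\<And>\<epsilon>. \<epsilon> > 0 \<Longrightarrow> \<exists>\<phi>\<in>test_functions \<Omega>.
        (\<integral>x. (u x - \<phi> x)\<^sup>2 + (norm (g x - grad \<phi> x))\<^sup>2 \<partial>lebesgue_on \<Omega>) < \<epsilon>"
    and pos: "AE x in lebesgue_on \<Omega>. u x > 0" and lam: "lam \<ge> 0"
    and V: "\<And>x. V x \<ge> 0"
    and eq: "\<And>v. v \<in> test_functions \<Omega> \<Longrightarrow> has_bochner_integral (lebesgue_on \<Omega>)
        (\<lambda>x. V x * u x * v x) (\<integral>x. g x \<bullet> grad v x + lam * u x * v x \<partial>lebesgue_on \<Omega>)"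
    and \<phi>: "\<phi> \<in> test_functions \<Omega>" and \<epsilon>: "\<epsilon> > 0"
  defines "q \<equiv> \<lambda>t. sqrt (t\<^sup>2 + \<epsilon>\<^sup>2)" and "\<beta> \<equiv> \<lambda>t. 2 / \<epsilon>\<^sup>2 * (sqrt (t\<^sup>2 + \<epsilon>\<^sup>2) - t)"
  shows "(\<integral>\<^sup>+x. ennreal (V x * u x * ((\<phi> x)\<^sup>2 * \<beta> (u x))) \<partial>lebesgue_on \<Omega>) \<le>
    ennreal (\<integral>x. \<beta> (u x) * q (u x) * (norm (grad \<phi> x))\<^sup>2 + lam * (\<phi> x)\<^sup>2 * (u x * \<beta> (u x)) \<partial>lebesgue_on \<Omega>)"
proof -
  let ?M = "lebesgue_on \<Omega>"
  have \<beta>: "q t > 0" "\<beta> t > 0" "\<beta> t = 2 / (q t + t)" "\<bar>\<beta> t\<bar> \<le> 2 / \<epsilon> + 4 / \<epsilon>\<^sup>2 * \<bar>t\<bar>"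
    "\<beta> t / q t \<le> 4 / \<epsilon>\<^sup>2" for t
    unfolding q_def \<beta>_def by (rule regularized_reciprocal_bounds[OF \<epsilon>])+
  have um: "u \<in> borel_measurable ?M" and gm: "g \<in> borel_measurable ?M"
    and ui: "integrable ?M (\<lambda>x. (u x)\<^sup>2)" and gi: "integrable ?M (\<lambda>x. (norm (g x))\<^sup>2)"
    using u g by (auto simp: L2_def)
  have pm: "\<phi> \<in> borel_measurable ?M" "grad \<phi> \<in> borel_measurable ?M"
    and pi: "integrable ?M (\<lambda>x. (\<phi> x)\<^sup>2)" "integrable ?M (\<lambda>x. (norm (grad \<phi> x))\<^sup>2)"
    using test_L2[OF \<phi> \<Omega>] by (auto simp: L2_def)
  have cq: "continuous_on UNIV q" and cb: "continuous_on UNIV \<beta>"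
    unfolding q_def \<beta>_def by (intro continuous_intros)+
  have qm: "(\<lambda>x. q (f x)) \<in> borel_measurable ?M" and bm: "(\<lambda>x. \<beta> (f x)) \<in> borel_measurable ?M"
    if "f \<in> borel_measurable ?M" for f
    using borel_measurable_continuous_on[OF cq that] borel_measurable_continuous_on[OF cb that] by auto
  obtain \<psi> E where \<psi>: "\<And>k::nat. \<psi> k \<in> test_functions \<Omega>" and E: "integrable ?M E"
    and conv: "AE x in ?M. (\<forall>k. (\<psi> k x)\<^sup>2 \<le> E x \<and> (norm (grad (\<psi> k) x))\<^sup>2 \<le> E x) \<and>
       (\<lambda>k. \<psi> k x) \<longlonglongrightarrow> u x \<and> (\<lambda>k. grad (\<psi> k) x) \<longlonglongrightarrow> g x"
    by (rule H1_0_sequence[OF \<Omega> u g ap]) (assumption | rule that)+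
  \<comment> \<open>Written as \<open>\<phi>\<close> times a smooth function, this is a test
    function. It is nonnegative even where \<open>\<psi> k\<close> is negative, since
    \<open>\<beta>\<close> is positive on the whole line.\<close>
  define v where "v k x = \<phi> x * (\<phi> x * \<beta> (\<psi> k x))" for k x
  have smooth: "C_k m (\<lambda>x. \<beta> (\<psi> k x))" for m k
    unfolding \<beta>_def by (rule C_k_regularized_reciprocal[OF \<epsilon> test_C_k[OF \<psi>]])
  have vt: "v k \<in> test_functions \<Omega>" for k
    unfolding v_def[abs_def] by (intro test_mult[OF \<phi>] C_k_mult test_C_k[OF \<phi>] smooth)
  have gv: "grad (v k) x = (2 * \<phi> x * \<beta> (\<psi> k x)) *\<^sub>R grad \<phi> x
      - ((\<phi> x)\<^sup>2 * (\<beta> (\<psi> k x) / q (\<psi> k x))) *\<^sub>R grad (\<psi> k) x" for k x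
  proof -
    have gb: "((\<lambda>x. \<beta> (\<psi> k x)) has_derivative (\<lambda>h. ((- \<beta> (\<psi> k x) / q (\<psi> k x)) *\<^sub>R grad (\<psi> k) x) \<bullet> h)) (at x)"
      using has_derivative_compose[OF grad_inner[OF test_differentiable[OF \<psi>]]
         regularized_reciprocal_derivative[OF \<epsilon>, folded q_def \<beta>_def, unfolded has_field_derivative_def]]
      by (simp add: q_def \<beta>_def)
    have d: "\<phi> differentiable (at x)" "(\<lambda>x. \<beta> (\<psi> k x)) differentiable (at x)"
      using test_differentiable[OF \<phi>] gb by (auto simp: differentiable_def)
    have "grad (v k) x = \<phi> x *\<^sub>R (\<phi> x *\<^sub>R grad (\<lambda>x. \<beta> (\<psi> k x)) x + \<beta> (\<psi> k x) *\<^sub>R grad \<phi> x)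
        + (\<phi> x * \<beta> (\<psi> k x)) *\<^sub>R grad \<phi> x"
      unfolding v_def[abs_def] using d by (simp add: grad_mult differentiable_mult)
    thus ?thesis unfolding grad_eq_innerI[OF gb]
      by (simp add: vec_eq_iff power2_eq_square algebra_simps)
  qed
  define F where "F k x = g x \<bullet> grad (v k) x + lam * u x * v k x" for k x
  \<comment> \<open>The limit of \<open>F k\<close>: \<open>u\<close> and \<open>g\<close> replace
    the approximant and its gradient.\<close>
  define F' where "F' x = g x \<bullet> ((2 * \<phi> x * \<beta> (u x)) *\<^sub>R grad \<phi> x
      - ((\<phi> x)\<^sup>2 * (\<beta> (u x) / q (u x))) *\<^sub>R g x) + lam * u x * (\<phi> x * (\<phi> x * \<beta> (u x)))" for x
  obtain B1 where B1: "B1 > 0" "\<And>x. \<bar>\<phi> x\<bar> \<le> B1" using test_bounded[OF \<phi>] by blast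
  obtain B2 where B2: "B2 > 0" "\<And>x. norm (grad \<phi> x) \<le> B2" using test_grad_bounded[OF \<phi>] by blast
  define a b where "a = 2 / \<epsilon>" and "b = 4 / \<epsilon>\<^sup>2"
  have ab: "a \<ge> 0" "b \<ge> 0" using \<epsilon> by (auto simp: a_def b_def)
  define C where "C = 2 * B2 * a + 2 * B1 * B2 * b + B1\<^sup>2 * b + lam * B1 * a + lam * B1\<^sup>2 * b"
  define W where "W x = C * ((\<phi> x)\<^sup>2 + (u x)\<^sup>2 + (norm (g x))\<^sup>2 + E x)" for x
  have Wi: "integrable ?M W" unfolding W_def using pi ui gi E by simp
  have Fm: "F k \<in> borel_measurable ?M" for k
    unfolding F_def using um gm
      continuous_borel_measurable_lebesgue_on[OF test_continuous[OF vt[of k]], of \<Omega>]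
      continuous_borel_measurable_lebesgue_on[OF test_grad_continuous[OF vt[of k]], of \<Omega>] by simp
  have F'm: "F' \<in> borel_measurable ?M"
    unfolding F'_def using um gm pm qm[OF um] bm[OF um] by simp
  have lim: "AE x in ?M. (\<lambda>k. F k x) \<longlonglongrightarrow> F' x"
    using conv
  proof eventually_elim
    case (elim x)
    have 1: "(\<lambda>k. \<psi> k x) \<longlonglongrightarrow> u x" and 2: "(\<lambda>k. grad (\<psi> k) x) \<longlonglongrightarrow> g x" using elim by auto
    have "isCont \<beta> (u x)" "isCont q (u x)" using cq cb by (auto simp: continuous_on_eq_continuous_at)
    hence 3: "(\<lambda>k. \<beta> (\<psi> k x)) \<longlonglongrightarrow> \<beta> (u x)" "(\<lambda>k. q (\<psi> k x)) \<longlonglongrightarrow> q (u x)"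
      using 1 isCont_tendsto_compose by blast+
    have "q (u x) \<noteq> 0" using \<beta>(1)[of "u x"] by simp
    thus ?case unfolding F_def F'_def gv unfolding v_def by (intro tendsto_intros 1 2 3)
  qed
  have bound: "AE x in ?M. norm (F k x) \<le> W x" for k
    using conv
  proof eventually_elim
    case (elim x)
    have e: "(\<psi> k x)\<^sup>2 \<le> E x" "(norm (grad (\<psi> k) x))\<^sup>2 \<le> E x" using elim by auto
    have "\<bar>g x \<bullet> grad (v k) x\<bar> \<le> norm (g x) * norm (grad (v k) x)" by (rule Cauchy_Schwarz_ineq2)
    also have "norm (grad (v k) x) \<le> 2 * \<bar>\<phi> x\<bar> * \<bar>\<beta> (\<psi> k x)\<bar> * norm (grad \<phi> x)
        + (\<phi> x)\<^sup>2 * (\<beta> (\<psi> k x) / q (\<psi> k x)) * norm (grad (\<psi> k) x)"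
      unfolding gv using \<beta>(1,2)[of "\<psi> k x"]
      by (intro order_trans[OF norm_triangle_ineq4]) (simp add: abs_mult)
    finally have "\<bar>F k x\<bar> \<le> norm (g x) * (2 * \<bar>\<phi> x\<bar> * \<bar>\<beta> (\<psi> k x)\<bar> * norm (grad \<phi> x)
        + (\<phi> x)\<^sup>2 * (\<beta> (\<psi> k x) / q (\<psi> k x)) * norm (grad (\<psi> k) x)) + lam * \<bar>u x\<bar> * ((\<phi> x)\<^sup>2 * \<bar>\<beta> (\<psi> k x)\<bar>)"
      using lam unfolding F_def v_def
      by (intro order_trans[OF abs_triangle_ineq] add_mono)
        (auto simp: mult_left_mono abs_mult power2_eq_square)
    also have "\<dots> \<le> C * ((\<phi> x)\<^sup>2 + (u x)\<^sup>2 + (norm (g x))\<^sup>2 + E x)"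
      unfolding C_def
      by (rule Picone_majorant[of "\<phi> x" B1 "norm (grad \<phi> x)" B2 "\<beta> (\<psi> k x)" a b "\<psi> k x"])
        (use B1 B2 \<beta>[of "\<psi> k x"] e lam ab in \<open>auto simp: a_def b_def\<close>)
    finally show ?case by (simp add: W_def)
  qed
  have L: "(\<lambda>k. \<integral>x. F k x \<partial>?M) \<longlonglongrightarrow> (\<integral>x. F' x \<partial>?M)"
    by (rule integral_dominated_convergence[OF F'm Fm Wi lim bound])
  have F'i: "integrable ?M F'" by (rule integrable_dominated_convergence[OF F'm Fm Wi lim bound])
  have vm: "v k \<in> borel_measurable ?M" for k
    by (rule continuous_borel_measurable_lebesgue_on[OF test_continuous[OF vt]])
  have "(\<integral>\<^sup>+x. ennreal (V x * u x * ((\<phi> x)\<^sup>2 * \<beta> (u x))) \<partial>?M) \<le> ennreal (\<integral>x. F' x \<partial>?M)"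
  proof (rule nn_integral_limit_le[OF _ _ _ L])
    show "(\<lambda>x. V x * u x * v k x) \<in> borel_measurable ?M" for k
      using eq[OF vt[of k]] by (simp add: has_bochner_integral_iff borel_measurable_integrable)
    show "AE x in ?M. (\<lambda>k. V x * u x * v k x) \<longlonglongrightarrow> V x * u x * ((\<phi> x)\<^sup>2 * \<beta> (u x))"
      using conv
    proof eventually_elim
      case (elim x)
      have 1: "(\<lambda>k. \<psi> k x) \<longlonglongrightarrow> u x" using elim by auto
      have "isCont \<beta> (u x)" using cb by (auto simp: continuous_on_eq_continuous_at)
      hence "(\<lambda>k. \<beta> (\<psi> k x)) \<longlonglongrightarrow> \<beta> (u x)" using 1 isCont_tendsto_compose by blast
      hence "(\<lambda>k. V x * u x * (\<phi> x * (\<phi> x * \<beta> (\<psi> k x)))) \<longlonglongrightarrow> V x * u x * (\<phi> x * (\<phi> x * \<beta> (u x)))"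
        by (intro tendsto_intros)
      thus ?case by (simp add: v_def power2_eq_square mult.assoc)
    qed
    show "(\<integral>\<^sup>+x. ennreal (V x * u x * v k x) \<partial>?M) \<le> ennreal (\<integral>x. F k x \<partial>?M)" for k
    proof -
      \<comment> \<open>Nonnegativity turns the Bochner integral of the equation into the
        nonnegative integral to which Fatou's lemma applies.\<close>
      have "AE x in ?M. 0 \<le> V x * u x * v k x"
        using pos
      proof eventually_elim
        case (elim x)
        have "v k x = (\<phi> x)\<^sup>2 * \<beta> (\<psi> k x)" by (simp add: v_def power2_eq_square)
        thus ?case using V[of x] elim \<beta>(2)[of "\<psi> k x"] by simp
      qed
      thus ?thesis using eq[OF vt[of k]]
        by (subst nn_integral_eq_integral) (auto simp: has_bochner_integral_iff F_def[abs_def])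
    qed
  qed
  also have "\<dots> \<le> ennreal (\<integral>x. \<beta> (u x) * q (u x) * (norm (grad \<phi> x))\<^sup>2 + lam * (\<phi> x)\<^sup>2 * (u x * \<beta> (u x)) \<partial>?M)"
  proof (intro ennreal_leI integral_mono_AE F'i)
    show "AE x in ?M. F' x \<le> \<beta> (u x) * q (u x) * (norm (grad \<phi> x))\<^sup>2 + lam * (\<phi> x)\<^sup>2 * (u x * \<beta> (u x))"
    proof (rule AE_I2)
      fix x
      show "F' x \<le> \<beta> (u x) * q (u x) * (norm (grad \<phi> x))\<^sup>2 + lam * (\<phi> x)\<^sup>2 * (u x * \<beta> (u x))"
        using Picone_integrand_bound[OF \<beta>(2,1)[of "u x"], of "\<phi> x" "g x" "grad \<phi> x"]
        unfolding F'_def power2_norm_eq_inner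
        by (simp add: inner_diff_right power2_eq_square mult_ac)
    qed
    show "integrable ?M (\<lambda>x. \<beta> (u x) * q (u x) * (norm (grad \<phi> x))\<^sup>2 + lam * (\<phi> x)\<^sup>2 * (u x * \<beta> (u x)))"
      unfolding q_def \<beta>_def by (rule Picone_rhs_integrable(1)[OF \<epsilon> um pos pm pi lam])
  qed
  finally show ?thesis .
qed

text \<open>Let the regularisation parameter tend to 0: where u > 0, both \<open>\<beta> * q\<close>
  and \<open>u * \<beta>\<close> tend to 1. The result is nonnegativity of the form of -Delta + lam
  - V on test functions.\<close>

lemma Picone_test:
  fixes u :: "real^'N \<Rightarrow> real"
  assumes \<Omega>: "open \<Omega>" and u: "u \<in> L2 \<Omega>" and g: "g \<in> L2 \<Omega>"
    and ap: "\<And>\<epsilon>. \<epsilon> > 0 \<Longrightarrow> \<exists>\<phi>\<in>test_functions \<Omega>.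
        (\<integral>x. (u x - \<phi> x)\<^sup>2 + (norm (g x - grad \<phi> x))\<^sup>2 \<partial>lebesgue_on \<Omega>) < \<epsilon>"
    and pos: "AE x in lebesgue_on \<Omega>. u x > 0" and lam: "lam \<ge> 0"
    and V: "\<And>x. V x \<ge> 0" and Vm: "V \<in> borel_measurable (lebesgue_on \<Omega>)"
    and eq: "\<And>v. v \<in> test_functions \<Omega> \<Longrightarrow> has_bochner_integral (lebesgue_on \<Omega>)
        (\<lambda>x. V x * u x * v x) (\<integral>x. g x \<bullet> grad v x + lam * u x * v x \<partial>lebesgue_on \<Omega>)"
    and \<phi>: "\<phi> \<in> test_functions \<Omega>"
  shows "(\<integral>\<^sup>+x. ennreal (V x * (\<phi> x)\<^sup>2) \<partial>lebesgue_on \<Omega>) \<le>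
    ennreal (\<integral>x. (norm (grad \<phi> x))\<^sup>2 + lam * (\<phi> x)\<^sup>2 \<partial>lebesgue_on \<Omega>)"
proof -
  let ?M = "lebesgue_on \<Omega>"
  have um: "u \<in> borel_measurable ?M" using u by (auto simp: L2_def)
  have pm: "\<phi> \<in> borel_measurable ?M" "grad \<phi> \<in> borel_measurable ?M"
    and pi: "integrable ?M (\<lambda>x. (\<phi> x)\<^sup>2)" "integrable ?M (\<lambda>x. (norm (grad \<phi> x))\<^sup>2)"
    using test_L2[OF \<phi> \<Omega>] by (auto simp: L2_def)
  define e where "e n = 1 / real (Suc n)" for n
  have e: "e n > 0" for n by (simp add: e_def)
  have e0: "e \<longlonglongrightarrow> 0" unfolding e_def[abs_def] using LIMSEQ_inverse_real_of_nat
    by (simp add: inverse_eq_divide)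
  define q where "q n t = sqrt (t\<^sup>2 + (e n)\<^sup>2)" for n t
  define \<beta> where "\<beta> n t = 2 / (e n)\<^sup>2 * (sqrt (t\<^sup>2 + (e n)\<^sup>2) - t)" for n t
  have \<beta>: "\<beta> n t = 2 / (q n t + t)" for n t
    unfolding q_def \<beta>_def by (rule regularized_reciprocal_bounds(3)[OF e])
  have lim: "(\<lambda>n. \<beta> n t * q n t) \<longlonglongrightarrow> 1" "(\<lambda>n. t * \<beta> n t) \<longlonglongrightarrow> 1" if t: "t > 0" for t
  proof -
    have "(\<lambda>n. sqrt (t\<^sup>2 + (e n)\<^sup>2)) \<longlonglongrightarrow> sqrt (t\<^sup>2 + 0\<^sup>2)" by (intro tendsto_intros e0)
    hence q: "(\<lambda>n. q n t) \<longlonglongrightarrow> t" using t by (simp add: q_def)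
    have "(\<lambda>n. 2 / (q n t + t) * q n t) \<longlonglongrightarrow> 2 / (t + t) * t" by (intro tendsto_intros q) (use t in simp)
    thus "(\<lambda>n. \<beta> n t * q n t) \<longlonglongrightarrow> 1" using t by (simp add: \<beta>)
    have "(\<lambda>n. t * (2 / (q n t + t))) \<longlonglongrightarrow> t * (2 / (t + t))" by (intro tendsto_intros q) (use t in simp)
    thus "(\<lambda>n. t * \<beta> n t) \<longlonglongrightarrow> 1" using t by (simp add: \<beta>)
  qed
  define R where "R n x = \<beta> n (u x) * q n (u x) * (norm (grad \<phi> x))\<^sup>2 + lam * (\<phi> x)\<^sup>2 * (u x * \<beta> n (u x))" for n x
  define R' where "R' x = (norm (grad \<phi> x))\<^sup>2 + lam * (\<phi> x)\<^sup>2" for x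
  have Ri: "integrable ?M (R n)" for n
    unfolding R_def q_def \<beta>_def by (rule Picone_rhs_integrable(1)[OF e um pos pm pi lam])
  have Rb: "AE x in ?M. norm (R n x) \<le> 2 * (norm (grad \<phi> x))\<^sup>2 + 2 * lam * (\<phi> x)\<^sup>2" for n
    unfolding R_def q_def \<beta>_def by (rule Picone_rhs_integrable(2)[OF e um pos pm pi lam])
  have "(\<lambda>n. \<integral>x. R n x \<partial>?M) \<longlonglongrightarrow> (\<integral>x. R' x \<partial>?M)"
  proof (rule integral_dominated_convergence[OF _ _ _ _ Rb])
    show "R' \<in> borel_measurable ?M" unfolding R'_def using pm by simp
    show "R n \<in> borel_measurable ?M" for n using Ri by auto
    show "integrable ?M (\<lambda>x. 2 * (norm (grad \<phi> x))\<^sup>2 + 2 * lam * (\<phi> x)\<^sup>2)" using pi by simp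
    show "AE x in ?M. (\<lambda>n. R n x) \<longlonglongrightarrow> R' x"
      using pos
    proof eventually_elim
      case (elim x)
      have "(\<lambda>n. R n x) \<longlonglongrightarrow> 1 * (norm (grad \<phi> x))\<^sup>2 + lam * (\<phi> x)\<^sup>2 * 1"
        unfolding R_def by (intro tendsto_intros lim[OF elim])
      thus ?case by (simp add: R'_def)
    qed
  qed
  hence "(\<integral>\<^sup>+x. ennreal (V x * (\<phi> x)\<^sup>2) \<partial>?M) \<le> ennreal (\<integral>x. R' x \<partial>?M)"
  proof (rule nn_integral_limit_le[rotated 3])
    have "continuous_on UNIV (\<beta> n)" for n unfolding \<beta>_def by (intro continuous_intros)
    hence "(\<lambda>x. \<beta> n (u x)) \<in> borel_measurable ?M" for n using borel_measurable_continuous_on um by blast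
    thus "(\<lambda>x. V x * u x * ((\<phi> x)\<^sup>2 * \<beta> n (u x))) \<in> borel_measurable ?M" for n using Vm um pm by simp
    show "AE x in ?M. (\<lambda>n. V x * u x * ((\<phi> x)\<^sup>2 * \<beta> n (u x))) \<longlonglongrightarrow> V x * (\<phi> x)\<^sup>2"
      using pos
    proof eventually_elim
      case (elim x)
      have "(\<lambda>n. V x * (\<phi> x)\<^sup>2 * (u x * \<beta> n (u x))) \<longlonglongrightarrow> V x * (\<phi> x)\<^sup>2 * 1"
        by (intro tendsto_intros lim[OF elim])
      thus ?case by (simp add: mult_ac)
    qed
    show "(\<integral>\<^sup>+x. ennreal (V x * u x * ((\<phi> x)\<^sup>2 * \<beta> n (u x))) \<partial>?M) \<le> ennreal (\<integral>x. R n x \<partial>?M)" for n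
      unfolding R_def \<beta>_def q_def
      by (rule Picone_regularized[OF \<Omega> u g ap pos lam V eq \<phi> e])
  qed
  thus ?thesis by (simp add: R'_def)
qed

text \<open>Approximation of \<open>w\<close> by test functions, with a majorant on the energy side
  and Fatou's lemma on the other. As the left side is a nonnegative integral, the bound also shows
  that V w^2 is integrable.\<close>

lemma Picone_H1_0:
  fixes u :: "real^'N \<Rightarrow> real"
  assumes \<Omega>: "open \<Omega>" and u: "u \<in> L2 \<Omega>" and g: "g \<in> L2 \<Omega>"
    and ap: "\<And>\<epsilon>. \<epsilon> > 0 \<Longrightarrow> \<exists>\<phi>\<in>test_functions \<Omega>.
        (\<integral>x. (u x - \<phi> x)\<^sup>2 + (norm (g x - grad \<phi> x))\<^sup>2 \<partial>lebesgue_on \<Omega>) < \<epsilon>"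
    and pos: "AE x in lebesgue_on \<Omega>. u x > 0" and lam: "lam \<ge> 0"
    and V: "\<And>x. V x \<ge> 0" and Vm: "V \<in> borel_measurable (lebesgue_on \<Omega>)"
    and eq: "\<And>v. v \<in> test_functions \<Omega> \<Longrightarrow> has_bochner_integral (lebesgue_on \<Omega>)
        (\<lambda>x. V x * u x * v x) (\<integral>x. g x \<bullet> grad v x + lam * u x * v x \<partial>lebesgue_on \<Omega>)"
    and w: "w \<in> L2 \<Omega>" and h: "h \<in> L2 \<Omega>"
    and apw: "\<And>\<epsilon>. \<epsilon> > 0 \<Longrightarrow> \<exists>\<phi>\<in>test_functions \<Omega>.
        (\<integral>x. (w x - \<phi> x)\<^sup>2 + (norm (h x - grad \<phi> x))\<^sup>2 \<partial>lebesgue_on \<Omega>) < \<epsilon>"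
  shows "(\<integral>\<^sup>+x. ennreal (V x * (w x)\<^sup>2) \<partial>lebesgue_on \<Omega>) \<le>
    ennreal (\<integral>x. (norm (h x))\<^sup>2 + lam * (w x)\<^sup>2 \<partial>lebesgue_on \<Omega>)"
proof -
  let ?M = "lebesgue_on \<Omega>"
  have wm: "w \<in> borel_measurable ?M" "h \<in> borel_measurable ?M" using w h by (auto simp: L2_def)
  obtain \<psi> E where \<psi>: "\<And>k::nat. \<psi> k \<in> test_functions \<Omega>" and E: "integrable ?M E"
    and conv: "AE x in ?M. (\<forall>k. (\<psi> k x)\<^sup>2 \<le> E x \<and> (norm (grad (\<psi> k) x))\<^sup>2 \<le> E x) \<and>
       (\<lambda>k. \<psi> k x) \<longlonglongrightarrow> w x \<and> (\<lambda>k. grad (\<psi> k) x) \<longlonglongrightarrow> h x"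
    by (rule H1_0_sequence[OF \<Omega> w h apw]) (assumption | rule that)+
  have pm: "\<psi> k \<in> borel_measurable ?M" "grad (\<psi> k) \<in> borel_measurable ?M" for k
    using test_L2[OF \<psi> \<Omega>] by (auto simp: L2_def)
  have "(\<lambda>k. \<integral>x. (norm (grad (\<psi> k) x))\<^sup>2 + lam * (\<psi> k x)\<^sup>2 \<partial>?M) \<longlonglongrightarrow> (\<integral>x. (norm (h x))\<^sup>2 + lam * (w x)\<^sup>2 \<partial>?M)"
  proof (rule integral_dominated_convergence)
    show "(\<lambda>x. (norm (h x))\<^sup>2 + lam * (w x)\<^sup>2) \<in> borel_measurable ?M" using wm by simp
    show "(\<lambda>x. (norm (grad (\<psi> k) x))\<^sup>2 + lam * (\<psi> k x)\<^sup>2) \<in> borel_measurable ?M" for k using pm[of k] by simp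
    show "integrable ?M (\<lambda>x. E x + lam * E x)" using E by simp
    show "AE x in ?M. (\<lambda>k. (norm (grad (\<psi> k) x))\<^sup>2 + lam * (\<psi> k x)\<^sup>2) \<longlonglongrightarrow> (norm (h x))\<^sup>2 + lam * (w x)\<^sup>2"
      using conv by eventually_elim (auto intro!: tendsto_intros)
    show "AE x in ?M. norm ((norm (grad (\<psi> k) x))\<^sup>2 + lam * (\<psi> k x)\<^sup>2) \<le> E x + lam * E x" for k
      using conv
    proof eventually_elim
      case (elim x)
      hence "(\<psi> k x)\<^sup>2 \<le> E x" "(norm (grad (\<psi> k) x))\<^sup>2 \<le> E x" by auto
      moreover from this have "lam * (\<psi> k x)\<^sup>2 \<le> lam * E x" using lam by (intro mult_left_mono) auto
      ultimately show ?case using lam by simp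
    qed
  qed
  thus ?thesis
  proof (rule nn_integral_limit_le[rotated 3])
    show "(\<lambda>x. V x * (\<psi> k x)\<^sup>2) \<in> borel_measurable ?M" for k using Vm pm by simp
    show "AE x in ?M. (\<lambda>k. V x * (\<psi> k x)\<^sup>2) \<longlonglongrightarrow> V x * (w x)\<^sup>2"
      using conv by eventually_elim (auto intro!: tendsto_intros)
    show "(\<integral>\<^sup>+x. ennreal (V x * (\<psi> k x)\<^sup>2) \<partial>?M) \<le> ennreal (\<integral>x. (norm (grad (\<psi> k) x))\<^sup>2 + lam * (\<psi> k x)\<^sup>2 \<partial>?M)" for k
      by (rule Picone_test[OF \<Omega> u g ap pos lam V Vm eq \<psi>])
  qed
qed

section \<open>From the system of equations to the Gram matrix\<close>

lemma integral_lebesgue_on_open_pos: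
  fixes f :: "'a::euclidean_space \<Rightarrow> real"
  assumes "open \<Omega>" "\<Omega> \<noteq> {}" and f: "integrable (lebesgue_on \<Omega>) f" and pos: "AE x in lebesgue_on \<Omega>. f x > 0"
  shows "(\<integral>x. f x \<partial>lebesgue_on \<Omega>) > 0"
proof -
  have nn: "AE x in lebesgue_on \<Omega>. 0 \<le> f x" using pos by eventually_elim simp
  have "(\<integral>x. f x \<partial>lebesgue_on \<Omega>) \<noteq> 0"
  proof
    assume "(\<integral>x. f x \<partial>lebesgue_on \<Omega>) = 0"
    hence "AE x in lebesgue_on \<Omega>. f x = 0" using integral_nonneg_eq_0_iff_AE[OF f nn] by simp
    with pos have "AE x in lebesgue_on \<Omega>. False" by eventually_elim simp
    hence "emeasure (lebesgue_on \<Omega>) (space (lebesgue_on \<Omega>)) = 0"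
      by (simp add: AE_iff_measurable[OF _ refl])
    hence "emeasure lebesgue \<Omega> = 0" using assms(1) by (simp add: emeasure_restrict_space)
    hence "negligible \<Omega>" using assms(1) by (simp add: negligible_iff_emeasure0)
    thus False using open_not_negligible assms(1,2) by blast
  qed
  thus ?thesis using Bochner_Integration.integral_nonneg_AE[OF nn] by simp
qed

theorem corollary5p2:
  fixes \<Omega> :: "(real^'N) set" and lam :: real and A :: "real^'n^'n"
  assumes "CARD('N) \<le> 3"
    and "open \<Omega>" and "connected \<Omega>" and "\<Omega> \<noteq> {}"
    and "lam > 0"
    and "transpose A = A"
    and "num_positive_eigenvalues A = 1"
    and "\<forall>i j. A $ i $ j \<ge> 0"
    and "\<forall>i. (\<Sum>j\<in>UNIV. A $ i $ j) > 0"
    and "\<not> (\<exists>c :: real^'n. (\<forall>i. (\<Sum>j\<in>UNIV. A $ i $ j * (c $ j)\<^sup>2) = 1) \<and> (\<forall>i. c $ i \<noteq> 0))"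
  shows "\<not> (\<exists>u :: 'n \<Rightarrow> real^'N \<Rightarrow> real. positive_vector_solution \<Omega> lam A u)"
proof
  let ?M = "lebesgue_on \<Omega>"
  assume "\<exists>u :: 'n \<Rightarrow> real^'N \<Rightarrow> real. positive_vector_solution \<Omega> lam A u"
  then obtain u :: "'n \<Rightarrow> real^'N \<Rightarrow> real" where ws: "weak_solution \<Omega> lam A u"
    and pos: "\<And>i. AE x in ?M. u i x > 0" by (auto simp: positive_vector_solution_def)
  have Ann: "A $ i $ j \<ge> 0" for i j using assms(8) by simp
  have u0: "u i \<in> H1_0 \<Omega>" for i
    using ws sol_space_subset_H1_0 by (auto simp: weak_solution_def)
  hence uL: "u i \<in> L2 \<Omega>" for i by (simp add: H1_0_def)
  hence um: "u i \<in> borel_measurable ?M" for i by (simp add: L2_def)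
  \<comment> \<open>The gradients are chosen as those for which the approximation by test functions
    holds; the weak formulation applies to every weak gradient, hence to these.\<close>
  have "\<forall>i. \<exists>g. g \<in> L2 \<Omega> \<and> has_weak_gradient \<Omega> (u i) g \<and> (\<forall>\<epsilon>>0. \<exists>\<phi>\<in>test_functions \<Omega>.
        (\<integral>x. (u i x - \<phi> x)\<^sup>2 + (norm (g x - grad \<phi> x))\<^sup>2 \<partial>?M) < \<epsilon>)"
    using u0 unfolding H1_0_def by blast
  from choice[OF this] obtain g where g: "\<And>i. g i \<in> L2 \<Omega>" "\<And>i. has_weak_gradient \<Omega> (u i) (g i)"
    and ap: "\<And>i \<epsilon>. \<epsilon> > 0 \<Longrightarrow> \<exists>\<phi>\<in>test_functions \<Omega>.
        (\<integral>x. (u i x - \<phi> x)\<^sup>2 + (norm (g i x - grad \<phi> x))\<^sup>2 \<partial>?M) < \<epsilon>" by blast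
  define f where "f i x = (u i x)\<^sup>2" for i x
  define V where "V i x = (\<Sum>j\<in>UNIV. A $ i $ j * f j x)" for i x
  have fm: "f i \<in> borel_measurable ?M" for i unfolding f_def using um[of i] by simp
  have Vm: "V i \<in> borel_measurable ?M" for i unfolding V_def using fm by simp
  have V0: "V i x \<ge> 0" for i x unfolding V_def f_def using Ann by (intro sum_nonneg) simp
  have nonlin: "(\<Sum>j\<in>UNIV. A $ i $ j * u i x * (u j x)\<^sup>2) = V i x * u i x" for i x
    by (simp add: V_def f_def sum_distrib_left mult_ac)
  have sol: "has_bochner_integral ?M (\<lambda>x. V i x * u i x * v x) (\<integral>x. g i x \<bullet> h x + lam * u i x * v x \<partial>?M)"
    if "v \<in> H1_0 \<Omega>" "has_weak_gradient \<Omega> v h" for i v h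
    using ws that g(2)[of i] unfolding weak_solution_def nonlin by blast
  have sol_test: "has_bochner_integral ?M (\<lambda>x. V i x * u i x * v x) (\<integral>x. g i x \<bullet> grad v x + lam * u i x * v x \<partial>?M)"
    if "v \<in> test_functions \<Omega>" for i v
    by (rule sol[OF test_H1_0[OF that assms(2)] test_weak_gradient[OF that assms(2)]])
  \<comment> \<open>The j-th equation tested with u_j itself: the diagonal entry M_jj is the energy
    of u_j.\<close>
  have sol_self: "has_bochner_integral ?M (\<lambda>x. V j x * f j x) (\<integral>x. (norm (g j x))\<^sup>2 + lam * (u j x)\<^sup>2 \<partial>?M)" for j
    using sol[OF u0[of j] g(2)[of j], of j]
    unfolding power2_norm_eq_inner f_def by (simp add: power2_eq_square mult.assoc)
  \<comment> \<open>The positive solution is \<open>u i\<close>, with potential \<open>V i\<close>;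
    the function inserted into the form is \<open>u j\<close>, whose energy is rewritten by
    \<open>sol_self\<close>.\<close>
  have Picone: "(\<integral>\<^sup>+x. ennreal (V i x * f j x) \<partial>?M) \<le> ennreal (\<integral>x. V j x * f j x \<partial>?M)" for i j
    using Picone_H1_0[OF assms(2) uL g(1) ap pos _ V0 Vm sol_test uL[of j] g(1)[of j] ap, of i] assms(5)
      has_bochner_integral_integral_eq[OF sol_self[of j]] by (simp add: f_def)
  \<comment> \<open>Finiteness comes from the Picone bound, whose right side is a real
    number.\<close>
  have Vi: "integrable ?M (\<lambda>x. V i x * f j x)" for i j
  proof (rule integrableI_bounded)
    show "(\<lambda>x. V i x * f j x) \<in> borel_measurable ?M" using Vm fm by simp
    have "(\<integral>\<^sup>+x. ennreal (norm (V i x * f j x)) \<partial>?M) = (\<integral>\<^sup>+x. ennreal (V i x * f j x) \<partial>?M)"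
      using V0 by (simp add: f_def abs_mult)
    also have "\<dots> < \<infinity>" using Picone[of i j] by (auto intro: le_less_trans)
    finally show "(\<integral>\<^sup>+x. ennreal (norm (V i x * f j x)) \<partial>?M) < \<infinity>" .
  qed
  have Vle: "(\<integral>x. V i x * f j x \<partial>?M) \<le> (\<integral>x. V j x * f j x \<partial>?M)" for i j
  proof -
    have "ennreal (\<integral>x. V i x * f j x \<partial>?M) = (\<integral>\<^sup>+x. ennreal (V i x * f j x) \<partial>?M)"
      by (rule nn_integral_eq_integral[symmetric]) (use Vi V0 in \<open>auto simp: f_def\<close>)
    moreover have "(\<integral>x. V j x * f j x \<partial>?M) \<ge> 0"
      by (rule Bochner_Integration.integral_nonneg) (simp add: V0 f_def)
    ultimately show ?thesis using Picone[of i j] by (metis ennreal_le_iff)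
  qed
  \<comment> \<open>Positivity of the k-th row sum and symmetry give an \<open>i\<close> with A_ik >
    0. Then f_k <= V_i / A_ik, and integrability carries over from V_i f_j.\<close>
  have fi: "integrable ?M (\<lambda>x. f k x * f j x)" for k j
  proof -
    have "(\<Sum>i\<in>UNIV. A $ k $ i) \<noteq> 0" using assms(9) by (metis less_irrefl)
    then obtain i where "A $ k $ i \<noteq> 0" by (meson sum.neutral)
    moreover have "A $ i $ k = A $ k $ i"
      using arg_cong[OF assms(6), of "\<lambda>B. B $ k $ i"] by (simp add: transpose_def)
    ultimately have a: "A $ i $ k > 0" using Ann[of i k] by simp
    have "integrable ?M (\<lambda>x. (1 / A $ i $ k) * (V i x * f j x))" using Vi by simp
    thus ?thesis
    proof (rule Bochner_Integration.integrable_bound)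
      show "(\<lambda>x. f k x * f j x) \<in> borel_measurable ?M" using fm by simp
      have "norm (f k x * f j x) \<le> norm (1 / A $ i $ k * (V i x * f j x))" for x
      proof -
        have "A $ i $ k * f k x \<le> V i x"
          unfolding V_def by (rule member_le_sum) (auto simp: f_def Ann)
        hence "f k x \<le> (1 / A $ i $ k) * V i x" using a by (simp add: field_simps)
        hence "f k x * f j x \<le> (1 / A $ i $ k) * V i x * f j x" by (intro mult_right_mono) (auto simp: f_def)
        also have "\<dots> \<le> \<bar>1 / A $ i $ k * (V i x * f j x)\<bar>" unfolding mult.assoc by (rule abs_ge_self)
        finally show ?thesis by (simp add: f_def)
      qed
      thus "AE x in ?M. norm (f k x * f j x) \<le> norm (1 / A $ i $ k * (V i x * f j x))" by simp
    qed
  qed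
  have fpos: "(\<integral>x. f k x * f j x \<partial>?M) > 0" for k j
  proof (rule integral_lebesgue_on_open_pos[OF assms(2,4) fi])
    show "AE x in ?M. f k x * f j x > 0" using pos[of k] pos[of j] by eventually_elim (simp add: f_def)
  qed
  have expand: "(\<Sum>k\<in>UNIV. A $ i $ k * (\<integral>x. f k x * f j x \<partial>?M)) = (\<integral>x. V i x * f j x \<partial>?M)" for i j
    unfolding V_def sum_distrib_right using fi by (simp add: mult.assoc)
  obtain s where s: "\<And>j. s j > 0" "\<And>i. (\<Sum>j\<in>UNIV. A $ i $ j * s j) = 1"
  proof (rule Gram_matrix_solution[OF assms(6,7), of ?M f])
    show "(\<Sum>k\<in>UNIV. A $ i $ k * (\<integral>x. f k x * f j x \<partial>?M)) \<le> (\<Sum>k\<in>UNIV. A $ j $ k * (\<integral>x. f k x * f j x \<partial>?M))" for i j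
      unfolding expand by (rule Vle)
  qed (use Ann assms(9) fi fpos in auto)
  have "(\<Sum>j\<in>UNIV. A $ i $ j * ((\<chi> j. sqrt (s j)) $ j)\<^sup>2) = 1" for i
    using s less_imp_le[OF s(1)] by simp
  moreover have "(\<chi> j. sqrt (s j)) $ i \<noteq> 0" for i using s(1)[of i] by simp
  ultimately show False using assms(10) by blast
qed

end
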